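(* Suppose $\sigma^2(x)\equiv\sigma^2$ and the following hold. (i) There is a constant $c_\pi>0$ such that $0\le \pi(x),\sigma^2(x)\le c_\pi$ for all $x\in\mathcal{X}$. (ii) There is a constant $\tau>0$ such that $E\{\epsilon^4|X\}<\tau$ almost surely. (iii) $c_\varphi:=\sup_{j\ge1}\|\varphi_j\|_{\sup}<\infty$ and $\sup_{k\ge1}\frac{\sum_{\nu=k+1}^\infty\mu_\nu}{k\mu_k}<\infty$. (iv) There exist nonnegative constants $a,b$ such that $\max_{1\le j\le s}\xi_j=O_P\left(\sqrt{\frac{\log^b N}{nh^a}}\right)$. (v) As $N\to\infty$, $h=o(1)$, $Nh^2\to\infty$ and $\log^bN=o(nh^{a+1})$. Then, under $H_0: f=0$, as $N\to\infty$, $$\frac{N^2}{\sigma(N)}\left(T_{N,\lambda}-\frac{\sigma^2}{Nh}\right)\overset{d}{\longrightarrow}N(0,1).$$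
   Context: Model: $(Y_i,X_i)$, $i=1,\dots,N$, are i.i.d. from $Y_i=f(X_i)+\epsilon_i$, with $E\{\epsilon_i|X_i\}=0$, $E\{\epsilon_i^2|X_i\}=\sigma^2(X_i)>0$, $X_i\in\mathcal{X}\subseteq\mathbb{R}^d$ with distribution (density) $\pi$, $Y_i\in\mathbb{R}$, and $f\in\mathcal{H}$ unknown. RKHS: $\mathcal{H}\subset L^2_\pi(\mathcal{X})$ is a reproducing kernel Hilbert space with inner product $\langle\cdot,\cdot\rangle_{\mathcal{H}}$ and kernel $R(x,x')=\sum_{i\ge1}\mu_i\varphi_i(x)\varphi_i(x')$, $\mu_1\ge\mu_2\ge\cdots\ge0$, where $\{\varphi_i\}$ is a basis of $L^2_\pi(\mathcal{X})$ with $\langle\varphi_i,\varphi_j\rangle_{L^2_\pi}=\delta_{ij}$ and $\langle\varphi_i,\varphi_j\rangle_{\mathcal{H}}=\delta_{ij}/\mu_i$. For $\lambda>0$ define $\langle f,g\rangle=V(f,g)+\lambda\langle f,g\rangle_{\mathcal{H}}$, $V(f,g)=E\{f(X)g(X)\}$, with norm $\|\cdot\|$; $(\mathcal{H},\langle\cdot,\cdot\rangle)$ is an RKHS with kernel $K(x,y)=\sum_{\nu\ge1}\frac{\varphi_\nu(x)\varphi_\nu(y)}{1+\lambda/\mu_\nu}$. $h^{-1}:=\sum_{\nu\ge1}\frac{1}{1+\lambda/\mu_\nu}$. $\|f\|_{\sup}=\sup_{x\in\mathcal{X}}|f(x)|$. Divide and conquer: the $N$ samples are randomly divided into $s$ subsamples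 with index sets $I_1,\dots,I_s$, $|I_j|=n$, $N=ns$. $\widehat f_j=\arg\min_{f\in\mathcal{H}}\frac1{2n}\sum_{i\in I_j}(Y_i-f(X_i))^2+\frac\lambda2\|f\|_{\mathcal{H}}^2$, $\bar f=\frac1s\sum_{j=1}^s\widehat f_j$, and $T_{N,\lambda}=\|\bar f\|^2$. Empirical process: $Pf=E_X\{f(X)\}$, $P_jf=n^{-1}\sum_{i\in I_j}f(X_i)$, $\xi_j=\sup_{f,g\in\mathcal{H},\,\|f\|=\|g\|=1}|P_jfg-Pfg|$. Variance: $W(N)=\sum_{1\le i<k\le N}2\epsilon_i\epsilon_kK(X_i,X_k)$ and $\sigma^2(N)=\mathrm{Var}(W(N))$. The quantities $s,n,\lambda,h$ depend on $N$. *)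

theory Defs
  imports "HOL-Probability.Probability" "HOL-Library.Landau_Symbols"
begin

text \<open>
  A real function on \<open>S\<close> is represented by the total function that vanishes off \<open>S\<close>. Thus
  equality of representatives is equality on \<open>S\<close>. All families \<open>\<phi>\<close>, \<open>\<mu>\<close> and all samples are
  indexed from 1; the value at index 0 is never used.
\<close>

definition functions_on :: "'a set \<Rightarrow> ('a \<Rightarrow> real) set" where
  "functions_on S = {f. \<forall>x. x \<notin> S \<longrightarrow> f x = 0}"

definition hilbert_function_space ::
  "'a set \<Rightarrow> ('a \<Rightarrow> real) set \<Rightarrow> (('a \<Rightarrow> real) \<Rightarrow> ('a \<Rightarrow> real) \<Rightarrow> real) \<Rightarrow> bool" where
  "hilbert_function_space S H ip \<longleftrightarrow>
     H \<subseteq> functions_on S \<and>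
     (\<lambda>_. 0) \<in> H \<and>
     (\<forall>f\<in>H. \<forall>g\<in>H. (\<lambda>x. f x + g x) \<in> H) \<and>
     (\<forall>c. \<forall>f\<in>H. (\<lambda>x. c * f x) \<in> H) \<and>
     (\<forall>f\<in>H. \<forall>g\<in>H. ip f g = ip g f) \<and>
     (\<forall>f\<in>H. \<forall>g\<in>H. \<forall>u\<in>H. ip (\<lambda>x. f x + g x) u = ip f u + ip g u) \<and>
     (\<forall>c. \<forall>f\<in>H. \<forall>g\<in>H. ip (\<lambda>x. c * f x) g = c * ip f g) \<and>
     (\<forall>f\<in>H. f \<noteq> (\<lambda>_. 0) \<longrightarrow> 0 < ip f f) \<and>
     (\<forall>u. (\<forall>m. u m \<in> H) \<and>
          (\<forall>e>0. \<exists>k. \<forall>m\<ge>k. \<forall>l\<ge>k. sqrt (ip (\<lambda>x. u m x - u l x) (\<lambda>x. u m x - u l x)) < e) \<longrightarrow>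
          (\<exists>f\<in>H. (\<lambda>m. sqrt (ip (\<lambda>x. u m x - f x) (\<lambda>x. u m x - f x))) \<longlonglongrightarrow> 0))"

definition rkhs ::
  "'a set \<Rightarrow> ('a \<Rightarrow> real) set \<Rightarrow> (('a \<Rightarrow> real) \<Rightarrow> ('a \<Rightarrow> real) \<Rightarrow> real) \<Rightarrow> ('a \<Rightarrow> 'a \<Rightarrow> real) \<Rightarrow> bool" where
  "rkhs S H ip R \<longleftrightarrow>
     hilbert_function_space S H ip \<and> (\<forall>x\<in>S. R x \<in> H \<and> (\<forall>f\<in>H. ip f (R x) = f x))"

text \<open>The law of a covariate with Lebesgue density \<open>p\<close> on \<open>S\<close>, and the spaces it generates.\<close>

definition design_law :: "'a::euclidean_space set \<Rightarrow> ('a \<Rightarrow> real) \<Rightarrow> 'a measure" where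
  "design_law S p = density (restrict_space lborel S) (\<lambda>x. ennreal (p x))"

definition square_integrable :: "'a measure \<Rightarrow> ('a \<Rightarrow> real) set" where
  "square_integrable Q = {f \<in> borel_measurable Q. integrable Q (\<lambda>x. (f x)\<^sup>2)}"

definition V_form :: "'a measure \<Rightarrow> ('a \<Rightarrow> real) \<Rightarrow> ('a \<Rightarrow> real) \<Rightarrow> real" where
  "V_form Q f g = (\<integral>x. f x * g x \<partial>Q)"

definition orthonormal_basis_L2 :: "'a measure \<Rightarrow> (nat \<Rightarrow> 'a \<Rightarrow> real) \<Rightarrow> bool" where
  "orthonormal_basis_L2 Q \<phi> \<longleftrightarrow>
     (\<forall>i\<ge>1. \<phi> i \<in> square_integrable Q) \<and>
     (\<forall>i\<ge>1. \<forall>j\<ge>1. V_form Q (\<phi> i) (\<phi> j) = (if i = j then 1 else 0)) \<and>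
     (\<forall>f\<in>square_integrable Q.
        (\<lambda>m. \<integral>x. (f x - (\<Sum>i=1..m. V_form Q f (\<phi> i) * \<phi> i x))\<^sup>2 \<partial>Q) \<longlonglongrightarrow> 0)"

definition series_kernel :: "(nat \<Rightarrow> real) \<Rightarrow> (nat \<Rightarrow> 'a \<Rightarrow> real) \<Rightarrow> 'a \<Rightarrow> 'a \<Rightarrow> real" where
  "series_kernel w \<phi> x y = (\<Sum>i. w (Suc i) * \<phi> (Suc i) x * \<phi> (Suc i) y)"

text \<open>
  The condition \<open>\<langle>\<phi>\<^sub>i, \<phi>\<^sub>j\<rangle> = \<delta>\<^sub>i\<^sub>j / \<mu>\<^sub>i\<close> in the Hilbert space is meaningful for positive
  eigenvalues only; eigenfunctions with \<open>\<mu>\<^sub>i = 0\<close> do not contribute to the kernel.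
\<close>

definition spectral_rkhs ::
  "'a set \<Rightarrow> 'a measure \<Rightarrow> ('a \<Rightarrow> real) set \<Rightarrow> (('a \<Rightarrow> real) \<Rightarrow> ('a \<Rightarrow> real) \<Rightarrow> real) \<Rightarrow>
   (nat \<Rightarrow> real) \<Rightarrow> (nat \<Rightarrow> 'a \<Rightarrow> real) \<Rightarrow> bool" where
  "spectral_rkhs S Q H ip \<mu> \<phi> \<longleftrightarrow>
     (\<forall>i\<ge>1. 0 \<le> \<mu> i) \<and> (\<forall>i\<ge>1. \<mu> (Suc i) \<le> \<mu> i) \<and>
     (\<forall>i\<ge>1. \<phi> i \<in> functions_on S) \<and> orthonormal_basis_L2 Q \<phi> \<and>
     H \<subseteq> square_integrable Q \<and>
     (\<forall>i\<ge>1. \<mu> i > 0 \<longrightarrow> \<phi> i \<in> H) \<and>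
     (\<forall>i\<ge>1. \<forall>j\<ge>1. \<mu> i > 0 \<and> \<mu> j > 0 \<longrightarrow> ip (\<phi> i) (\<phi> j) = (if i = j then 1 / \<mu> i else 0)) \<and>
     (\<forall>x\<in>S. \<forall>y\<in>S. summable (\<lambda>i. \<mu> (Suc i) * \<phi> (Suc i) x * \<phi> (Suc i) y)) \<and>
     rkhs S H ip (series_kernel \<mu> \<phi>)"

text \<open>The case distinction is the convention \<open>1 / (1 + \<lambda> / 0) = 1 / \<infinity> = 0\<close>.\<close>

definition shrinkage :: "(nat \<Rightarrow> real) \<Rightarrow> real \<Rightarrow> nat \<Rightarrow> real" where
  "shrinkage \<mu> lam i = (if \<mu> i = 0 then 0 else 1 / (1 + lam / \<mu> i))"

definition K_kernel :: "(nat \<Rightarrow> real) \<Rightarrow> (nat \<Rightarrow> 'a \<Rightarrow> real) \<Rightarrow> real \<Rightarrow> 'a \<Rightarrow> 'a \<Rightarrow> real" where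
  "K_kernel \<mu> \<phi> lam = series_kernel (shrinkage \<mu> lam) \<phi>"

definition h_of :: "(nat \<Rightarrow> real) \<Rightarrow> real \<Rightarrow> real" where
  "h_of \<mu> lam = inverse (\<Sum>i. shrinkage \<mu> lam (Suc i))"

definition sup_norm_on :: "'a set \<Rightarrow> ('a \<Rightarrow> real) \<Rightarrow> ennreal" where
  "sup_norm_on S f = (SUP x\<in>S. ennreal \<bar>f x\<bar>)"

definition pen_ip ::
  "'a measure \<Rightarrow> (('a \<Rightarrow> real) \<Rightarrow> ('a \<Rightarrow> real) \<Rightarrow> real) \<Rightarrow> real \<Rightarrow> ('a \<Rightarrow> real) \<Rightarrow> ('a \<Rightarrow> real) \<Rightarrow> real" where
  "pen_ip Q ip lam f g = V_form Q f g + lam * ip f g"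

definition pen_norm ::
  "'a measure \<Rightarrow> (('a \<Rightarrow> real) \<Rightarrow> ('a \<Rightarrow> real) \<Rightarrow> real) \<Rightarrow> real \<Rightarrow> ('a \<Rightarrow> real) \<Rightarrow> real" where
  "pen_norm Q ip lam f = sqrt (pen_ip Q ip lam f f)"

text \<open>Below, \<open>x\<close> and \<open>y\<close> are realised samples and \<open>A\<close> is the index set of a subsample.\<close>

definition empirical_mean :: "nat set \<Rightarrow> (nat \<Rightarrow> 'a) \<Rightarrow> ('a \<Rightarrow> real) \<Rightarrow> real" where
  "empirical_mean A x f = (\<Sum>i\<in>A. f (x i)) / real (card A)"

definition xi_sup ::
  "'a measure \<Rightarrow> ('a \<Rightarrow> real) set \<Rightarrow> (('a \<Rightarrow> real) \<Rightarrow> ('a \<Rightarrow> real) \<Rightarrow> real) \<Rightarrow> real \<Rightarrow>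
   nat set \<Rightarrow> (nat \<Rightarrow> 'a) \<Rightarrow> real" where
  "xi_sup Q H ip lam A x =
     (SUP (f, g) \<in> {(f, g). f \<in> H \<and> g \<in> H \<and> pen_norm Q ip lam f = 1 \<and> pen_norm Q ip lam g = 1}.
        \<bar>empirical_mean A x (\<lambda>z. f z * g z) - (\<integral>z. f z * g z \<partial>Q)\<bar>)"

definition ridge_loss ::
  "(('a \<Rightarrow> real) \<Rightarrow> ('a \<Rightarrow> real) \<Rightarrow> real) \<Rightarrow> real \<Rightarrow> nat set \<Rightarrow> (nat \<Rightarrow> 'a) \<Rightarrow> (nat \<Rightarrow> real) \<Rightarrow>
   ('a \<Rightarrow> real) \<Rightarrow> real" where
  "ridge_loss ip lam A x y f =
     1 / (2 * real (card A)) * (\<Sum>i\<in>A. (y i - f (x i))\<^sup>2) + lam / 2 * ip f f"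

definition ridge_estimator ::
  "('a \<Rightarrow> real) set \<Rightarrow> (('a \<Rightarrow> real) \<Rightarrow> ('a \<Rightarrow> real) \<Rightarrow> real) \<Rightarrow> real \<Rightarrow> nat set \<Rightarrow> (nat \<Rightarrow> 'a) \<Rightarrow>
   (nat \<Rightarrow> real) \<Rightarrow> 'a \<Rightarrow> real" where
  "ridge_estimator H ip lam A x y = arg_min (ridge_loss ip lam A x y) (\<lambda>f. f \<in> H)"

definition averaged_estimator ::
  "('a \<Rightarrow> real) set \<Rightarrow> (('a \<Rightarrow> real) \<Rightarrow> ('a \<Rightarrow> real) \<Rightarrow> real) \<Rightarrow> real \<Rightarrow> nat \<Rightarrow> (nat \<Rightarrow> nat set) \<Rightarrow>
   (nat \<Rightarrow> 'a) \<Rightarrow> (nat \<Rightarrow> real) \<Rightarrow> 'a \<Rightarrow> real" where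
  "averaged_estimator H ip lam s D x y =
     (\<lambda>z. 1 / real s * (\<Sum>j=1..s. ridge_estimator H ip lam (D j) x y z))"

definition T_stat ::
  "'a measure \<Rightarrow> ('a \<Rightarrow> real) set \<Rightarrow> (('a \<Rightarrow> real) \<Rightarrow> ('a \<Rightarrow> real) \<Rightarrow> real) \<Rightarrow> real \<Rightarrow> nat \<Rightarrow>
   (nat \<Rightarrow> nat set) \<Rightarrow> (nat \<Rightarrow> 'a) \<Rightarrow> (nat \<Rightarrow> real) \<Rightarrow> real" where
  "T_stat Q H ip lam s D x y = (pen_norm Q ip lam (averaged_estimator H ip lam s D x y))\<^sup>2"

definition W_stat :: "('a \<Rightarrow> 'a \<Rightarrow> real) \<Rightarrow> nat \<Rightarrow> (nat \<Rightarrow> 'a) \<Rightarrow> (nat \<Rightarrow> real) \<Rightarrow> real" where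
  "W_stat K N x e = (\<Sum>(i, l) \<in> {(i, l). 1 \<le> i \<and> i < l \<and> l \<le> N}. 2 * e i * e l * K (x i) (x l))"

text \<open>
  A random division of \<open>{1..N}\<close> into \<open>s\<close> blocks of size \<open>n\<close>, drawn independently of the
  first \<open>N\<close> data points; its law is otherwise arbitrary (in particular it may be uniform).
\<close>

definition random_division ::
  "'w measure \<Rightarrow> (nat \<Rightarrow> 'w \<Rightarrow> real \<times> 'a::euclidean_space) \<Rightarrow> nat \<Rightarrow> nat \<Rightarrow> nat \<Rightarrow>
   (nat \<Rightarrow> 'w \<Rightarrow> nat set) \<Rightarrow> bool" where
  "random_division M Z N s n D \<longleftrightarrow>
     (\<forall>\<omega>\<in>space M. disjoint_family_on (\<lambda>j. D j \<omega>) {1..s} \<and> (\<Union>j\<in>{1..s}. D j \<omega>) = {1..N} \<and>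
                   (\<forall>j\<in>{1..s}. card (D j \<omega>) = n)) \<and>
     prob_space.indep_set M
       (sets (vimage_algebra (space M) (\<lambda>\<omega>. \<lambda>j\<in>{1..s}. D j \<omega>)
                (\<Pi>\<^sub>M j\<in>{1..s}. count_space (Pow {1..N}))))
       (sets (vimage_algebra (space M) (\<lambda>\<omega>. \<lambda>i\<in>{1..N}. Z i \<omega>)
                (\<Pi>\<^sub>M i\<in>{1..N}. borel \<Otimes>\<^sub>M borel)))"

text \<open>
  \<open>Z k = O\<^sub>P(r k)\<close>, formulated with outer probability, so that measurability of suprema over
  uncountable classes need not be presupposed.
\<close>

definition bigO_in_prob :: "'w measure \<Rightarrow> (nat \<Rightarrow> 'w \<Rightarrow> real) \<Rightarrow> (nat \<Rightarrow> real) \<Rightarrow> bool" where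
  "bigO_in_prob M Z r \<longleftrightarrow>
     (\<forall>\<delta>>0. \<exists>C>0. \<forall>\<^sub>F k in sequentially.
        \<exists>A\<in>sets M. {\<omega>\<in>space M. C * r k < \<bar>Z k \<omega>\<bar>} \<subseteq> A \<and> measure M A \<le> \<delta>)"

text \<open>
  Conditioning on \<open>X\<close>. Nonnegative conditional moments are taken with \<open>nn_cond_exp\<close>, which does
  not presuppose integrability.
\<close>

definition sigma_of :: "'w measure \<Rightarrow> ('w \<Rightarrow> 'a::topological_space) \<Rightarrow> 'w measure" where
  "sigma_of M X = vimage_algebra (space M) X borel"

text \<open>
  The regression model: \<open>Y i = f0 (X i) + \<epsilon> i\<close> with i.i.d. pairs, covariate density \<open>p\<close> on \<open>S\<close>,
  and conditional variance function \<open>v\<close>. That the covariates take values in \<open>S\<close> is part of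
  \<open>distributed\<close> with base measure \<open>restrict_space lborel S\<close>.
\<close>

definition regression_model ::
  "'w measure \<Rightarrow> 'a::euclidean_space set \<Rightarrow> ('a \<Rightarrow> real) \<Rightarrow> (nat \<Rightarrow> 'w \<Rightarrow> 'a) \<Rightarrow> (nat \<Rightarrow> 'w \<Rightarrow> real) \<Rightarrow>
   (nat \<Rightarrow> 'w \<Rightarrow> real) \<Rightarrow> ('a \<Rightarrow> real) \<Rightarrow> ('a \<Rightarrow> real) \<Rightarrow> bool" where
  "regression_model M S p X Y \<epsilon> f0 v \<longleftrightarrow>
     prob_space.indep_vars M (\<lambda>_. borel \<Otimes>\<^sub>M borel) (\<lambda>i \<omega>. (Y i \<omega>, X i \<omega>)) {1..} \<and>
     (\<forall>i\<ge>1. distr M (borel \<Otimes>\<^sub>M borel) (\<lambda>\<omega>. (Y i \<omega>, X i \<omega>)) =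
             distr M (borel \<Otimes>\<^sub>M borel) (\<lambda>\<omega>. (Y 1 \<omega>, X 1 \<omega>))) \<and>
     (\<forall>i\<ge>1. distributed M (restrict_space lborel S) (X i) (\<lambda>x. ennreal (p x))) \<and>
     (\<forall>i\<ge>1. \<forall>\<omega>\<in>space M. Y i \<omega> = f0 (X i \<omega>) + \<epsilon> i \<omega>) \<and>
     (\<forall>i\<ge>1. integrable M (\<epsilon> i)) \<and>
     (\<forall>i\<ge>1. AE \<omega> in M. real_cond_exp M (sigma_of M (X i)) (\<epsilon> i) \<omega> = 0) \<and>
     (\<forall>i\<ge>1. AE \<omega> in M. nn_cond_exp M (sigma_of M (X i)) (\<lambda>\<omega>. ennreal ((\<epsilon> i \<omega>)\<^sup>2)) \<omega>
                        = ennreal (v (X i \<omega>))) \<and>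
     (\<forall>x\<in>S. 0 < v x)"

end

theory Submission
  imports Defs
begin

text \<open>
  Write \<open>k\<close> for the kernel of the form \<open>\<lambda> \<langle>f, g\<rangle>\<^sub>H + P\<^sub>j f g\<close> attached to a subsample. The normal equations
  give the ridge estimator as the linear combination of the \<open>k (X i)\<close> with weights \<open>Y i / n\<close>, and
  comparing them with the reproducing property of \<open>K\<close> shows \<open>\<parallel>k x - K x\<parallel> \<le> 2 \<xi>\<^sub>j \<parallel>K x\<parallel>\<close> once
  \<open>\<xi>\<^sub>j \<le> 1/2\<close>. Given the design and the division, the difference between the averaged estimator
  and \<open>N\<inverse> \<Sum> \<epsilon> i K (X i)\<close> is thus a sum of uncorrelated terms of conditional second moment
  \<open>O(\<xi>\<^sup>2 / (N h)) = o(1 / N)\<close>; this gain over the triangle inequality is what makes the condition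
  on \<open>log\<^sup>b N\<close> sufficient. The squared norm of \<open>N\<inverse> \<Sum> \<epsilon> i K (X i)\<close> consists of a diagonal,
  concentrated at \<open>\<sigma>\<^sup>2 / (N h)\<close>, and of \<open>W / N\<^sup>2\<close>.

  Since \<open>W\<close> is a degenerate U-statistic, it is a martingale in the sample size. Its characteristic
  function is compared with the Gaussian one by replacing the increments one at a time; the
  conditional variances fluctuate so little that the errors are summable in absolute value, and no
  martingale central limit theorem is needed. The tail condition on the eigenvalues enters only
  through the comparability of \<open>\<Sum> (1 + \<lambda>/\<mu>\<^sub>\<nu>)\<^sup>-\<^sup>2\<close> with \<open>1/h\<close>.
\<close>

section \<open>Independence and moments\<close>

text \<open>Everything is measured against the scale \<open>sqrt dim1 / N\<close>, where
  \<open>dim1\<close> is 1/h: comparability of \<open>dim1\<close> and \<open>dim2\<close> makes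
  \<sigma>(N) of exact order \<open>N * sqrt dim1\<close>, so an error in T may be dropped once it
  is of smaller order than \<open>sqrt dim1 / N\<close>. The diagonal fluctuates by
  \<open>dim1 / N powr (3/2)\<close>, small enough because N h tends to infinity. Passing from the
  estimator to its linear part costs a cross term between a function of squared norm about
  \<open>dim1 / N\<close> and one of squared norm about \<open>\<eta>\<^sup>2 / N\<close>; weighting
  the two with \<theta> = \<eta> / \<open>sqrt dim1\<close> leaves \<eta> times
  \<open>sqrt dim1 / N\<close>. What has to be small is thus \<xi>^2 times \<open>dim1\<close>, and
  this is what log^b N = o(n h^(a+1)) provides. The obstacle is measurability. The suprema are
  controlled in outer probability only, and the inner product of H carries no measurable structure
  in the sample. Hence the event on which the comparison is made is cut out by
  \<open>dispersion\<close>, an explicit function of design and division, and Gram entries are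
  written without \<open>ip\<close>.\<close>

lemma (in pair_sigma_finite) integrable_times:
  fixes f :: "'a \<Rightarrow> real"
  assumes "integrable M1 f" "integrable M2 g"
  shows "integrable (M1 \<Otimes>\<^sub>M M2) (\<lambda>(x, y). f x * g y)"
  using assms by (intro Fubini_integrable) (auto simp: abs_mult split_beta' intro!: borel_measurable_times)

context prob_space begin

lemma indep_var_commute: "indep_var S X T Y \<Longrightarrow> indep_var T Y S X"
  unfolding indep_var_eq indep_sets2_eq
  by (elim conjE, intro conjI ballI, assumption+) (subst Int_commute, subst mult.commute, blast)

text \<open>Only the product form of the joint law is recorded, since Fubini's theorem uses nothing
  else. The two components may have different types: a past is paired with a single observation, a
  division with the data.\<close>

definition indep_pair :: "'b measure \<Rightarrow> ('a \<Rightarrow> 'b) \<Rightarrow> 'c measure \<Rightarrow> ('a \<Rightarrow> 'c) \<Rightarrow> bool" where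
  "indep_pair MA A MB B \<longleftrightarrow> A \<in> measurable M MA \<and> B \<in> measurable M MB \<and>
     distr M MA A \<Otimes>\<^sub>M distr M MB B = distr M (MA \<Otimes>\<^sub>M MB) (\<lambda>\<omega>. (A \<omega>, B \<omega>))"

lemma indep_pair_compose:
  assumes ind: "indep_var MA A MB B" and f[measurable]: "f \<in> measurable MA MC" and g[measurable]: "g \<in> measurable MB MD"
  shows "indep_pair MC (\<lambda>\<omega>. f (A \<omega>)) MD (\<lambda>\<omega>. g (B \<omega>))"
proof -
  have A[measurable]: "A \<in> measurable M MA" and B[measurable]: "B \<in> measurable M MB"
    and j: "distr M MA A \<Otimes>\<^sub>M distr M MB B = distr M (MA \<Otimes>\<^sub>M MB) (\<lambda>x. (A x, B x))"
    using ind unfolding indep_var_distribution_eq by auto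
  have e: "distr M MC (\<lambda>\<omega>. f (A \<omega>)) = distr (distr M MA A) MC f" "distr M MD (\<lambda>\<omega>. g (B \<omega>)) = distr (distr M MB B) MD g"
    by (simp_all add: distr_distr comp_def)
  have "sigma_finite_measure (distr M MD (\<lambda>\<omega>. g (B \<omega>)))"
    using prob_space_distr[of "\<lambda>\<omega>. g (B \<omega>)" MD] by (auto simp: prob_space_imp_sigma_finite)
  then show ?thesis unfolding indep_pair_def e
    by (subst pair_measure_distr) (simp_all add: j distr_distr comp_def e[symmetric])
qed

lemma indep_pair_swap: "indep_pair MA A MB B \<Longrightarrow> indep_pair MB B MA A"
  unfolding indep_pair_def
proof safe
  assume A[measurable]: "A \<in> measurable M MA" and B[measurable]: "B \<in> measurable M MB"
    and j: "distr M MA A \<Otimes>\<^sub>M distr M MB B = distr M (MA \<Otimes>\<^sub>M MB) (\<lambda>x. (A x, B x))"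
  interpret Ap: prob_space "distr M MA A" by (rule prob_space_distr) fact
  interpret Bp: prob_space "distr M MB B" by (rule prob_space_distr) fact
  interpret pp: pair_prob_space "distr M MB B" "distr M MA A" ..
  show "distr M MB B \<Otimes>\<^sub>M distr M MA A = distr M (MB \<Otimes>\<^sub>M MA) (\<lambda>x. (B x, A x))"
    by (subst pp.distr_pair_swap)
       (auto simp: j distr_distr comp_def intro!: distr_cong sets_pair_measure_cong)
qed

text \<open>This takes the place of conditioning on \<open>A\<close>: its value is frozen at
  \<omega> while \<open>B\<close> is integrated over a fresh point \<omega>'.\<close>

lemma indep_pair_nn_fubini:
  assumes ind: "indep_pair MA A MB B" and F: "F \<in> borel_measurable (MA \<Otimes>\<^sub>M MB)"
  shows "(\<integral>\<^sup>+\<omega>. F (A \<omega>, B \<omega>) \<partial>M) = (\<integral>\<^sup>+\<omega>. (\<integral>\<^sup>+\<omega>'. F (A \<omega>, B \<omega>') \<partial>M) \<partial>M)"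
proof -
  have A[measurable]: "A \<in> measurable M MA" and B[measurable]: "B \<in> measurable M MB"
    and j: "distr M MA A \<Otimes>\<^sub>M distr M MB B = distr M (MA \<Otimes>\<^sub>M MB) (\<lambda>x. (A x, B x))"
    using ind unfolding indep_pair_def by auto
  note F[measurable]
  interpret Bp: prob_space "distr M MB B" by (rule prob_space_distr) fact
  have "(\<integral>\<^sup>+\<omega>. F (A \<omega>, B \<omega>) \<partial>M) = (\<integral>\<^sup>+z. F z \<partial>(distr M MA A \<Otimes>\<^sub>M distr M MB B))"
    unfolding j by (subst nn_integral_distr) auto
  also have "\<dots> = (\<integral>\<^sup>+a. (\<integral>\<^sup>+b. F (a, b) \<partial>distr M MB B) \<partial>distr M MA A)"
    by (subst Bp.nn_integral_fst[symmetric]) auto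
  also have "\<dots> = (\<integral>\<^sup>+\<omega>. (\<integral>\<^sup>+b. F (A \<omega>, b) \<partial>distr M MB B) \<partial>M)"
    by (subst nn_integral_distr) auto
  also have "\<dots> = (\<integral>\<^sup>+\<omega>. (\<integral>\<^sup>+\<omega>'. F (A \<omega>, B \<omega>') \<partial>M) \<partial>M)"
    by (intro nn_integral_cong, subst nn_integral_distr) (auto dest: measurable_space[OF A])
  finally show ?thesis .
qed

lemma indep_pair_fubini:
  fixes F :: "_ \<Rightarrow> 'c::{banach, second_countable_topology}"
  assumes ind: "indep_pair MA A MB B" and F: "F \<in> borel_measurable (MA \<Otimes>\<^sub>M MB)"
    and int: "integrable M (\<lambda>\<omega>. F (A \<omega>, B \<omega>))"
  shows "(\<integral>\<omega>. F (A \<omega>, B \<omega>) \<partial>M) = (\<integral>\<omega>. (\<integral>\<omega>'. F (A \<omega>, B \<omega>') \<partial>M) \<partial>M)"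
    and "integrable M (\<lambda>\<omega>. (\<integral>\<omega>'. F (A \<omega>, B \<omega>') \<partial>M))"
proof -
  have A[measurable]: "A \<in> measurable M MA" and B[measurable]: "B \<in> measurable M MB"
    and j: "distr M MA A \<Otimes>\<^sub>M distr M MB B = distr M (MA \<Otimes>\<^sub>M MB) (\<lambda>x. (A x, B x))"
    using ind unfolding indep_pair_def by auto
  note F[measurable]
  interpret Ap: prob_space "distr M MA A" by (rule prob_space_distr) fact
  interpret Bp: prob_space "distr M MB B" by (rule prob_space_distr) fact
  interpret pp: pair_prob_space "distr M MA A" "distr M MB B" ..
  have i2: "integrable (distr M MA A \<Otimes>\<^sub>M distr M MB B) F"
    unfolding j by (subst integrable_distr_eq) (auto simp: int)
  have in_eq: "(\<integral>b. F (A \<omega>, b) \<partial>distr M MB B) = (\<integral>\<omega>'. F (A \<omega>, B \<omega>') \<partial>M)" if "\<omega> \<in> space M" for \<omega>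
    using measurable_space[OF A that] by (subst integral_distr) auto
  have "integrable (distr M MA A) (\<lambda>a. (\<integral>b. F (a, b) \<partial>distr M MB B))"
    using pp.integrable_fst'[OF i2] by simp
  then have "integrable M (\<lambda>\<omega>. (\<integral>b. F (A \<omega>, b) \<partial>distr M MB B))"
    by (subst (asm) integrable_distr_eq) auto
  then show "integrable M (\<lambda>\<omega>. (\<integral>\<omega>'. F (A \<omega>, B \<omega>') \<partial>M))"
    by (subst Bochner_Integration.integrable_cong[OF refl in_eq[symmetric]]) auto
  have "(\<integral>\<omega>. F (A \<omega>, B \<omega>) \<partial>M) = (\<integral>z. F z \<partial>(distr M MA A \<Otimes>\<^sub>M distr M MB B))"
    unfolding j by (subst integral_distr) auto
  also have "\<dots> = (\<integral>a. (\<integral>b. F (a, b) \<partial>distr M MB B) \<partial>distr M MA A)"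
    using pp.integral_fst'[OF i2] by simp
  also have "\<dots> = (\<integral>\<omega>. (\<integral>b. F (A \<omega>, b) \<partial>distr M MB B) \<partial>M)"
    by (subst integral_distr) auto
  also have "\<dots> = (\<integral>\<omega>. (\<integral>\<omega>'. F (A \<omega>, B \<omega>') \<partial>M) \<partial>M)"
    by (intro Bochner_Integration.integral_cong refl in_eq)
  finally show "(\<integral>\<omega>. F (A \<omega>, B \<omega>) \<partial>M) = (\<integral>\<omega>. (\<integral>\<omega>'. F (A \<omega>, B \<omega>') \<partial>M) \<partial>M)" .
qed

section \<open>Functions with finite fourth moment\<close>

definition L4 :: "('a \<Rightarrow> real) \<Rightarrow> bool" where
  "L4 f \<longleftrightarrow> f \<in> borel_measurable M \<and> integrable M (\<lambda>\<omega>. f \<omega> ^ 4)"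

lemma L4_measurable: "L4 f \<Longrightarrow> f \<in> borel_measurable M"
  by (simp add: L4_def)

lemma L4_dominated:
  assumes "L4 b" "f \<in> borel_measurable M" "AE \<omega> in M. \<bar>f \<omega>\<bar> \<le> \<bar>b \<omega>\<bar>"
  shows "L4 f"
  unfolding L4_def
proof (rule conjI[OF _ Bochner_Integration.integrable_bound[of M "\<lambda>\<omega>. b \<omega> ^ 4"]])
  show "AE x in M. norm (f x ^ 4) \<le> norm (b x ^ 4)"
    using assms(3) by eventually_elim (simp add: power_mono_even)
qed (use assms in \<open>auto simp: L4_def\<close>)

lemma L4_add:
  assumes "L4 f" "L4 g" shows "L4 (\<lambda>\<omega>. f \<omega> + g \<omega>)"
  unfolding L4_def
proof (rule conjI[OF _ Bochner_Integration.integrable_bound[of M "\<lambda>\<omega>. 8 * (f \<omega> ^ 4 + g \<omega> ^ 4)"]])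
  have "(x + y)^4 \<le> 8 * (x^4 + y^4)" for x y :: real
  proof -
    have "(x+y)^2 \<le> 2*(x^2+y^2)" using sum_squares_bound[of x y] by (simp add: power2_sum)
    then have "((x+y)^2)^2 \<le> (2*(x^2+y^2))^2" by (intro power_mono) auto
    also have "\<dots> \<le> 4 * (2 * ((x^2)^2 + (y^2)^2))"
      using sum_squares_bound[of "x^2" "y^2"] by (simp add: power2_sum power_mult_distrib)
    finally show ?thesis by simp
  qed
  then show "AE x in M. norm ((f x + g x) ^ 4) \<le> norm (8 * (f x ^ 4 + g x ^ 4))"
    by (intro AE_I2) (smt (verit) real_norm_def zero_le_even_power even_numeral)
qed (use assms in \<open>auto simp: L4_def\<close>)

lemma L4_const: "L4 (\<lambda>_. c)" by (simp add: L4_def)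

lemma L4_cmult: "L4 f \<Longrightarrow> L4 (\<lambda>\<omega>. c * f \<omega>)"
  by (auto simp: L4_def power_mult_distrib)

lemma L4_sum: "(\<And>i. i \<in> I \<Longrightarrow> L4 (f i)) \<Longrightarrow> L4 (\<lambda>\<omega>. \<Sum>i\<in>I. f i \<omega>)"
  by (induction I rule: infinite_finite_induct) (auto simp: L4_const intro!: L4_add)

text \<open>Four factors, so that the constant 1 in some of the slots yields all mixed moments of
  lower order.\<close>

lemma L4_prod_integrable:
  assumes "L4 f" "L4 g" "L4 h" "L4 k"
  shows "integrable M (\<lambda>\<omega>. f \<omega> * g \<omega> * h \<omega> * k \<omega>)"
proof (rule Bochner_Integration.integrable_bound[of M "\<lambda>\<omega>. f \<omega> ^ 4 + g \<omega> ^ 4 + h \<omega> ^ 4 + k \<omega> ^ 4"])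
  have "\<bar>a * b * c * d\<bar> \<le> a^4 + b^4 + c^4 + d^4" for a b c d :: real
  proof -
    have "2 * \<bar>a*b\<bar> * \<bar>c*d\<bar> \<le> \<bar>a*b\<bar>^2 + \<bar>c*d\<bar>^2" by (rule sum_squares_bound)
    moreover have "2 * a^2 * b^2 \<le> (a^2)^2 + (b^2)^2" "2 * c^2 * d^2 \<le> (c^2)^2 + (d^2)^2"
      by (rule sum_squares_bound)+
    moreover have "0 \<le> (a^2)^2 + (b^2)^2" "0 \<le> (c^2)^2 + (d^2)^2" by auto
    moreover have "\<bar>a * b * c * d\<bar> = \<bar>a*b\<bar> * \<bar>c*d\<bar>" by (simp add: abs_mult)
    ultimately show ?thesis by (simp add: power_mult_distrib)
  qed
  then show "AE \<omega> in M. norm (f \<omega> * g \<omega> * h \<omega> * k \<omega>) \<le> norm (f \<omega> ^ 4 + g \<omega> ^ 4 + h \<omega> ^ 4 + k \<omega> ^ 4)"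
    by (intro AE_I2) (auto intro: order_trans)
qed (use assms in \<open>auto simp: L4_def\<close>)

lemma L4_integrable:
  assumes "L4 f"
  shows "integrable M f" "integrable M (\<lambda>\<omega>. f \<omega> ^ 2)" "integrable M (\<lambda>\<omega>. f \<omega> ^ 3)" "integrable M (\<lambda>\<omega>. f \<omega> ^ 4)"
  using L4_prod_integrable[OF assms L4_const[of 1] L4_const[of 1] L4_const[of 1]]
    L4_prod_integrable[OF assms assms L4_const[of 1] L4_const[of 1]]
    L4_prod_integrable[OF assms assms assms L4_const[of 1]] assms
  by (auto simp: power2_eq_square power3_eq_cube L4_def)

lemma L4_mult_integrable:
  assumes "L4 f" "L4 g"
  shows "integrable M (\<lambda>\<omega>. f \<omega> * g \<omega>)"
  using L4_prod_integrable[OF assms L4_const[of 1] L4_const[of 1]] by simp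

text \<open>Jensen's inequality, read off from the nonnegativity of the variance of the absolute
  value.\<close>

lemma abs_expectation_le_sqrt:
  fixes f :: "'a \<Rightarrow> real"
  assumes "f \<in> borel_measurable M" "integrable M (\<lambda>\<omega>. f \<omega> ^ 2)"
  shows "expectation (\<lambda>\<omega>. \<bar>f \<omega>\<bar>) \<le> sqrt (expectation (\<lambda>\<omega>. f \<omega> ^ 2))"
proof -
  have i: "integrable M f" using square_integrable_imp_integrable[OF assms] .
  have "variance (\<lambda>\<omega>. \<bar>f \<omega>\<bar>) = expectation (\<lambda>\<omega>. \<bar>f \<omega>\<bar> ^ 2) - (expectation (\<lambda>\<omega>. \<bar>f \<omega>\<bar>))\<^sup>2"
    using i assms by (intro variance_eq) auto
  moreover have "variance (\<lambda>\<omega>. \<bar>f \<omega>\<bar>) \<ge> 0" by (rule variance_positive)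
  ultimately have "(expectation (\<lambda>\<omega>. \<bar>f \<omega>\<bar>))\<^sup>2 \<le> expectation (\<lambda>\<omega>. f \<omega> ^ 2)" by simp
  then show ?thesis by (rule real_le_rsqrt)
qed

text \<open>Passing from n to n + 1 adds at most \<open>6 * n * \<gamma>\<^sup>2 + q\<close> to the
  fourth moment, since terms with an isolated centred factor vanish. As
  \<open>\<gamma>\<^sup>2 \<le> q\<close> by Jensen's inequality, the growth is at most
  \<open>(6 * n + 1) * q\<close>, which \<open>3 * n\<^sup>2 * q\<close> accommodates.\<close>

lemma fourth_moment_sum_le:
  fixes X :: "nat \<Rightarrow> 'a \<Rightarrow> real"
  assumes ind: "indep_vars (\<lambda>_. borel) X UNIV" and L4: "\<And>i. L4 (X i)"
    and mean: "\<And>i. expectation (X i) = 0"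
    and m2: "\<And>i. expectation (\<lambda>\<omega>. X i \<omega> ^ 2) = \<gamma>"
    and m4: "\<And>i. expectation (\<lambda>\<omega>. X i \<omega> ^ 4) \<le> q"
  shows "expectation (\<lambda>\<omega>. (\<Sum>i<n. X i \<omega>) ^ 2) = real n * \<gamma>"
    and "expectation (\<lambda>\<omega>. (\<Sum>i<n. X i \<omega>) ^ 4) \<le> 3 * real n ^ 2 * q"
proof -
  have g2: "\<gamma> ^ 2 \<le> q"
  proof -
    have "variance (\<lambda>\<omega>. X 0 \<omega> ^ 2) = expectation (\<lambda>\<omega>. (X 0 \<omega> ^ 2) ^ 2) - \<gamma>\<^sup>2"
      using L4_integrable[OF L4[of 0]] m2[of 0] by (subst variance_eq) auto
    moreover have "variance (\<lambda>\<omega>. X 0 \<omega> ^ 2) \<ge> 0" by (rule variance_positive)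
    ultimately show ?thesis using m4[of 0] by simp
  qed
  \<comment> \<open>The mean of the partial sum joins the induction because it is the factor that
    removes the term with the third moment of the new variable.\<close>
  have "expectation (\<lambda>\<omega>. (\<Sum>i<n. X i \<omega>) ^ 2) = real n * \<gamma> \<and>
    expectation (\<lambda>\<omega>. (\<Sum>i<n. X i \<omega>)) = 0 \<and>
    expectation (\<lambda>\<omega>. (\<Sum>i<n. X i \<omega>) ^ 4) \<le> 3 * real n ^ 2 * q"
  proof (induction n)
    case (Suc n)
    define T where "T \<omega> = (\<Sum>i<n. X i \<omega>)" for \<omega>
    have T4: "L4 T" unfolding T_def by (intro L4_sum L4)
    have iv: "indep_var borel T borel (X n)"
    proof -
      have "indep_vars (\<lambda>_. borel) X (insert n {..<n})" using ind by (rule indep_vars_subset) auto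
      from indep_vars_sum[OF _ _ this] have "indep_var borel (X n) borel T" unfolding T_def by auto
      then show ?thesis by (rule indep_var_commute)
    qed
    have iv2: "indep_var borel (\<lambda>\<omega>. T \<omega> ^ a) borel (\<lambda>\<omega>. X n \<omega> ^ b)" for a b
      using indep_var_compose[OF iv, of "\<lambda>x. x ^ a" borel "\<lambda>x. x ^ b" borel] by (simp add: comp_def)
    have E: "expectation (\<lambda>\<omega>. T \<omega> ^ a * X n \<omega> ^ b) = expectation (\<lambda>\<omega>. T \<omega> ^ a) * expectation (\<lambda>\<omega>. X n \<omega> ^ b)"
      and I: "integrable M (\<lambda>\<omega>. T \<omega> ^ a * X n \<omega> ^ b)"
      if "a \<in> {1,2,3}" "b \<in> {1,2,3}" for a b
      using that L4_integrable[OF T4] L4_integrable[OF L4[of n]]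
      by (auto intro!: indep_var_lebesgue_integral indep_var_integrable iv2)
    note I4 = L4_integrable[OF T4] L4_integrable[OF L4[of n]]
    have s2: "(x+y)^2 = x^2 + 2 * (x^1*y^1) + y^2" for x y :: real by (simp add: power2_sum)
    have s4: "(x+y)^4 = x^4 + 4 * (x^3*y^1) + 6 * (x^2*y^2) + 4 * (x^1*y^3) + y^4" for x y :: real
      by algebra
    have e2: "expectation (\<lambda>\<omega>. (T \<omega> + X n \<omega>)^2) =
      expectation (\<lambda>\<omega>. T \<omega> ^ 2) + 2 * (expectation (\<lambda>\<omega>. T \<omega>) * expectation (X n)) + expectation (\<lambda>\<omega>. X n \<omega> ^ 2)"
      unfolding s2 using I[of 1 1] E[of 1 1] I4 by simp
    have e4: "expectation (\<lambda>\<omega>. (T \<omega> + X n \<omega>)^4) =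
      expectation (\<lambda>\<omega>. T \<omega> ^ 4) + 4 * (expectation (\<lambda>\<omega>. T \<omega> ^ 3) * expectation (X n))
       + 6 * (expectation (\<lambda>\<omega>. T \<omega> ^ 2) * expectation (\<lambda>\<omega>. X n \<omega> ^ 2))
       + 4 * (expectation T * expectation (\<lambda>\<omega>. X n \<omega> ^ 3)) + expectation (\<lambda>\<omega>. X n \<omega> ^ 4)"
      unfolding s4 using I[of 3 1] E[of 3 1] I[of 2 2] E[of 2 2] I[of 1 3] E[of 1 3] I4 by simp
    have IH: "expectation (\<lambda>\<omega>. T \<omega> ^ 2) = real n * \<gamma>" "expectation T = 0"
      "expectation (\<lambda>\<omega>. T \<omega> ^ 4) \<le> 3 * real n ^ 2 * q"
      using Suc unfolding T_def[abs_def] by auto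
    have sum_T: "(\<Sum>i<Suc n. X i \<omega>) = T \<omega> + X n \<omega>" for \<omega> by (simp add: T_def)
    have "expectation (\<lambda>\<omega>. (T \<omega> + X n \<omega>)^4) \<le> 3 * real n ^ 2 * q + 6 * (real n * (\<gamma> * \<gamma>)) + q"
      unfolding e4 using IH mean[of n] m2[of n] m4[of n] by simp
    also have "\<dots> \<le> 3 * real n ^ 2 * q + 6 * (real n * q) + q"
      using g2 by (auto intro!: mult_left_mono simp: power2_eq_square)
    also have "\<dots> \<le> 3 * real (Suc n) ^ 2 * q"
      using g2 by (simp add: power2_eq_square algebra_simps) (metis order_trans zero_le_square)
    finally show ?case unfolding sum_T e2
      using IH mean[of n] m2[of n] Bochner_Integration.integral_add[OF I4(1) I4(5)] by (simp add: algebra_simps)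
  qed simp
  then show "expectation (\<lambda>\<omega>. (\<Sum>i<n. X i \<omega>) ^ 2) = real n * \<gamma>"
    and "expectation (\<lambda>\<omega>. (\<Sum>i<n. X i \<omega>) ^ 4) \<le> 3 * real n ^ 2 * q" by auto
qed


section \<open>Functions with finite second moment\<close>

definition L2 :: "('a \<Rightarrow> real) \<Rightarrow> bool" where
  "L2 f \<longleftrightarrow> f \<in> borel_measurable M \<and> integrable M (\<lambda>\<omega>. f \<omega> ^ 2)"

lemma L2_mult_integrable:
  assumes "L2 f" "L2 g" shows "integrable M (\<lambda>\<omega>. f \<omega> * g \<omega>)"
proof (rule Bochner_Integration.integrable_bound[of M "\<lambda>\<omega>. f \<omega> ^ 2 + g \<omega> ^ 2"])
  have "\<bar>x * y\<bar> \<le> x^2 + y^2" for x y :: real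
  proof -
    have "2 * \<bar>x\<bar> * \<bar>y\<bar> \<le> x^2 + y^2" using sum_squares_bound[of "\<bar>x\<bar>" "\<bar>y\<bar>"] by simp
    moreover have "0 \<le> \<bar>x\<bar> * \<bar>y\<bar>" by simp
    ultimately show ?thesis unfolding abs_mult by linarith
  qed
  then show "AE \<omega> in M. norm (f \<omega> * g \<omega>) \<le> norm (f \<omega> ^ 2 + g \<omega> ^ 2)"
    by (intro AE_I2) simp
qed (use assms in \<open>auto simp: L2_def\<close>)

lemma L2_add:
  assumes "L2 f" "L2 g" shows "L2 (\<lambda>\<omega>. f \<omega> + g \<omega>)"
  using assms L2_mult_integrable[OF assms] unfolding L2_def power2_sum by (auto simp: mult.assoc)

lemma L2_const: "L2 (\<lambda>_. c)" by (simp add: L2_def)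

lemma L2_cmult: "L2 f \<Longrightarrow> L2 (\<lambda>\<omega>. c * f \<omega>)"
  by (auto simp: L2_def power_mult_distrib)

lemma L2_sum: "(\<And>i. i \<in> I \<Longrightarrow> L2 (f i)) \<Longrightarrow> L2 (\<lambda>\<omega>. \<Sum>i\<in>I. f i \<omega>)"
  by (induction I rule: infinite_finite_induct) (auto simp: L2_const intro!: L2_add)

lemma L2_integrable: "L2 f \<Longrightarrow> integrable M f" "L2 f \<Longrightarrow> integrable M (\<lambda>\<omega>. f \<omega> ^ 2)"
  using L2_mult_integrable[of f "\<lambda>_. 1"] L2_const[of 1] by (auto simp: L2_def)

lemma L4_imp_L2: "L4 f \<Longrightarrow> L2 f"
  using L4_integrable(2) by (auto simp: L2_def L4_def)

lemma L4_mult_L2: "L4 f \<Longrightarrow> L4 g \<Longrightarrow> L2 (\<lambda>\<omega>. f \<omega> * g \<omega>)"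
  using L4_prod_integrable[of f g f g] by (auto simp: L2_def L4_def power2_eq_square mult.assoc)

lemma L2_dominated:
  assumes "L2 b" "f \<in> borel_measurable M" "AE \<omega> in M. \<bar>f \<omega>\<bar> \<le> \<bar>b \<omega>\<bar>"
  shows "L2 f"
  unfolding L2_def
proof (rule conjI[OF _ Bochner_Integration.integrable_bound[of M "\<lambda>\<omega>. b \<omega> ^ 2"]])
  show "AE x in M. norm (f x ^ 2) \<le> norm (b x ^ 2)"
    using assms(3) by eventually_elim (simp add: abs_le_square_iff)
qed (use assms in \<open>auto simp: L2_def\<close>)

lemma second_moment_sum_le:
  fixes X :: "nat \<Rightarrow> 'a \<Rightarrow> real"
  assumes ind: "indep_vars (\<lambda>_. borel) X UNIV" and L2: "\<And>i. L2 (X i)"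
    and mean: "\<And>i. expectation (X i) = 0" and m2: "\<And>i. expectation (\<lambda>\<omega>. X i \<omega> ^ 2) \<le> \<gamma>"
  shows "expectation (\<lambda>\<omega>. (\<Sum>i<n. X i \<omega>) ^ 2) \<le> real n * \<gamma>"
proof (induction n)
  case (Suc n)
  define T where "T \<omega> = (\<Sum>i<n. X i \<omega>)" for \<omega>
  have T2: "L2 T" unfolding T_def by (intro L2_sum L2)
  have iv: "indep_var borel T borel (X n)"
  proof -
    have "indep_vars (\<lambda>_. borel) X (insert n {..<n})" using ind by (rule indep_vars_subset) auto
    from indep_vars_sum[OF _ _ this] have "indep_var borel (X n) borel T" unfolding T_def by auto
    then show ?thesis by (rule indep_var_commute)
  qed
  have E: "expectation (\<lambda>\<omega>. T \<omega> * X n \<omega>) = 0"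
    using indep_var_lebesgue_integral[OF iv L2_integrable(1)[OF T2] L2_integrable(1)[OF L2]] mean by simp
  have "expectation (\<lambda>\<omega>. (\<Sum>i<Suc n. X i \<omega>)^2) = expectation (\<lambda>\<omega>. T \<omega> ^ 2 + 2 * (T \<omega> * X n \<omega>) + X n \<omega> ^ 2)"
    by (simp add: T_def power2_sum algebra_simps)
  also have "\<dots> = expectation (\<lambda>\<omega>. T \<omega> ^ 2) + expectation (\<lambda>\<omega>. X n \<omega> ^ 2)"
    using L2_integrable(2)[OF T2] L2_integrable(2)[OF L2] L2_mult_integrable[OF T2 L2] E by simp
  also have "\<dots> \<le> real n * \<gamma> + \<gamma>" using Suc m2 unfolding T_def by (intro add_mono)
  finally show ?case by (simp add: algebra_simps)
qed simp

text \<open>Rectangles generate the product and are stable under intersection. This is the entry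
  point for the random division, whose independence is stated for generated sigma-algebras.\<close>

lemma indep_pairI:
  assumes A: "A \<in> measurable M MA" and B: "B \<in> measurable M MB"
    and prod: "\<And>U V. U \<in> sets MA \<Longrightarrow> V \<in> sets MB \<Longrightarrow>
      prob ((A -` U \<inter> space M) \<inter> (B -` V \<inter> space M)) = prob (A -` U \<inter> space M) * prob (B -` V \<inter> space M)"
  shows "indep_pair MA A MB B"
  unfolding indep_pair_def
proof (intro conjI A B pair_measure_eqI)
  show "sigma_finite_measure (distr M MA A)" "sigma_finite_measure (distr M MB B)"
    using prob_space_distr[OF A] prob_space_distr[OF B] by (simp_all add: prob_space_imp_sigma_finite)
  show "sets (distr M MA A \<Otimes>\<^sub>M distr M MB B) = sets (distr M (MA \<Otimes>\<^sub>M MB) (\<lambda>\<omega>. (A \<omega>, B \<omega>)))"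
    by (simp cong: sets_pair_measure_cong)
  fix U V assume "U \<in> sets (distr M MA A)" "V \<in> sets (distr M MB B)"
  then have U: "U \<in> sets MA" and V: "V \<in> sets MB" by auto
  have "(\<lambda>\<omega>. (A \<omega>, B \<omega>)) -` (U \<times> V) \<inter> space M = (A -` U \<inter> space M) \<inter> (B -` V \<inter> space M)" by auto
  then show "emeasure (distr M MA A) U * emeasure (distr M MB B) V =
      emeasure (distr M (MA \<Otimes>\<^sub>M MB) (\<lambda>\<omega>. (A \<omega>, B \<omega>))) (U \<times> V)"
    using A B U V prod[OF U V]
    by (simp add: emeasure_distr emeasure_eq_measure ennreal_mult'[symmetric] measurable_Pair)
qed

end

section \<open>Degenerate U-statistics\<close>

locale iid_sample = prob_space M for M :: "'w measure" +
  fixes E P :: "'z measure" and Z :: "nat \<Rightarrow> 'w \<Rightarrow> 'z"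
  assumes indep: "indep_vars (\<lambda>_. E) Z UNIV" and law: "\<And>i. distr M E (Z i) = P"
begin

lemma Z_measurable[measurable]: "Z i \<in> measurable M E"
  using indep by (auto simp: indep_vars_def)

lemma sets_P[measurable_cong]: "sets P = sets E"
  unfolding law[of 0, symmetric] by simp

lemma space_P: "space P = space E"
  by (rule sets_eq_imp_space_eq[OF sets_P])

sublocale P: prob_space P
  using law[of 0] prob_space_distr[OF Z_measurable[of 0]] by simp

text \<open>The history as one random element. The martingale structure is expressed by testing
  against functions of \<open>past l\<close>, which take the place of a filtration.\<close>

definition past :: "nat \<Rightarrow> 'w \<Rightarrow> nat \<Rightarrow> 'z" where
  "past l \<omega> = (\<lambda>i\<in>{..<l}. Z i \<omega>)"

lemma past_measurable[measurable]: "past l \<in> measurable M (PiM {..<l} (\<lambda>_. E))"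
  unfolding past_def by measurable

lemma indep_past: "indep_pair (PiM {..<l} (\<lambda>_. E)) (past l) E (Z l)"
proof -
  have "indep_var (PiM {..<l} (\<lambda>_. E)) (\<lambda>\<omega>. restrict (\<lambda>i. Z i \<omega>) {..<l}) (PiM {l} (\<lambda>_. E)) (\<lambda>\<omega>. restrict (\<lambda>i. Z i \<omega>) {l})"
    by (rule indep_var_restrict[OF indep]) auto
  from indep_pair_compose[OF this, of "\<lambda>p. p" _ "\<lambda>p. p l" E] show ?thesis
    by (simp add: past_def[abs_def])
qed

lemma integral_Z:
  fixes f :: "'z \<Rightarrow> 'c::{banach, second_countable_topology}"
  shows "f \<in> borel_measurable E \<Longrightarrow> expectation (\<lambda>\<omega>. f (Z i \<omega>)) = (\<integral>z. f z \<partial>P)"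
  unfolding law[of i, symmetric] by (subst integral_distr) auto

lemma integrable_Z:
  fixes f :: "'z \<Rightarrow> 'c::{banach, second_countable_topology}"
  shows "f \<in> borel_measurable E \<Longrightarrow> integrable M (\<lambda>\<omega>. f (Z i \<omega>)) \<longleftrightarrow> integrable P f"
  unfolding law[of i, symmetric] by (subst integrable_distr_eq) auto

lemma fubini_past:
  fixes F :: "_ \<Rightarrow> 'c::{banach, second_countable_topology}"
  assumes F[measurable]: "F \<in> borel_measurable (PiM {..<l} (\<lambda>_. E) \<Otimes>\<^sub>M E)"
    and int: "integrable M (\<lambda>\<omega>. F (past l \<omega>, Z l \<omega>))"
  shows "(\<integral>\<omega>. F (past l \<omega>, Z l \<omega>) \<partial>M) = (\<integral>\<omega>. (\<integral>z. F (past l \<omega>, z) \<partial>P) \<partial>M)"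
proof -
  have "(\<integral>\<omega>'. F (past l \<omega>, Z l \<omega>') \<partial>M) = (\<integral>z. F (past l \<omega>, z) \<partial>P)" if "\<omega> \<in> space M" for \<omega>
    using measurable_space[OF past_measurable that] by (subst integral_Z[of "\<lambda>z. F (past l \<omega>, z)"]) auto
  then show ?thesis
    unfolding indep_pair_fubini(1)[OF indep_past F int] by (intro Bochner_Integration.integral_cong refl)
qed

text \<open>The envelope has product form and a fourth moment. So every section \<open>k z\<close>
  lies in L4, not just almost every one, independence bounds the fourth moments of \<open>k\<close>
  at distinct observations, and the form is preserved by \<open>self_conv\<close>. In the
  application the noise is unbounded and the kernel in the covariates bounded, so \<open>b\<close>
  is a multiple of the absolute response.\<close>

definition degenerate :: "('z \<Rightarrow> 'z \<Rightarrow> real) \<Rightarrow> ('z \<Rightarrow> real) \<Rightarrow> bool" where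
  "degenerate k b \<longleftrightarrow> (\<lambda>(z, w). k z w) \<in> borel_measurable (E \<Otimes>\<^sub>M E) \<and> b \<in> borel_measurable E \<and>
     (\<forall>z\<in>space E. 0 \<le> b z) \<and> integrable P (\<lambda>z. b z ^ 4) \<and>
     (\<forall>z\<in>space E. \<forall>w\<in>space E. k z w = k w z \<and> \<bar>k z w\<bar> \<le> b z * b w) \<and>
     (\<forall>z\<in>space E. (\<integral>w. k z w \<partial>P) = 0)"

definition incr :: "('z \<Rightarrow> 'z \<Rightarrow> real) \<Rightarrow> nat \<Rightarrow> 'w \<Rightarrow> real" where
  "incr k l \<omega> = (\<Sum>i<l. k (Z i \<omega>) (Z l \<omega>))"

text \<open>For symmetric \<open>k\<close>, the kernel of the square of the integral operator given
  by \<open>k\<close>.\<close>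

definition self_conv :: "('z \<Rightarrow> 'z \<Rightarrow> real) \<Rightarrow> 'z \<Rightarrow> 'z \<Rightarrow> real" where
  "self_conv k z w = (\<integral>u. k z u * k w u \<partial>P)"

text \<open>The conditional variance of \<open>incr k l\<close> given the past, with the integral
  over the last observation carried out.\<close>

definition cond_var :: "('z \<Rightarrow> 'z \<Rightarrow> real) \<Rightarrow> nat \<Rightarrow> 'w \<Rightarrow> real" where
  "cond_var k l \<omega> = (\<Sum>i<l. \<Sum>j<l. self_conv k (Z i \<omega>) (Z j \<omega>))"

definition kernel_moment :: "('z \<Rightarrow> 'z \<Rightarrow> real) \<Rightarrow> nat \<Rightarrow> real" where
  "kernel_moment k m = (\<integral>z. (\<integral>w. k z w ^ m \<partial>P) \<partial>P)"

context
  fixes k b assumes deg: "degenerate k b"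
begin

lemma
  shows kernel_measurable: "(\<lambda>(z, w). k z w) \<in> borel_measurable (E \<Otimes>\<^sub>M E)"
    and envelope_measurable: "b \<in> borel_measurable E"
    and envelope_nonneg: "\<And>z. z \<in> space E \<Longrightarrow> 0 \<le> b z"
    and kernel_symmetric: "\<And>z w. z \<in> space E \<Longrightarrow> w \<in> space E \<Longrightarrow> k z w = k w z"
    and kernel_bound: "\<And>z w. z \<in> space E \<Longrightarrow> w \<in> space E \<Longrightarrow> \<bar>k z w\<bar> \<le> b z * b w"
    and kernel_mean: "\<And>z. z \<in> space E \<Longrightarrow> (\<integral>w. k z w \<partial>P) = 0"
    and envelope_integrable: "integrable P (\<lambda>z. b z ^ 4)"
  using deg unfolding degenerate_def by auto

lemma kernel_comp_measurable[measurable (raw)]: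
  assumes "f \<in> measurable N E" "h \<in> measurable N E"
  shows "(\<lambda>x. k (f x) (h x)) \<in> borel_measurable N"
  using measurable_compose[OF measurable_Pair[OF assms] kernel_measurable] by simp

declare envelope_measurable[measurable]

lemma P_L4_envelope: "P.L4 b"
  unfolding P.L4_def using envelope_integrable by simp

lemma P_L4_kernel: "z \<in> space E \<Longrightarrow> P.L4 (k z)"
  by (rule P.L4_dominated[OF P.L4_cmult[OF P_L4_envelope, of "b z"]])
     (auto simp: space_P abs_mult envelope_nonneg intro!: AE_I2 kernel_bound)

lemma L4_envelope: "L4 (\<lambda>\<omega>. b (Z i \<omega>))"
  unfolding L4_def using envelope_integrable integrable_Z[of "\<lambda>z. b z ^ 4" i] by simp

lemma indep_Z: "i \<noteq> j \<Longrightarrow> indep_var E (Z i) E (Z j)"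
  using indep_var_compose[OF indep_var_restrict[OF indep, of "{i}" "{j}"], of "\<lambda>p. p i" E "\<lambda>p. p j" E]
  by (simp add: comp_def)

text \<open>Independence factorises the fourth moment of the product envelope; on the diagonal
  eighth moments of \<open>b\<close> would be required.\<close>

lemma L4_kernel: "i \<noteq> j \<Longrightarrow> L4 (\<lambda>\<omega>. k (Z i \<omega>) (Z j \<omega>))"
proof (rule L4_dominated[of "\<lambda>\<omega>. b (Z i \<omega>) * b (Z j \<omega>)"])
  assume ij: "i \<noteq> j"
  have "indep_var borel (\<lambda>\<omega>. b (Z i \<omega>) ^ 4) borel (\<lambda>\<omega>. b (Z j \<omega>) ^ 4)"
    using indep_var_compose[OF indep_Z[OF ij], of "\<lambda>z. b z ^ 4" borel "\<lambda>z. b z ^ 4" borel]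
    by (simp add: comp_def)
  then show "L4 (\<lambda>\<omega>. b (Z i \<omega>) * b (Z j \<omega>))"
    unfolding L4_def power_mult_distrib using L4_envelope[of i] L4_envelope[of j]
    by (auto intro!: indep_var_integrable simp: L4_def)
  show "AE \<omega> in M. \<bar>k (Z i \<omega>) (Z j \<omega>)\<bar> \<le> \<bar>b (Z i \<omega>) * b (Z j \<omega>)\<bar>"
    using measurable_space[OF Z_measurable]
    by (intro AE_I2) (auto intro!: order_trans[OF kernel_bound])
qed auto

lemma L4_incr: "L4 (incr k l)"
  unfolding incr_def[abs_def] by (intro L4_sum L4_kernel) auto

lemma incr_past: "incr k l \<omega> = (\<Sum>i<l. k (past l \<omega> i) (Z l \<omega>))"
  by (simp add: incr_def past_def)

text \<open>The martingale difference property in weak form. The test function takes values in a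
  Banach space because it is real in the variance computations and a complex phase in
  \<open>char_step\<close>.\<close>

lemma expectation_incr_past:
  fixes f :: "_ \<Rightarrow> 'c::{banach, second_countable_topology}"
  assumes [measurable]: "f \<in> borel_measurable (PiM {..<l} (\<lambda>_. E))"
    and int: "integrable M (\<lambda>\<omega>. incr k l \<omega> *\<^sub>R f (past l \<omega>))"
  shows "expectation (\<lambda>\<omega>. incr k l \<omega> *\<^sub>R f (past l \<omega>)) = 0"
proof -
  define F where "F = (\<lambda>(p, z). (\<Sum>i<l. k (p i) z) *\<^sub>R f p)"
  have [measurable]: "F \<in> borel_measurable (PiM {..<l} (\<lambda>_. E) \<Otimes>\<^sub>M E)"
    unfolding F_def by measurable
  have eq: "incr k l \<omega> *\<^sub>R f (past l \<omega>) = F (past l \<omega>, Z l \<omega>)" for \<omega>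
    by (simp add: F_def incr_past)
  have "(\<integral>z. F (past l \<omega>, z) \<partial>P) = 0" if "\<omega> \<in> space M" for \<omega>
  proof -
    have sp: "past l \<omega> i \<in> space E" if "i < l" for i
      using that \<open>\<omega> \<in> space M\<close> measurable_space[OF Z_measurable] by (simp add: past_def)
    have i: "integrable P (\<lambda>z. \<Sum>i<l. k (past l \<omega> i) z)"
      by (intro Bochner_Integration.integrable_sum P.L4_integrable(1) P_L4_kernel sp) auto
    have "(\<integral>z. (\<Sum>i<l. k (past l \<omega> i) z) \<partial>P) = 0"
      by (subst Bochner_Integration.integral_sum) (auto intro!: P.L4_integrable(1) P_L4_kernel sp sum.neutral kernel_mean)
    then show ?thesis unfolding F_def using i by simp
  qed
  then show ?thesis unfolding eq
    by (subst fubini_past) (use int eq in \<open>auto intro!: integral_eq_zero_AE\<close>)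
qed

lemma self_conv_past:
  assumes "\<omega> \<in> space M"
  shows "(\<integral>z. (\<Sum>i<l. k (past l \<omega> i) z)^2 \<partial>P) = cond_var k l \<omega>"
    and "integrable P (\<lambda>z. (\<Sum>i<l. k (past l \<omega> i) z)^2)"
proof -
  have sp: "Z i \<omega> \<in> space E" for i
    using measurable_space[OF Z_measurable assms] .
  have i: "integrable P (\<lambda>z. k (Z i \<omega>) z * k (Z j \<omega>) z)" for i j
    by (intro P.L4_mult_integrable P_L4_kernel sp)
  have e: "(\<Sum>i<l. k (past l \<omega> i) z)^2 = (\<Sum>i<l. \<Sum>j<l. k (Z i \<omega>) z * k (Z j \<omega>) z)" for z
    unfolding power2_eq_square sum_product by (simp add: past_def)
  show "(\<integral>z. (\<Sum>i<l. k (past l \<omega> i) z)^2 \<partial>P) = cond_var k l \<omega>"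
    unfolding e cond_var_def self_conv_def using i by simp
  show "integrable P (\<lambda>z. (\<Sum>i<l. k (past l \<omega> i) z)^2)"
    unfolding e using i by simp
qed

lemma expectation_incr_square_past:
  fixes f :: "_ \<Rightarrow> 'c::{banach, second_countable_topology}"
  assumes [measurable]: "f \<in> borel_measurable (PiM {..<l} (\<lambda>_. E))"
    and int: "integrable M (\<lambda>\<omega>. (incr k l \<omega>)^2 *\<^sub>R f (past l \<omega>))"
  shows "expectation (\<lambda>\<omega>. (incr k l \<omega>)^2 *\<^sub>R f (past l \<omega>)) = expectation (\<lambda>\<omega>. cond_var k l \<omega> *\<^sub>R f (past l \<omega>))"
proof -
  define F where "F = (\<lambda>(p, z). (\<Sum>i<l. k (p i) z)^2 *\<^sub>R f p)"
  have [measurable]: "F \<in> borel_measurable (PiM {..<l} (\<lambda>_. E) \<Otimes>\<^sub>M E)"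
    unfolding F_def by measurable
  have eq: "(incr k l \<omega>)^2 *\<^sub>R f (past l \<omega>) = F (past l \<omega>, Z l \<omega>)" for \<omega>
    by (simp add: F_def incr_past)
  have "(\<integral>z. F (past l \<omega>, z) \<partial>P) = cond_var k l \<omega> *\<^sub>R f (past l \<omega>)" if "\<omega> \<in> space M" for \<omega>
    using self_conv_past[OF that, of l] unfolding F_def by simp
  then show ?thesis unfolding eq
    by (subst fubini_past) (use int eq in \<open>auto intro!: Bochner_Integration.integral_cong\<close>)
qed

lemma self_conv_bound:
  assumes "z \<in> space E" "w \<in> space E"
  shows "\<bar>self_conv k z w\<bar> \<le> (sqrt (\<integral>u. b u ^ 2 \<partial>P) * b z) * (sqrt (\<integral>u. b u ^ 2 \<partial>P) * b w)"
proof -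
  have "\<bar>self_conv k z w\<bar> \<le> (\<integral>u. (b z * b w) * b u ^ 2 \<partial>P)"
    unfolding self_conv_def
  proof (rule order_trans[OF integral_abs_bound integral_mono])
    show "integrable P (\<lambda>u. \<bar>k z u * k w u\<bar>)" by (intro integrable_abs P.L4_mult_integrable P_L4_kernel assms)
    show "integrable P (\<lambda>u. (b z * b w) * b u ^ 2)" using P.L4_integrable(2)[OF P_L4_envelope] by simp
    fix u assume "u \<in> space P"
    then have u: "u \<in> space E" by (simp add: space_P)
    have "\<bar>k z u\<bar> * \<bar>k w u\<bar> \<le> (b z * b u) * (b w * b u)"
      by (intro mult_mono kernel_bound assms u) (auto intro!: mult_nonneg_nonneg envelope_nonneg assms u)
    then show "\<bar>k z u * k w u\<bar> \<le> (b z * b w) * b u ^ 2"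
      by (simp add: abs_mult power2_eq_square mult_ac)
  qed
  also have "\<dots> = (b z * b w) * (sqrt (\<integral>u. b u ^ 2 \<partial>P))^2"
    by simp
  finally show ?thesis by (simp only: power2_eq_square mult_ac)
qed

text \<open>Closure under convolution is what makes the conditional variances tractable: their
  off-diagonal part is again a degenerate U-statistic. The mean vanishes by exchanging the two
  integrals, and each argument receives one square root of the second moment of \<open>b\<close>,
  which keeps the envelope in product form.\<close>

lemma self_conv_degenerate: "degenerate (self_conv k) (\<lambda>z. sqrt (\<integral>u. b u ^ 2 \<partial>P) * b z)"
proof -
  have m: "(\<lambda>(z, w). self_conv k z w) \<in> borel_measurable (E \<Otimes>\<^sub>M E)"
    unfolding self_conv_def by measurable
  have mean: "(\<integral>w. self_conv k z w \<partial>P) = 0" if z: "z \<in> space E" for z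
  proof -
    interpret PP: pair_prob_space P P ..
    have [measurable_cong]: "sets (P \<Otimes>\<^sub>M P) = sets (E \<Otimes>\<^sub>M E)"
      by (intro sets_pair_measure_cong sets_P)
    have [measurable]: "(\<lambda>x. z) \<in> measurable L E" for L :: "('z \<times> 'z) measure"
      using z by simp
    have i: "integrable (P \<Otimes>\<^sub>M P) (\<lambda>(w, u). k z u * k w u)"
    proof (rule Bochner_Integration.integrable_bound)
      show "integrable (P \<Otimes>\<^sub>M P) (\<lambda>(w, u). b w * (b z * b u ^ 2))"
        by (rule PP.integrable_times) (auto intro!: P.L4_integrable P_L4_envelope)
      show "AE x in P \<Otimes>\<^sub>M P. norm (case x of (w, u) \<Rightarrow> k z u * k w u) \<le> norm (case x of (w, u) \<Rightarrow> b w * (b z * b u ^ 2))"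
      proof (rule AE_I2, clarsimp simp: space_pair_measure space_P)
        fix w u assume wu: "w \<in> space E" "u \<in> space E"
        have "\<bar>k z u\<bar> * \<bar>k w u\<bar> \<le> (b z * b u) * (b w * b u)"
          by (intro mult_mono kernel_bound z wu) (auto intro!: mult_nonneg_nonneg envelope_nonneg z wu)
        then show "\<bar>k z u * k w u\<bar> \<le> \<bar>b w * (b z * (b u)\<^sup>2)\<bar>"
          by (simp add: abs_mult power2_eq_square mult_ac envelope_nonneg z wu)
      qed
    qed measurable
    have "(\<integral>w. self_conv k z w \<partial>P) = (\<integral>w. (\<integral>u. k z u * k w u \<partial>P) \<partial>P)"
      unfolding self_conv_def ..
    also have "\<dots> = (\<integral>u. (\<integral>w. k z u * k w u \<partial>P) \<partial>P)"
      using PP.Fubini_integral[OF i] by simp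
    also have "\<dots> = (\<integral>u. k z u * (\<integral>w. k u w \<partial>P) \<partial>P)"
    proof (intro Bochner_Integration.integral_cong refl)
      fix u assume "u \<in> space P"
      then have "(\<integral>w. k w u \<partial>P) = (\<integral>w. k u w \<partial>P)"
        by (intro Bochner_Integration.integral_cong refl kernel_symmetric) (auto simp: space_P)
      then show "(\<integral>w. k z u * k w u \<partial>P) = k z u * (\<integral>w. k u w \<partial>P)" by simp
    qed
    also have "\<dots> = 0"
      by (intro integral_eq_zero_AE AE_I2) (auto simp: kernel_mean space_P)
    finally show ?thesis .
  qed
  have "self_conv k z w = self_conv k w z" for z w
    by (simp add: self_conv_def mult.commute)
  moreover have "integrable P (\<lambda>z. (sqrt (\<integral>u. b u ^ 2 \<partial>P) * b z) ^ 4)"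
    using envelope_integrable by (simp add: power_mult_distrib)
  ultimately show ?thesis
    unfolding degenerate_def using m mean self_conv_bound by (auto simp: envelope_nonneg)
qed

end

end

context iid_sample begin

context
  fixes k b assumes deg: "degenerate k b"
begin

text \<open>Closing and reopening the context frees \<open>k\<close>, so that the lemmas above apply
  to \<open>self_conv k\<close> as well as to \<open>k\<close>.\<close>

lemmas self_deg = self_conv_degenerate[OF deg]

lemma self_conv_diag: "self_conv k z z = (\<integral>w. k z w ^ 2 \<partial>P)"
  by (simp add: self_conv_def power2_eq_square)

lemma self_conv_measurable[measurable (raw)]:
  assumes "f \<in> measurable N E" "h \<in> measurable N E"
  shows "(\<lambda>x. self_conv k (f x) (h x)) \<in> borel_measurable N"
  by (rule kernel_comp_measurable[OF self_deg assms])

text \<open>The new row and the new column each contribute an increment with kernel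
  \<open>self_conv k\<close>; the corner is a diagonal term.\<close>

lemma cond_var_Suc:
  "cond_var k (Suc l) \<omega> = cond_var k l \<omega> + (2 * incr (self_conv k) l \<omega> + self_conv k (Z l \<omega>) (Z l \<omega>))"
proof -
  have "(\<Sum>i<l. self_conv k (Z l \<omega>) (Z i \<omega>)) = incr (self_conv k) l \<omega>"
    by (simp add: incr_def self_conv_def mult.commute)
  then show ?thesis
    unfolding cond_var_def by (simp add: sum.distrib incr_def)
qed

text \<open>On the diagonal the envelope is squared, so that its fourth moment yields only a second
  moment here.\<close>

lemma L2_self_conv_diag: "L2 (\<lambda>\<omega>. self_conv k (Z i \<omega>) (Z i \<omega>))"
proof (rule L2_dominated[OF L4_mult_L2[OF L4_envelope[OF self_deg] L4_envelope[OF self_deg]]])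
  show "AE \<omega> in M. \<bar>self_conv k (Z i \<omega>) (Z i \<omega>)\<bar> \<le>
    \<bar>sqrt (\<integral>u. b u ^ 2 \<partial>P) * b (Z i \<omega>) * (sqrt (\<integral>u. b u ^ 2 \<partial>P) * b (Z i \<omega>))\<bar>"
    using measurable_space[OF Z_measurable]
    by (intro AE_I2 order_trans[OF kernel_bound[OF self_deg]]) auto
qed measurable

lemma L2_cond_var: "L2 (cond_var k l)"
  unfolding cond_var_def[abs_def]
proof (intro L2_sum)
  fix i j
  show "L2 (\<lambda>\<omega>. self_conv k (Z i \<omega>) (Z j \<omega>))"
    using L2_self_conv_diag[of i] L4_imp_L2[OF L4_kernel[OF self_deg, of i j]] by (cases "i = j") auto
qed

lemma expectation_incr: "expectation (incr k l) = 0"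
  using expectation_incr_past[OF deg, of "\<lambda>_. 1::real" l] L4_integrable(1)[OF L4_incr[OF deg]] by simp

lemma expectation_cond_var: "expectation (cond_var k l) = real l * kernel_moment k 2"
proof (induction l)
  case (Suc l)
  note i = L2_integrable(1)[OF L2_cond_var, of l] L4_integrable(1)[OF L4_incr[OF self_deg], of l]
    L2_integrable(1)[OF L2_self_conv_diag, of l]
  have e0: "expectation (incr (self_conv k) l) = 0"
    using expectation_incr_past[OF self_deg, of "\<lambda>_. 1::real" l] i(2) by simp
  have e1: "expectation (\<lambda>\<omega>. self_conv k (Z l \<omega>) (Z l \<omega>)) = kernel_moment k 2"
    by (subst integral_Z) (simp_all add: kernel_moment_def self_conv_diag[symmetric])
  have "expectation (cond_var k (Suc l)) =
    expectation (\<lambda>\<omega>. cond_var k l \<omega> + (2 * incr (self_conv k) l \<omega> + self_conv k (Z l \<omega>) (Z l \<omega>)))"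
    by (intro Bochner_Integration.integral_cong refl cond_var_Suc)
  also have "\<dots> = expectation (cond_var k l) + (2 * expectation (incr (self_conv k) l) + kernel_moment k 2)"
    using i by (simp add: e1)
  finally show ?case using Suc e0 by (simp add: algebra_simps)
qed (simp add: cond_var_def)

lemma expectation_incr_square: "expectation (\<lambda>\<omega>. incr k l \<omega> ^ 2) = real l * kernel_moment k 2"
  using expectation_incr_square_past[OF deg, of "\<lambda>_. 1::real" l] L4_integrable(2)[OF L4_incr[OF deg]]
  by (simp add: expectation_cond_var)

lemma integrable_fourth_moment: "integrable P (\<lambda>z. (\<integral>w. k z w ^ 4 \<partial>P))"
proof (rule Bochner_Integration.integrable_bound[of P "\<lambda>z. b z ^ 4 * (\<integral>w. b w ^ 4 \<partial>P)"])
  note kernel_comp_measurable[OF deg, measurable (raw)]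
  show "(\<lambda>z. (\<integral>w. k z w ^ 4 \<partial>P)) \<in> borel_measurable P" by measurable
  show "AE z in P. norm (\<integral>w. k z w ^ 4 \<partial>P) \<le> norm (b z ^ 4 * (\<integral>w. b w ^ 4 \<partial>P))"
  proof (rule AE_I2)
    fix z assume "z \<in> space P"
    then have z: "z \<in> space E" by (simp add: space_P)
    have "(\<integral>w. k z w ^ 4 \<partial>P) \<le> (\<integral>w. b z ^ 4 * b w ^ 4 \<partial>P)"
    proof (rule integral_mono)
      show "integrable P (\<lambda>w. k z w ^ 4)" by (rule P.L4_integrable(4)[OF P_L4_kernel[OF deg z]])
      show "integrable P (\<lambda>w. b z ^ 4 * b w ^ 4)" using envelope_integrable[OF deg] by simp
      fix w assume "w \<in> space P"
      then have w: "w \<in> space E" by (simp add: space_P)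
      have "\<bar>k z w\<bar> ^ 4 \<le> (b z * b w) ^ 4" by (intro power_mono kernel_bound[OF deg] z w) auto
      then show "k z w ^ 4 \<le> b z ^ 4 * b w ^ 4" by (simp add: power_mult_distrib)
    qed
    then show "norm (\<integral>w. k z w ^ 4 \<partial>P) \<le> norm (b z ^ 4 * (\<integral>w. b w ^ 4 \<partial>P))"
      by simp
  qed
qed (use envelope_integrable[OF deg] in simp)

lemma self_conv_diag_square_le:
  assumes z: "z \<in> space E" shows "self_conv k z z ^ 2 \<le> (\<integral>w. k z w ^ 4 \<partial>P)"
proof -
  note i = P.L4_integrable[OF P_L4_kernel[OF deg z]]
  have "P.variance (\<lambda>w. k z w ^ 2) = P.expectation (\<lambda>w. (k z w ^ 2) ^ 2) - (self_conv k z z)\<^sup>2"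
    unfolding self_conv_diag using i by (intro P.variance_eq) auto
  moreover have "P.variance (\<lambda>w. k z w ^ 2) \<ge> 0" by (rule P.variance_positive)
  ultimately show ?thesis by simp
qed

lemma expectation_self_conv_diag_centred:
  "expectation (\<lambda>\<omega>. (self_conv k (Z l \<omega>) (Z l \<omega>) - kernel_moment k 2)^2) \<le> kernel_moment k 4 - (kernel_moment k 2)^2"
proof -
  note i = L2_integrable[OF L2_self_conv_diag[of l]]
  have e1: "expectation (\<lambda>\<omega>. self_conv k (Z l \<omega>) (Z l \<omega>)) = kernel_moment k 2"
    by (subst integral_Z) (simp_all add: kernel_moment_def self_conv_diag[symmetric])
  have "expectation (\<lambda>\<omega>. (self_conv k (Z l \<omega>) (Z l \<omega>) - kernel_moment k 2)^2)
    = expectation (\<lambda>\<omega>. self_conv k (Z l \<omega>) (Z l \<omega>) ^ 2) - (kernel_moment k 2)^2"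
    using variance_eq[OF i] unfolding e1 by simp
  also have "expectation (\<lambda>\<omega>. self_conv k (Z l \<omega>) (Z l \<omega>) ^ 2) = (\<integral>z. self_conv k z z ^ 2 \<partial>P)"
    by (subst integral_Z) auto
  also have "\<dots> \<le> kernel_moment k 4"
    unfolding kernel_moment_def
  proof (rule integral_mono)
    show "integrable P (\<lambda>z. self_conv k z z ^ 2)"
      using i(2) by (subst (asm) integrable_Z) auto
  qed (auto simp: space_P self_conv_diag_square_le integrable_fourth_moment)
  finally show ?thesis by simp
qed

lemma kernel_moment_square_le: "(kernel_moment k 2)^2 \<le> kernel_moment k 4"
proof -
  have "0 \<le> expectation (\<lambda>\<omega>. (self_conv k (Z 0 \<omega>) (Z 0 \<omega>) - kernel_moment k 2)^2)" by simp
  then show ?thesis using expectation_self_conv_diag_centred[of 0] by linarith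
qed

text \<open>By \<open>cond_var_Suc\<close> the centred conditional variance is a martingale with
  increments \<open>2 * B + C\<close>. Both parts are orthogonal to the past, so second moments add
  up. One increment costs at most \<open>8 * l * kernel_moment (self_conv k) 2 + 2 * kernel_moment k
  4\<close>, and the sum of these first factors over the steps stays below
  \<open>8 * l\<^sup>2\<close>.\<close>

lemma cond_var_fluctuation:
  "expectation (\<lambda>\<omega>. (cond_var k l \<omega> - real l * kernel_moment k 2)^2)
     \<le> 8 * real l ^ 2 * kernel_moment (self_conv k) 2 + 2 * real l * kernel_moment k 4"
proof (induction l)
  case (Suc l)
  define \<kappa> where "\<kappa> = kernel_moment k 2"
  define B where "B = incr (self_conv k) l"
  define C where "C \<omega> = self_conv k (Z l \<omega>) (Z l \<omega>) - \<kappa>" for \<omega>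
  define f where "f p = (\<Sum>i<l. \<Sum>j<l. self_conv k (p i) (p j)) - real l * \<kappa>" for p
  define c where "c \<omega> = cond_var k l \<omega> - real l * \<kappa>" for \<omega>
  have [measurable]: "f \<in> borel_measurable (PiM {..<l} (\<lambda>_. E))" unfolding f_def by measurable
  have cf: "c \<omega> = f (past l \<omega>)" for \<omega>
    unfolding c_def f_def cond_var_def past_def by simp
  have L2c: "L2 c" unfolding c_def[abs_def] using L2_add[OF L2_cond_var L2_const[of "- (real l * \<kappa>)"]] by simp
  have L2B: "L2 B" unfolding B_def by (rule L4_imp_L2[OF L4_incr[OF self_deg]])
  have L2C: "L2 C" unfolding C_def[abs_def] using L2_add[OF L2_self_conv_diag L2_const[of "- \<kappa>"]] by simp
  note L2R = L2_add[OF L2_cmult[OF L2B, of 2] L2C]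
  have cB: "expectation (\<lambda>\<omega>. c \<omega> * B \<omega>) = 0"
    using expectation_incr_past[OF self_deg, of f l] L2_mult_integrable[OF L2B L2c]
    unfolding cf B_def by (simp add: mult.commute)
  have cC: "expectation (\<lambda>\<omega>. c \<omega> * C \<omega>) = 0"
  proof -
    have "expectation (\<lambda>\<omega>. c \<omega> * C \<omega>) = expectation (\<lambda>\<omega>. (\<lambda>(p, z). f p * (self_conv k z z - \<kappa>)) (past l \<omega>, Z l \<omega>))"
      unfolding cf C_def by simp
    also have "\<dots> = expectation (\<lambda>\<omega>. \<integral>z. (\<lambda>(p, z). f p * (self_conv k z z - \<kappa>)) (past l \<omega>, z) \<partial>P)"
      using L2_mult_integrable[OF L2c L2C] unfolding cf C_def by (intro fubini_past) auto
    also have "\<dots> = 0"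
    proof -
      have "integrable P (\<lambda>z. self_conv k z z)"
        using L2_integrable(1)[OF L2_self_conv_diag[of l]] by (subst (asm) integrable_Z) auto
      moreover have "(\<integral>z. self_conv k z z \<partial>P) = \<kappa>"
        by (simp add: \<kappa>_def kernel_moment_def self_conv_diag)
      ultimately show ?thesis by (simp add: P.prob_space)
    qed
    finally show ?thesis .
  qed
  have Suc_eq: "cond_var k (Suc l) \<omega> - real (Suc l) * \<kappa> = c \<omega> + (2 * B \<omega> + C \<omega>)" for \<omega>
    unfolding cond_var_Suc c_def B_def C_def by (simp add: algebra_simps)
  have EB: "expectation (\<lambda>\<omega>. B \<omega> ^ 2) = real l * kernel_moment (self_conv k) 2"
    unfolding B_def using expectation_incr_square_past[OF self_deg, of "\<lambda>_. 1::real" l]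
      L4_integrable(2)[OF L4_incr[OF self_deg]] iid_sample.expectation_cond_var[OF iid_sample_axioms self_deg, of l] by simp
  have EC: "expectation (\<lambda>\<omega>. C \<omega> ^ 2) \<le> kernel_moment k 4"
    unfolding C_def \<kappa>_def by (rule order_trans[OF expectation_self_conv_diag_centred]) simp
  have "expectation (\<lambda>\<omega>. (2 * B \<omega> + C \<omega>)^2) \<le> expectation (\<lambda>\<omega>. 8 * B \<omega> ^ 2 + 2 * C \<omega> ^ 2)"
  proof (rule integral_mono)
    fix \<omega> show "(2 * B \<omega> + C \<omega>)^2 \<le> 8 * B \<omega> ^ 2 + 2 * C \<omega> ^ 2"
      using sum_squares_bound[of "2 * B \<omega>" "C \<omega>"] by (simp add: power2_sum power_mult_distrib)
  qed (use L2R L2B L2C in \<open>auto simp: L2_def\<close>)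
  also have "\<dots> = 8 * expectation (\<lambda>\<omega>. B \<omega> ^ 2) + 2 * expectation (\<lambda>\<omega>. C \<omega> ^ 2)"
    using L2B L2C by (simp add: L2_def)
  also have "\<dots> \<le> 8 * (real l * kernel_moment (self_conv k) 2) + 2 * kernel_moment k 4"
    using EB EC by simp
  finally have R: "expectation (\<lambda>\<omega>. (2 * B \<omega> + C \<omega>)^2) \<le> 8 * (real l * kernel_moment (self_conv k) 2) + 2 * kernel_moment k 4" .
  have \<theta>: "0 \<le> kernel_moment (self_conv k) 2"
    unfolding kernel_moment_def by (intro Bochner_Integration.integral_nonneg) auto
  have "expectation (\<lambda>\<omega>. (cond_var k (Suc l) \<omega> - real (Suc l) * \<kappa>)^2) =
     expectation (\<lambda>\<omega>. c \<omega> ^ 2 + (2 * B \<omega> + C \<omega>)^2 + (4 * (c \<omega> * B \<omega>) + 2 * (c \<omega> * C \<omega>)))"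
    by (intro Bochner_Integration.integral_cong refl)
       (simp only: Suc_eq power2_eq_square, simp add: algebra_simps)
  also have "\<dots> = expectation (\<lambda>\<omega>. c \<omega> ^ 2) + expectation (\<lambda>\<omega>. (2 * B \<omega> + C \<omega>)^2) +
      (4 * expectation (\<lambda>\<omega>. c \<omega> * B \<omega>) + 2 * expectation (\<lambda>\<omega>. c \<omega> * C \<omega>))"
    using L2_integrable(2)[OF L2c] L2_integrable(2)[OF L2R] L2_mult_integrable[OF L2c L2B] L2_mult_integrable[OF L2c L2C]
    by simp
  also have "\<dots> \<le> (8 * real l ^ 2 * kernel_moment (self_conv k) 2 + 2 * real l * kernel_moment k 4) +
     (8 * (real l * kernel_moment (self_conv k) 2) + 2 * kernel_moment k 4)"
    using Suc R cB cC unfolding c_def \<kappa>_def by simp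
  also have "\<dots> \<le> 8 * real (Suc l) ^ 2 * kernel_moment (self_conv k) 2 + 2 * real (Suc l) * kernel_moment k 4"
    using \<theta> mult_nonneg_nonneg[OF _ \<theta>, of "real l"] by (simp add: power2_eq_square algebra_simps)
  finally show ?case unfolding \<kappa>_def .
qed (simp add: cond_var_def)

lemma expectation_abs_cond_var:
  "expectation (\<lambda>\<omega>. \<bar>cond_var k l \<omega> - real l * kernel_moment k 2\<bar>)
     \<le> sqrt (8 * real l ^ 2 * kernel_moment (self_conv k) 2 + 2 * real l * kernel_moment k 4)"
proof -
  have "L2 (\<lambda>\<omega>. cond_var k l \<omega> - real l * kernel_moment k 2)"
    using L2_add[OF L2_cond_var L2_const[of "- (real l * kernel_moment k 2)"]] by simp
  then have "expectation (\<lambda>\<omega>. \<bar>cond_var k l \<omega> - real l * kernel_moment k 2\<bar>) \<le> sqrt (expectation (\<lambda>\<omega>. (cond_var k l \<omega> - real l * kernel_moment k 2)^2))"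
    by (intro abs_expectation_le_sqrt) (auto simp: L2_def)
  also have "\<dots> \<le> sqrt (8 * real l ^ 2 * kernel_moment (self_conv k) 2 + 2 * real l * kernel_moment k 4)"
    by (intro real_sqrt_le_mono cond_var_fluctuation)
  finally show ?thesis .
qed

text \<open>Here the last observation is frozen and the past is integrated: given
  \<open>Z l = z\<close>, the increment is a sum of i.i.d. centred variables
  \<open>k z (Z i)\<close>, and \<open>fourth_moment_sum_le\<close> applies. Hence the swapped order
  of arguments in \<open>F\<close>.\<close>

lemma expectation_incr_power4: "expectation (\<lambda>\<omega>. incr k l \<omega> ^ 4) \<le> 3 * real l ^ 2 * kernel_moment k 4"
proof -
  note kernel_comp_measurable[OF deg, measurable (raw)]
  define F where "F = (\<lambda>(z, p). (\<Sum>i<l. k (p i) z) ^ 4)"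
  have F[measurable]: "F \<in> borel_measurable (E \<Otimes>\<^sub>M PiM {..<l} (\<lambda>_. E))" unfolding F_def by measurable
  have e: "incr k l \<omega> ^ 4 = F (Z l \<omega>, past l \<omega>)" for \<omega> by (simp add: F_def incr_def past_def)
  have int: "integrable M (\<lambda>\<omega>. F (Z l \<omega>, past l \<omega>))"
    unfolding e[symmetric] by (rule L4_integrable(4)[OF L4_incr[OF deg]])
  have inner: "(\<integral>\<omega>'. F (z, past l \<omega>') \<partial>M) \<le> 3 * real l ^ 2 * (\<integral>w. k z w ^ 4 \<partial>P)" if z: "z \<in> space E" for z
  proof -
    have [measurable]: "k z \<in> borel_measurable E"
      by (rule kernel_comp_measurable[OF deg]) (use z in auto)
    have m: "(\<lambda>w. k w z) \<in> borel_measurable E"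
      by (rule kernel_comp_measurable[OF deg]) (use z in auto)
    have sw: "k (Z i \<omega>') z = k z (Z i \<omega>')" if "\<omega>' \<in> space M" for i \<omega>'
      by (rule kernel_symmetric[OF deg measurable_space[OF Z_measurable that] z])
    have "expectation (\<lambda>\<omega>'. (\<Sum>i<l. k z (Z i \<omega>')) ^ 4) \<le> 3 * real l ^ 2 * (\<integral>w. k z w ^ 4 \<partial>P)"
    proof (rule fourth_moment_sum_le(2))
      show "indep_vars (\<lambda>_. borel) (\<lambda>i \<omega>. k z (Z i \<omega>)) UNIV"
        using indep_vars_compose2[OF indep, of "\<lambda>_. k z" "\<lambda>_. borel"] by simp
      show "L4 (\<lambda>\<omega>. k z (Z i \<omega>))" for i
        unfolding L4_def using P.L4_integrable(4)[OF P_L4_kernel[OF deg z]] integrable_Z[of "\<lambda>w. k z w ^ 4" i] by simp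
      show "expectation (\<lambda>\<omega>. k z (Z i \<omega>)) = 0" for i
        by (subst integral_Z) (auto simp: kernel_mean[OF deg z])
      show "expectation (\<lambda>\<omega>. k z (Z i \<omega>) ^ 2) = (\<integral>w. k z w ^ 2 \<partial>P)" for i
        by (subst integral_Z[of "\<lambda>w. k z w ^ 2"]) auto
      show "expectation (\<lambda>\<omega>. k z (Z i \<omega>) ^ 4) \<le> (\<integral>w. k z w ^ 4 \<partial>P)" for i
        by (subst integral_Z[of "\<lambda>w. k z w ^ 4"]) auto
    qed
    also have "expectation (\<lambda>\<omega>'. (\<Sum>i<l. k z (Z i \<omega>')) ^ 4) = (\<integral>\<omega>'. F (z, past l \<omega>') \<partial>M)"
      by (intro Bochner_Integration.integral_cong refl) (simp add: F_def past_def sw)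
    finally show ?thesis .
  qed
  note fub = indep_pair_fubini[OF indep_pair_swap[OF indep_past] F int]
  have i4: "integrable M (\<lambda>\<omega>. (\<integral>w. k (Z l \<omega>) w ^ 4 \<partial>P))"
    by (subst integrable_Z[of "\<lambda>z. (\<integral>w. k z w ^ 4 \<partial>P)"]) (auto simp: integrable_fourth_moment)
  have "expectation (\<lambda>\<omega>. incr k l \<omega> ^ 4) = (\<integral>\<omega>. (\<integral>\<omega>'. F (Z l \<omega>, past l \<omega>') \<partial>M) \<partial>M)"
    unfolding e by (rule fub(1))
  also have "\<dots> \<le> (\<integral>\<omega>. 3 * real l ^ 2 * (\<integral>w. k (Z l \<omega>) w ^ 4 \<partial>P) \<partial>M)"
    by (intro integral_mono fub(2) inner measurable_space[OF Z_measurable] integrable_mult_right i4)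
  also have "\<dots> = 3 * real l ^ 2 * kernel_moment k 4"
    using i4 by (simp add: kernel_moment_def) (subst integral_Z[of "\<lambda>z. (\<integral>w. k z w ^ 4 \<partial>P)"], auto)
  finally show ?thesis .
qed


section \<open>Comparison of characteristic functions, one increment at a time\<close>

lemma integrable_scaleR_iexp:
  assumes "integrable M f" "g \<in> borel_measurable M"
  shows "integrable M (\<lambda>\<omega>. f \<omega> *\<^sub>R iexp (g \<omega>))"
  by (rule Bochner_Integration.integrable_bound[OF assms(1)]) (use assms in auto)

text \<open>The phase \<open>e\<close> of the earlier increments is a function of the past. Under it
  the linear Taylor term of the new increment has mean zero, and the square may be replaced by
  \<open>cond_var\<close>. The three summands of the bound are the Taylor remainder, the deviation
  of \<open>cond_var\<close> from its mean, and the error of \<open>1 - t\<^sup>2 * v / 2\<close>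
  against the exponential.\<close>

lemma char_step:
  fixes s t :: real and l :: nat
  assumes s: "s > 0"
  defines "S \<equiv> (\<lambda>m \<omega>. (\<Sum>j<m. incr k j \<omega>) / s)"
    and "v \<equiv> real l * kernel_moment k 2 / s^2"
  shows "cmod (expectation (\<lambda>\<omega>. iexp (t * S (Suc l) \<omega>)) - exp (- (t^2 * v / 2)) * expectation (\<lambda>\<omega>. iexp (t * S l \<omega>)))
    \<le> \<bar>t\<bar>^3 / 6 * (expectation (\<lambda>\<omega>. \<bar>incr k l \<omega>\<bar>^3) / s^3)
      + t^2 / 2 * (expectation (\<lambda>\<omega>. \<bar>cond_var k l \<omega> - real l * kernel_moment k 2\<bar>) / s^2)
      + (t^2 * v)^2 / 8"
proof -
  define D where "D = incr k l"
  define x where "x \<omega> = t * D \<omega> / s" for \<omega>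
  define e where "e \<omega> = iexp (t * S l \<omega>)" for \<omega>
  define r where "r = exp (- (t^2 * v / 2))"
  note i4 = L4_integrable[OF L4_incr[OF deg, of l], folded D_def]
  have Dm[measurable]: "D \<in> borel_measurable M" unfolding D_def by (rule L4_measurable[OF L4_incr[OF deg]])
  have [measurable]: "incr k j \<in> borel_measurable M" for j by (rule L4_measurable[OF L4_incr[OF deg]])
  have Sm[measurable]: "S m \<in> borel_measurable M" for m unfolding S_def by measurable
  note kernel_comp_measurable[OF deg, measurable (raw)]
  define f where "f p = iexp (t * ((\<Sum>j<l. \<Sum>i<j. k (p i) (p j)) / s))" for p
  have fm[measurable]: "f \<in> borel_measurable (PiM {..<l} (\<lambda>_. E))" unfolding f_def by measurable
  have ef: "e \<omega> = f (past l \<omega>)" for \<omega>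
    unfolding e_def f_def S_def incr_def past_def
    by (intro arg_cong[of _ _ iexp] arg_cong2[of _ _ _ _ "(*)"] arg_cong2[of _ _ _ _ "(/)"] sum.cong refl) simp
  have ne: "cmod (e \<omega>) = 1" for \<omega> by (simp add: e_def)
  have iD: "integrable M (\<lambda>\<omega>. D \<omega> *\<^sub>R e \<omega>)" unfolding e_def by (intro integrable_scaleR_iexp i4) auto
  have iD2: "integrable M (\<lambda>\<omega>. (D \<omega>)^2 *\<^sub>R e \<omega>)" unfolding e_def by (intro integrable_scaleR_iexp i4) auto
  have icv: "integrable M (\<lambda>\<omega>. cond_var k l \<omega> *\<^sub>R e \<omega>)"
    unfolding e_def by (intro integrable_scaleR_iexp L2_integrable(1)[OF L2_cond_var]) auto
  have ie: "integrable M e" unfolding e_def[abs_def] by (intro integrable_iexp) auto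
  have E1: "expectation (\<lambda>\<omega>. D \<omega> *\<^sub>R e \<omega>) = 0"
    using expectation_incr_past[OF deg fm] iD unfolding ef D_def by simp
  have E2: "expectation (\<lambda>\<omega>. (D \<omega>)^2 *\<^sub>R e \<omega>) = expectation (\<lambda>\<omega>. cond_var k l \<omega> *\<^sub>R e \<omega>)"
    using expectation_incr_square_past[OF deg fm] iD2 unfolding ef D_def by simp
  define R where "R \<omega> = iexp (x \<omega>) - (1 + \<i> * x \<omega> - (x \<omega>)^2 / 2)" for \<omega>
  have R_bound: "cmod (R \<omega>) \<le> \<bar>x \<omega>\<bar>^3 / 6" for \<omega>
  proof -
    have "(\<Sum>j \<le> 2. (\<i> * x \<omega>)^j / fact j) = 1 + \<i> * x \<omega> - (x \<omega>)^2 / 2"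
      by (simp add: numeral_2_eq_2 power_mult_distrib)
    then show ?thesis using iexp_approx1[of "x \<omega>" 2] unfolding R_def by (simp add: fact_numeral)
  qed
  have xm[measurable]: "x \<in> borel_measurable M" unfolding x_def[abs_def] by measurable
  have em[measurable]: "e \<in> borel_measurable M" using ie by simp
  have Rm[measurable]: "R \<in> borel_measurable M" unfolding R_def[abs_def] by measurable
  have i3: "integrable M (\<lambda>\<omega>. \<bar>D \<omega>\<bar>^3)"
    using integrable_abs[OF i4(3)] by (simp add: power_abs)
  have x3: "\<bar>x \<omega>\<bar>^3 / 6 = \<bar>t\<bar>^3 / 6 / s^3 * \<bar>D \<omega>\<bar>^3" for \<omega>
    using s by (simp add: x_def abs_mult power_mult_distrib power_divide)
  have iR: "integrable M (\<lambda>\<omega>. R \<omega> * e \<omega>)"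
  proof (rule Bochner_Integration.integrable_bound)
    show "integrable M (\<lambda>\<omega>. \<bar>t\<bar>^3 / 6 / s^3 * \<bar>D \<omega>\<bar>^3)" using i3 by simp
    show "AE \<omega> in M. norm (R \<omega> * e \<omega>) \<le> norm (\<bar>t\<bar>^3 / 6 / s^3 * \<bar>D \<omega>\<bar>^3)"
      using R_bound s unfolding x3[symmetric] by (simp add: norm_mult ne)
  qed auto
  have pointwise: "iexp (t * S (Suc l) \<omega>) = R \<omega> * e \<omega> + (1 - t^2 * v / 2) * e \<omega> + \<i> * (t / s) * (D \<omega> *\<^sub>R e \<omega>)
     - (t^2 / (2 * s^2)) * ((D \<omega>)^2 *\<^sub>R e \<omega> - (real l * kernel_moment k 2) * e \<omega>)" for \<omega>
  proof -
    have "t * S (Suc l) \<omega> = t * S l \<omega> + x \<omega>"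
      by (simp add: S_def x_def D_def add_divide_distrib distrib_left)
    then have "iexp (t * S (Suc l) \<omega>) = e \<omega> * iexp (x \<omega>)"
      by (simp add: e_def distrib_left exp_add)
    also have "\<dots> = R \<omega> * e \<omega> + (1 + \<i> * x \<omega> - (x \<omega>)^2 / 2) * e \<omega>"
      by (simp add: R_def algebra_simps)
    also have "\<dots> = R \<omega> * e \<omega> + (1 - t^2 * v / 2) * e \<omega> + \<i> * (t / s) * (D \<omega> *\<^sub>R e \<omega>)
     - (t^2 / (2 * s^2)) * ((D \<omega>)^2 *\<^sub>R e \<omega> - (real l * kernel_moment k 2) * e \<omega>)"
      using s by (simp add: x_def v_def scaleR_conv_of_real power_divide power_mult_distrib field_simps)
    finally show ?thesis .
  qed
  have linear: "expectation (\<lambda>\<omega>. F \<omega> + c1 * e \<omega> + c2 * F' \<omega> - c3 * (F'' \<omega> - c4 * e \<omega>)) =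
      expectation F + c1 * expectation e + c2 * expectation F' - c3 * (expectation F'' - c4 * expectation e)"
    if "integrable M F" "integrable M F'" "integrable M F''" for F F' F'' :: "'w \<Rightarrow> complex" and c1 c2 c3 c4
    using that ie by simp
  have "expectation (\<lambda>\<omega>. iexp (t * S (Suc l) \<omega>)) = expectation (\<lambda>\<omega>. R \<omega> * e \<omega>) + (1 - t^2 * v / 2) * expectation e
     + \<i> * (t / s) * 0 - (t^2 / (2 * s^2)) * (expectation (\<lambda>\<omega>. cond_var k l \<omega> *\<^sub>R e \<omega>) - (real l * kernel_moment k 2) * expectation e)"
    unfolding pointwise E1[symmetric] E2[symmetric] by (rule linear[OF iR iD iD2])
  then have decomp: "expectation (\<lambda>\<omega>. iexp (t * S (Suc l) \<omega>)) - r * expectation e =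
     expectation (\<lambda>\<omega>. R \<omega> * e \<omega>) - (t^2 / (2 * s^2)) * (expectation (\<lambda>\<omega>. cond_var k l \<omega> *\<^sub>R e \<omega>) - (real l * kernel_moment k 2) * expectation e)
     + (1 - t^2 * v / 2 - r) * expectation e"
    by (simp add: algebra_simps)
  have b1: "cmod (expectation (\<lambda>\<omega>. R \<omega> * e \<omega>)) \<le> \<bar>t\<bar>^3 / 6 * (expectation (\<lambda>\<omega>. \<bar>D \<omega>\<bar>^3) / s^3)"
  proof -
    have "cmod (expectation (\<lambda>\<omega>. R \<omega> * e \<omega>)) \<le> expectation (\<lambda>\<omega>. cmod (R \<omega> * e \<omega>))"
      by (rule integral_norm_bound)
    also have "\<dots> \<le> expectation (\<lambda>\<omega>. \<bar>t\<bar>^3 / 6 / s^3 * \<bar>D \<omega>\<bar>^3)"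
    proof (intro integral_mono integrable_norm iR)
      show "integrable M (\<lambda>\<omega>. \<bar>t\<bar>^3 / 6 / s^3 * \<bar>D \<omega>\<bar>^3)" using i3 by simp
      show "cmod (R \<omega> * e \<omega>) \<le> \<bar>t\<bar>^3 / 6 / s^3 * \<bar>D \<omega>\<bar>^3" for \<omega>
        using R_bound[of \<omega>] unfolding x3 by (simp add: norm_mult ne)
    qed
    finally show ?thesis by simp
  qed
  have b2: "cmod (expectation (\<lambda>\<omega>. cond_var k l \<omega> *\<^sub>R e \<omega>) - (real l * kernel_moment k 2) * expectation e)
     \<le> expectation (\<lambda>\<omega>. \<bar>cond_var k l \<omega> - real l * kernel_moment k 2\<bar>)"
  proof -
    have "expectation (\<lambda>\<omega>. cond_var k l \<omega> *\<^sub>R e \<omega>) - (real l * kernel_moment k 2) * expectation e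
      = expectation (\<lambda>\<omega>. (cond_var k l \<omega> - real l * kernel_moment k 2) *\<^sub>R e \<omega>)"
      using icv ie by (simp add: scaleR_left_diff_distrib) (simp add: scaleR_conv_of_real)
    also have "cmod \<dots> \<le> expectation (\<lambda>\<omega>. cmod ((cond_var k l \<omega> - real l * kernel_moment k 2) *\<^sub>R e \<omega>))"
      by (rule integral_norm_bound)
    finally show ?thesis by (simp add: ne)
  qed
  have b3: "cmod ((1 - t^2 * v / 2 - r) * expectation e) \<le> (t^2 * v)^2 / 8"
  proof -
    define y where "y = t^2 * v / 2"
    have \<kappa>0: "0 \<le> kernel_moment k 2"
      unfolding kernel_moment_def by (intro Bochner_Integration.integral_nonneg) auto
    then have y0: "0 \<le> y" using s by (simp add: y_def v_def)
    have lo: "1 - y \<le> exp (- y)" using exp_ge_add_one_self[of "- y"] by simp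
    have "exp (- y) \<le> 1 - y + y^2 / 2"
    proof -
      \<comment> \<open>The product of the two quadratic polynomials is at least 1, so the lower
        Taylor bound for \<open>exp y\<close> turns into an upper bound for
        \<open>exp (- y)\<close>.\<close>
      have "(1 - y + y^2/2) * (1 + y + y^2/2) = 1 + (y^2)^2 / 4"
        by (simp add: algebra_simps power2_eq_square)
      then have "1 \<le> (1 - y + y^2/2) * (1 + y + y^2/2)"
        by simp
      also have "\<dots> \<le> (1 - y + y^2/2) * exp y"
      proof (rule mult_left_mono[OF exp_lower_Taylor_quadratic[OF y0]])
        have "0 \<le> (1 - y)^2" by simp
        then show "0 \<le> 1 - y + y^2/2" by (simp add: power2_eq_square algebra_simps)
      qed
      finally show ?thesis by (simp add: exp_minus field_simps)
    qed
    with lo have "\<bar>1 - t^2 * v / 2 - r\<bar> \<le> y^2 / 2" unfolding r_def y_def[symmetric] by simp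
    moreover have "cmod (expectation e) \<le> 1"
      using integral_norm_bound[of M e] by (simp add: ne prob_space)
    ultimately have "\<bar>1 - t^2 * v / 2 - r\<bar> * cmod (expectation e) \<le> y^2 / 2 * 1"
      by (intro mult_mono) auto
    moreover have "cmod ((1 - t^2 * v / 2 - r) * expectation e) = \<bar>1 - t^2 * v / 2 - r\<bar> * cmod (expectation e)"
      unfolding norm_mult by (metis norm_of_real of_real_diff of_real_1 of_real_divide of_real_mult of_real_numeral of_real_power)
    ultimately show ?thesis by (simp add: y_def power_divide)
  qed
  have "cmod (expectation (\<lambda>\<omega>. iexp (t * S (Suc l) \<omega>)) - r * expectation e) \<le>
    cmod (expectation (\<lambda>\<omega>. R \<omega> * e \<omega>))
     + cmod ((t^2 / (2 * s^2)) * (expectation (\<lambda>\<omega>. cond_var k l \<omega> *\<^sub>R e \<omega>) - (real l * kernel_moment k 2) * expectation e))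
     + cmod ((1 - t^2 * v / 2 - r) * expectation e)"
    unfolding decomp by (intro order_trans[OF norm_triangle_ineq] add_right_mono norm_triangle_ineq4)
  also have "cmod ((t^2 / (2 * s^2)) * (expectation (\<lambda>\<omega>. cond_var k l \<omega> *\<^sub>R e \<omega>) - (real l * kernel_moment k 2) * expectation e))
    \<le> t^2 / (2 * s^2) * expectation (\<lambda>\<omega>. \<bar>cond_var k l \<omega> - real l * kernel_moment k 2\<bar>)"
    using mult_left_mono[OF b2, of "t^2 / (2 * s^2)"]
    by (simp add: norm_mult norm_divide norm_power)
  finally show ?thesis using b1 b3 unfolding D_def r_def e_def[abs_def] by simp
qed


text \<open>The cube is placed between the second and the fourth power by
  \<open>y\<^sup>2 * (\<alpha> * s - y)\<^sup>2 \<ge> 0\<close>. The weight \<alpha> is chosen in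
  \<open>char_ustat_bound\<close>.\<close>

lemma expectation_abs_cube_le:
  assumes "\<alpha> > 0" "s > 0"
  shows "expectation (\<lambda>\<omega>. \<bar>incr k l \<omega>\<bar>^3) / s^3 \<le>
    (\<alpha> * (real l * kernel_moment k 2 / s^2) + 3 * real l ^ 2 * kernel_moment k 4 / s^4 / \<alpha>) / 2"
proof -
  define D where "D = incr k l"
  note i4 = L4_integrable[OF L4_incr[OF deg, of l], folded D_def]
  have "expectation (\<lambda>\<omega>. \<bar>D \<omega>\<bar>^3) \<le> expectation (\<lambda>\<omega>. (\<alpha> * s / 2) * D \<omega> ^ 2 + (1 / (2 * \<alpha> * s)) * D \<omega> ^ 4)"
  proof (rule integral_mono)
    show "integrable M (\<lambda>\<omega>. \<bar>D \<omega>\<bar>^3)" using integrable_abs[OF i4(3)] by (simp add: power_abs)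
    show "integrable M (\<lambda>\<omega>. (\<alpha> * s / 2) * D \<omega> ^ 2 + (1 / (2 * \<alpha> * s)) * D \<omega> ^ 4)" using i4 by simp
    fix \<omega>
    define y where "y = \<bar>D \<omega>\<bar>"
    have "0 \<le> y^2 * (\<alpha> * s - y)^2 / (2 * \<alpha> * s)" using assms by simp
    also have "\<dots> = (\<alpha> * s / 2) * y ^ 2 + (1 / (2 * \<alpha> * s)) * y ^ 4 - y^3"
      using assms by (simp add: field_simps power2_eq_square power3_eq_cube power4_eq_xxxx)
    finally show "\<bar>D \<omega>\<bar>^3 \<le> (\<alpha> * s / 2) * D \<omega> ^ 2 + (1 / (2 * \<alpha> * s)) * D \<omega> ^ 4"
      by (simp add: y_def)
  qed
  also have "\<dots> = (\<alpha> * s / 2) * expectation (\<lambda>\<omega>. D \<omega> ^ 2) + (1 / (2 * \<alpha> * s)) * expectation (\<lambda>\<omega>. D \<omega> ^ 4)"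
    using i4 by simp
  also have "\<dots> \<le> (\<alpha> * s / 2) * (real l * kernel_moment k 2) + (1 / (2 * \<alpha> * s)) * (3 * real l ^ 2 * kernel_moment k 4)"
    unfolding D_def expectation_incr_square using assms
    by (intro add_left_mono mult_left_mono expectation_incr_power4) auto
  finally have "expectation (\<lambda>\<omega>. \<bar>D \<omega>\<bar>^3) / s^3 \<le>
     ((\<alpha> * s / 2) * (real l * kernel_moment k 2) + (1 / (2 * \<alpha> * s)) * (3 * real l ^ 2 * kernel_moment k 4)) / s^3"
    using assms by (intro divide_right_mono) auto
  also have "\<dots> = (\<alpha> * (real l * kernel_moment k 2 / s^2) + 3 * real l ^ 2 * kernel_moment k 4 / s^4 / \<alpha>) / 2"
    using assms by (simp add: field_simps power2_eq_square power3_eq_cube power4_eq_xxxx)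
  finally show ?thesis unfolding D_def .
qed

text \<open>\<open>s\<close> is the standard deviation of the sum, so the variance shares
  \<open>v l\<close> add up to 1. The damping factors are at most 1, hence one-step errors merely
  accumulate, and n times a single error is small as soon as 1/n, the normalised fourth moment
  \<rho> and the normalised second moment of the convolved kernel are.\<close>

theorem char_ustat_bound:
  fixes n :: nat and t :: real
  assumes n: "2 \<le> n" and \<kappa>: "kernel_moment k 2 > 0"
  defines "s \<equiv> sqrt (kernel_moment k 2 * real n * (real n - 1) / 2)"
    and "\<rho> \<equiv> kernel_moment k 4 / (real n * (kernel_moment k 2)^2)"
  shows "cmod (expectation (\<lambda>\<omega>. iexp (t * ((\<Sum>l<n. incr k l \<omega>) / s))) - exp (- (t^2 / 2)))
    \<le> 13 / 3 * \<bar>t\<bar>^3 * sqrt \<rho> + 2 * t^2 * sqrt (8 * kernel_moment (self_conv k) 2 / (kernel_moment k 2)^2 + 2 * \<rho>) + 2 * t^4 / real n"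
proof -
  define \<kappa> q \<theta> where "\<kappa> = kernel_moment k 2" and "q = kernel_moment k 4" and "\<theta> = kernel_moment (self_conv k) 2"
  have \<kappa>0: "\<kappa> > 0" and q0: "q > 0" and \<theta>0: "\<theta> \<ge> 0" and n0: "real n > 0"
    using \<kappa> n less_le_trans[OF zero_less_power[OF \<kappa>, of 2] kernel_moment_square_le] unfolding \<kappa>_def q_def \<theta>_def
    by (auto simp: kernel_moment_def[of "self_conv k"] intro!: Bochner_Integration.integral_nonneg)
  have \<rho>0: "\<rho> > 0" using q0 \<kappa>0 n0 by (simp add: \<rho>_def q_def \<kappa>_def)
  have s2: "s^2 = \<kappa> * real n * (real n - 1) / 2" unfolding s_def \<kappa>_def using \<kappa> n by simp
  have s2_pos: "s^2 > 0" unfolding s2 using \<kappa>0 n by simp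
  have s0: "s > 0" unfolding s_def using \<kappa> n by simp
  have s2_lower: "\<kappa> * (real n)^2 / 4 \<le> s^2"
  proof -
    have nn: "real n * (real n / 2) \<le> real n * (real n - 1)" using n by (intro mult_left_mono) auto
    have eq1: "\<kappa> * (real n)^2 / 4 = \<kappa> * (real n * (real n / 2)) / 2"
      by (simp add: power2_eq_square)
    have eq2: "s^2 = \<kappa> * (real n * (real n - 1)) / 2" unfolding s2 by simp
    show ?thesis unfolding eq1 eq2 using \<kappa>0 by (intro divide_right_mono mult_left_mono[OF nn]) auto
  qed
  define v where "v l = real l * \<kappa> / s^2" for l
  define bnd where "bnd l = \<bar>t\<bar>^3 / 6 * (expectation (\<lambda>\<omega>. \<bar>incr k l \<omega>\<bar>^3) / s^3)
      + t^2 / 2 * (expectation (\<lambda>\<omega>. \<bar>cond_var k l \<omega> - real l * \<kappa>\<bar>) / s^2) + (t^2 * v l)^2 / 8" for l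
  define ch where "ch m = expectation (\<lambda>\<omega>. iexp (t * ((\<Sum>l<m. incr k l \<omega>) / s)))" for m
  have tele: "cmod (ch m - exp (- (t^2 / 2 * (\<Sum>l<m. v l)))) \<le> (\<Sum>l<m. bnd l)" for m
  proof (induction m)
    case (Suc m)
    define r where "r = exp (- (t^2 * v m / 2))"
    have r: "0 \<le> r" "r \<le> 1" using \<kappa>0 by (auto simp: r_def v_def)
    have e: "exp (- (t^2 / 2 * (\<Sum>l<Suc m. v l))) = r * exp (- (t^2 / 2 * (\<Sum>l<m. v l)))"
      by (simp add: r_def exp_add[symmetric] algebra_simps)
    have step: "cmod (ch (Suc m) - r * ch m) \<le> bnd m"
      using char_step[OF s0, of t m] unfolding ch_def r_def bnd_def v_def \<kappa>_def by simp
    have "ch (Suc m) - exp (- (t^2 / 2 * (\<Sum>l<Suc m. v l))) =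
      (ch (Suc m) - r * ch m) + r * (ch m - exp (- (t^2 / 2 * (\<Sum>l<m. v l))))"
      unfolding e by (simp add: algebra_simps)
    also have "cmod \<dots> \<le> bnd m + (\<Sum>l<m. bnd l)"
    proof (rule norm_triangle_mono[OF step])
      have "r * cmod (ch m - exp (- (t^2 / 2 * (\<Sum>l<m. v l)))) \<le> 1 * (\<Sum>l<m. bnd l)"
        using r Suc by (intro mult_mono) auto
      then show "cmod (r * (ch m - exp (- (t^2 / 2 * (\<Sum>l<m. v l))))) \<le> (\<Sum>l<m. bnd l)"
        using r by (simp add: norm_mult)
    qed
    finally show ?case by simp
  qed (simp add: ch_def prob_space)
  have "(\<Sum>l<n. v l) = (\<Sum>l<n. real l) * \<kappa> / s^2"
    unfolding v_def by (simp add: sum_distrib_right sum_divide_distrib)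
  also have "(\<Sum>l<n. real l) = real n * (real n - 1) / 2"
    by (induction n) (auto simp: field_simps)
  finally have v_sum: "(\<Sum>l<n. v l) = 1" using s2 s2_pos n \<kappa>0 by (simp add: field_simps)
  \<comment> \<open>The 26 is (4 + 48) / 2: \<open>v l \<le> 4 / n\<close>, the fourth moment
    contributes 3 * 16 = 48, and the weight \<open>sqrt \<rho>\<close> in
    \<open>expectation_abs_cube_le\<close> brings both parts to the order
    \<open>sqrt \<rho> / n\<close>.\<close>
  define B where "B = \<bar>t\<bar>^3 / 6 * (26 * sqrt \<rho> / n) + t^2 / 2 * (4 / n * sqrt (8 * \<theta> / \<kappa>^2 + 2 * \<rho>)) + (t^2 * (4 / n))^2 / 8"
  have bnd_le: "bnd l \<le> B" if l: "l < n" for l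
  proof -
    have inv: "1 / s^2 \<le> 4 / (\<kappa> * (real n)^2)"
      using s2_lower s2_pos \<kappa>0 n0 by (simp add: field_simps)
    have v_le: "v l \<le> 4 / n" and v0: "0 \<le> v l"
    proof -
      have "v l = real l * \<kappa> * (1 / s^2)" by (simp add: v_def)
      also have "\<dots> \<le> real n * \<kappa> * (4 / (\<kappa> * (real n)^2))"
        using l \<kappa>0 s2_pos by (intro mult_mono inv) auto
      also have "\<dots> = 4 / n" using \<kappa>0 n0 by (simp add: power2_eq_square)
      finally show "v l \<le> 4 / n" .
      show "0 \<le> v l" using \<kappa>0 by (simp add: v_def)
    qed
    have "3 * real l ^ 2 * q / s^4 = 3 * real l ^ 2 * q * (1 / s^2)^2"
      by (simp add: power_divide)
    also have "\<dots> \<le> 3 * real n ^ 2 * q * (4 / (\<kappa> * (real n)^2))^2"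
      using l q0 s2_pos by (intro mult_mono power_mono inv) auto
    also have "\<dots> = 48 * \<rho> / n"
      using \<kappa>0 n0 unfolding \<rho>_def \<kappa>_def[symmetric] q_def[symmetric] by (simp add: field_simps power2_eq_square)
    finally have m4: "3 * real l ^ 2 * q / s^4 \<le> 48 * \<rho> / n" .
    have "expectation (\<lambda>\<omega>. \<bar>incr k l \<omega>\<bar>^3) / s^3 \<le> (sqrt \<rho> * v l + 3 * real l ^ 2 * q / s^4 / sqrt \<rho>) / 2"
      using expectation_abs_cube_le[of "sqrt \<rho>" s l] \<rho>0 s0 unfolding v_def \<kappa>_def q_def by simp
    also have "\<dots> \<le> (sqrt \<rho> * (4 / n) + (48 * \<rho> / n) / sqrt \<rho>) / 2"
      using v_le m4 \<rho>0 by (intro divide_right_mono add_mono mult_left_mono) auto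
    also have "(48 * \<rho> / n) / sqrt \<rho> = 48 * sqrt \<rho> / n"
      using \<rho>0 n0 by (simp add: real_div_sqrt field_simps)
    finally have c1: "expectation (\<lambda>\<omega>. \<bar>incr k l \<omega>\<bar>^3) / s^3 \<le> 26 * sqrt \<rho> / n" by simp
    have "expectation (\<lambda>\<omega>. \<bar>cond_var k l \<omega> - real l * \<kappa>\<bar>) / s^2 \<le> sqrt (8 * real l ^ 2 * \<theta> + 2 * real l * q) * (1 / s^2)"
      using expectation_abs_cond_var[of l] s2_pos unfolding \<kappa>_def \<theta>_def q_def by (simp add: divide_right_mono)
    also have "\<dots> \<le> sqrt (8 * real n ^ 2 * \<theta> + 2 * real n * q) * (4 / (\<kappa> * (real n)^2))"
      using l \<theta>0 q0 s2_pos by (intro mult_mono inv real_sqrt_le_mono add_mono mult_right_mono power_mono) auto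
    also have "8 * real n ^ 2 * \<theta> + 2 * real n * q = (\<kappa> * real n)^2 * (8 * \<theta> / \<kappa>^2 + 2 * \<rho>)"
      using \<kappa>0 n0 unfolding \<rho>_def \<kappa>_def[symmetric] q_def[symmetric] by (simp add: field_simps power2_eq_square)
    also have "sqrt ((\<kappa> * real n)^2 * (8 * \<theta> / \<kappa>^2 + 2 * \<rho>)) = \<kappa> * real n * sqrt (8 * \<theta> / \<kappa>^2 + 2 * \<rho>)"
      using \<kappa>0 n0 by (simp add: real_sqrt_mult)
    also have "\<kappa> * real n * sqrt (8 * \<theta> / \<kappa>^2 + 2 * \<rho>) * (4 / (\<kappa> * (real n)^2)) = 4 / n * sqrt (8 * \<theta> / \<kappa>^2 + 2 * \<rho>)"
      using \<kappa>0 n0 by (simp add: power2_eq_square)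
    finally have c2: "expectation (\<lambda>\<omega>. \<bar>cond_var k l \<omega> - real l * \<kappa>\<bar>) / s^2 \<le> 4 / n * sqrt (8 * \<theta> / \<kappa>^2 + 2 * \<rho>)" .
    have c3: "(t^2 * v l)^2 \<le> (t^2 * (4 / n))^2"
      using v_le v0 by (intro power_mono mult_left_mono) auto
    show ?thesis unfolding bnd_def B_def
      by (intro add_mono mult_left_mono c1 c2 divide_right_mono c3) auto
  qed
  have "cmod (ch n - exp (- (t^2 / 2))) \<le> (\<Sum>l<n. bnd l)"
    using tele[of n] v_sum by simp
  also have "\<dots> \<le> (\<Sum>l<n. B)" by (intro sum_mono bnd_le) auto
  also have "\<dots> = 13 / 3 * \<bar>t\<bar>^3 * sqrt \<rho> + 2 * t^2 * sqrt (8 * \<theta> / \<kappa>^2 + 2 * \<rho>) + 2 * t^4 / real n"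
    using n0 by (simp add: B_def field_simps power2_eq_square power4_eq_xxxx)
  finally show ?thesis unfolding ch_def \<theta>_def \<kappa>_def by simp
qed

lemma ustat_moments:
  defines "U \<equiv> (\<lambda>n \<omega>. \<Sum>l<n. incr k l \<omega>)"
  shows "L4 (U n)" "expectation (U n) = 0"
    "expectation (\<lambda>\<omega>. U n \<omega> ^ 2) = kernel_moment k 2 * real n * (real n - 1) / 2"
proof -
  note kernel_comp_measurable[OF deg, measurable (raw)]
  show L4U: "L4 (U n)" for n unfolding U_def by (intro L4_sum L4_incr[OF deg])
  show "expectation (U n) = 0"
    unfolding U_def using L4_integrable(1)[OF L4_incr[OF deg]] by (simp add: expectation_incr)
  show "expectation (\<lambda>\<omega>. U n \<omega> ^ 2) = kernel_moment k 2 * real n * (real n - 1) / 2"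
  proof (induction n)
    case (Suc n)
    define f where "f p = (\<Sum>j<n. \<Sum>i<j. k (p i) (p j))" for p
    have fm: "f \<in> borel_measurable (PiM {..<n} (\<lambda>_. E))" unfolding f_def by measurable
    have Uf: "U n \<omega> = f (past n \<omega>)" for \<omega>
      unfolding U_def f_def incr_def past_def by (intro sum.cong refl) simp
    have c: "expectation (\<lambda>\<omega>. incr k n \<omega> * U n \<omega>) = 0"
      using expectation_incr_past[OF deg fm] L4_mult_integrable[OF L4_incr[OF deg] L4U, of n n]
      unfolding Uf by simp
    have "expectation (\<lambda>\<omega>. U (Suc n) \<omega> ^ 2) = expectation (\<lambda>\<omega>. U n \<omega> ^ 2 + incr k n \<omega> ^ 2 + 2 * (incr k n \<omega> * U n \<omega>))"
      by (simp add: U_def power2_sum algebra_simps)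
    also have "\<dots> = expectation (\<lambda>\<omega>. U n \<omega> ^ 2) + expectation (\<lambda>\<omega>. incr k n \<omega> ^ 2)"
      using L4_integrable(2)[OF L4U, of n] L4_integrable(2)[OF L4_incr[OF deg], of n] c
        L4_mult_integrable[OF L4_incr[OF deg] L4U, of n n] by simp
    finally show ?case using Suc by (simp add: expectation_incr_square field_simps)
  qed (simp add: U_def)
qed

end

end

section \<open>Reproducing kernel Hilbert spaces\<close>

text \<open>Shared by the four forms that live on one function space: \<open>ip\<close>,
  \<open>V_form Q\<close>, \<open>pen_ip Q ip lam\<close> and the sample form
  \<open>data_form\<close>.\<close>

locale semi_inner_form =
  fixes H :: "('a \<Rightarrow> real) set" and B :: "('a \<Rightarrow> real) \<Rightarrow> ('a \<Rightarrow> real) \<Rightarrow> real"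
  assumes zero_mem: "(\<lambda>_. 0) \<in> H"
    and add_mem: "f \<in> H \<Longrightarrow> g \<in> H \<Longrightarrow> (\<lambda>x. f x + g x) \<in> H"
    and scale_mem: "f \<in> H \<Longrightarrow> (\<lambda>x. r * f x) \<in> H"
    and sym: "f \<in> H \<Longrightarrow> g \<in> H \<Longrightarrow> B f g = B g f"
    and add_left: "f \<in> H \<Longrightarrow> g \<in> H \<Longrightarrow> u \<in> H \<Longrightarrow> B (\<lambda>x. f x + g x) u = B f u + B g u"
    and scale_left: "f \<in> H \<Longrightarrow> g \<in> H \<Longrightarrow> B (\<lambda>x. r * f x) g = r * B f g"
    and nonneg: "f \<in> H \<Longrightarrow> 0 \<le> B f f"
begin

lemma add_right: "f \<in> H \<Longrightarrow> g \<in> H \<Longrightarrow> u \<in> H \<Longrightarrow> B u (\<lambda>x. f x + g x) = B u f + B u g"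
  using add_left[of f g u] sym[of u "\<lambda>x. f x + g x"] sym[of u f] sym[of u g] add_mem[of f g] by simp

lemma scale_right: "f \<in> H \<Longrightarrow> g \<in> H \<Longrightarrow> B g (\<lambda>x. r * f x) = r * B g f"
  using scale_left[of f g r] sym[of g "\<lambda>x. r * f x"] sym[of g f] scale_mem[of f r] by simp

lemma diff_mem: "f \<in> H \<Longrightarrow> g \<in> H \<Longrightarrow> (\<lambda>x. f x - g x) \<in> H"
  using add_mem[of f "\<lambda>x. (-1) * g x"] scale_mem[of g "-1"] by simp

lemma diff_left: "f \<in> H \<Longrightarrow> g \<in> H \<Longrightarrow> u \<in> H \<Longrightarrow> B (\<lambda>x. f x - g x) u = B f u - B g u"
  using add_left[of f "\<lambda>x. (-1) * g x" u] scale_mem[of g "-1"] scale_left[of g u "-1"] by simp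

lemma diff_right: "f \<in> H \<Longrightarrow> g \<in> H \<Longrightarrow> u \<in> H \<Longrightarrow> B u (\<lambda>x. f x - g x) = B u f - B u g"
  using diff_left[of f g u] sym[of u "\<lambda>x. f x - g x"] sym[of u f] sym[of u g] diff_mem[of f g] by simp

lemma zero_left: "g \<in> H \<Longrightarrow> B (\<lambda>_. 0) g = 0"
  using scale_left[OF zero_mem, of g 0] by simp

lemma sum_mem: "(\<And>i. i \<in> I \<Longrightarrow> f i \<in> H) \<Longrightarrow> (\<lambda>x. \<Sum>i\<in>I. r i * f i x) \<in> H"
  by (induction I rule: infinite_finite_induct) (auto simp: zero_mem intro!: add_mem scale_mem)

lemma sum_left: "(\<And>i. i \<in> I \<Longrightarrow> f i \<in> H) \<Longrightarrow> g \<in> H \<Longrightarrow> B (\<lambda>x. \<Sum>i\<in>I. r i * f i x) g = (\<Sum>i\<in>I. r i * B (f i) g)"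
proof (induction I rule: infinite_finite_induct)
  case (insert j I)
  then have "B (\<lambda>x. r j * f j x + (\<Sum>i\<in>I. r i * f i x)) g = r j * B (f j) g + (\<Sum>i\<in>I. r i * B (f i) g)"
    by (subst add_left) (auto intro!: scale_mem sum_mem simp: scale_left)
  with insert show ?case by simp
qed (auto simp: zero_left)

lemma sum_right: "(\<And>i. i \<in> I \<Longrightarrow> f i \<in> H) \<Longrightarrow> g \<in> H \<Longrightarrow> B g (\<lambda>x. \<Sum>i\<in>I. r i * f i x) = (\<Sum>i\<in>I. r i * B g (f i))"
  using sum_left[of I f g r] sym[of g "\<lambda>x. \<Sum>i\<in>I. r i * f i x"] sum_mem[of I f r] sym[of g]
  by simp

lemma square_add: "f \<in> H \<Longrightarrow> g \<in> H \<Longrightarrow> B (\<lambda>x. f x + g x) (\<lambda>x. f x + g x) = B f f + 2 * B f g + B g g"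
  by (simp add: add_left add_right add_mem sym[of g f])

lemma square_diff: "f \<in> H \<Longrightarrow> g \<in> H \<Longrightarrow> B (\<lambda>x. f x - g x) (\<lambda>x. f x - g x) = B f f - 2 * B f g + B g g"
  by (simp add: diff_left diff_right diff_mem sym[of g f])

lemma cauchy_schwarz_square:
  assumes "f \<in> H" "g \<in> H"
  shows "(B f g)^2 \<le> B f f * B g g"
proof -
  have q: "0 \<le> B f f - 2 * r * B f g + r^2 * B g g" for r
    using nonneg[OF diff_mem[OF assms(1) scale_mem[OF assms(2), of r]]] square_diff[OF assms(1) scale_mem[OF assms(2), of r]] assms
    by (simp add: scale_left scale_right scale_mem power2_eq_square)
  show ?thesis
  proof (cases "B g g = 0")
    case True
    have "B f g = 0"
    proof (rule ccontr)
      assume n: "B f g \<noteq> 0"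
      \<comment> \<open>With \<open>B g g = 0\<close> the quadratic in \<open>r\<close> is affine;
        at this \<open>r\<close> it takes the value -1.\<close>
      have "0 \<le> B f f - 2 * ((B f f + 1) / (2 * B f g)) * B f g" using q[of "(B f f + 1) / (2 * B f g)"] True by simp
      also have "\<dots> = - 1" using n by (simp add: field_simps)
      finally show False by simp
    qed
    then show ?thesis using True by simp
  next
    case False
    then have pos: "B g g > 0" using nonneg[OF assms(2)] by simp
    have "0 \<le> B f f - (B f g)^2 / B g g"
      using q[of "B f g / B g g"] pos by (simp add: power2_eq_square field_simps)
    then show ?thesis using pos by (simp add: field_simps)
  qed
qed

lemma cauchy_schwarz: "f \<in> H \<Longrightarrow> g \<in> H \<Longrightarrow> \<bar>B f g\<bar> \<le> sqrt (B f f) * sqrt (B g g)"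
  using real_sqrt_le_mono[OF cauchy_schwarz_square[of f g]] by (simp add: real_sqrt_mult)

lemma triangle:
  assumes "f \<in> H" "g \<in> H"
  shows "sqrt (B (\<lambda>x. f x + g x) (\<lambda>x. f x + g x)) \<le> sqrt (B f f) + sqrt (B g g)"
proof -
  have "B (\<lambda>x. f x + g x) (\<lambda>x. f x + g x) \<le> (sqrt (B f f) + sqrt (B g g))^2"
    using cauchy_schwarz[OF assms] nonneg assms by (simp add: square_add power2_sum)
  then show ?thesis using nonneg assms by (intro real_le_lsqrt) auto
qed

lemma diff_commute: "f \<in> H \<Longrightarrow> g \<in> H \<Longrightarrow> B (\<lambda>x. f x - g x) (\<lambda>x. f x - g x) = B (\<lambda>x. g x - f x) (\<lambda>x. g x - f x)"
  by (simp add: square_diff sym[of g f])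

end

section \<open>Kernels that are diagonal in a bounded orthonormal basis\<close>

locale bounded_orthonormal =
  fixes S :: "'a::euclidean_space set" and Q :: "'a measure" and \<phi> :: "nat \<Rightarrow> 'a \<Rightarrow> real" and c :: real
  assumes prob_Q: "prob_space Q" and sets_Q: "sets Q = sets (restrict_space borel S)"
    and S_borel: "S \<in> sets borel"
    and onb: "orthonormal_basis_L2 Q \<phi>" and fun_on: "\<And>i. 1 \<le> i \<Longrightarrow> \<phi> i \<in> functions_on S"
    and bound_S: "\<And>i x. 1 \<le> i \<Longrightarrow> x \<in> S \<Longrightarrow> \<bar>\<phi> i x\<bar> \<le> c"
begin

sublocale Q: prob_space Q by (rule prob_Q)

lemma space_Q: "space Q = S"
  using sets_eq_imp_space_eq[OF sets_Q] by (simp add: space_restrict_space)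

lemma S_nonempty: "S \<noteq> {}"
  using Q.not_empty space_Q by simp

lemma c_nonneg: "0 \<le> c"
  using S_nonempty bound_S[of 1] by force

lemma \<phi>_off: "x \<notin> S \<Longrightarrow> \<phi> (Suc i) x = 0"
  using fun_on[of "Suc i"] by (simp add: functions_on_def)

lemma \<phi>_bound: "\<bar>\<phi> (Suc i) x\<bar> \<le> c"
  using bound_S[of "Suc i" x] \<phi>_off[of x i] c_nonneg by (cases "x \<in> S") auto

lemma measurable_on_S:
  assumes "f \<in> borel_measurable Q" "f \<in> functions_on S" shows "f \<in> borel_measurable borel"
proof -
  have "f \<in> borel_measurable (restrict_space borel S)"
    using assms(1) sets_Q by (metis measurable_cong_sets)
  then have "(\<lambda>x. indicator S x *\<^sub>R f x) \<in> borel_measurable borel"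
    using S_borel by (subst (asm) borel_measurable_restrict_space_iff) auto
  moreover have "(\<lambda>x. indicator S x *\<^sub>R f x) = f"
    using assms(2) by (auto simp: fun_eq_iff functions_on_def indicator_def)
  ultimately show ?thesis by simp
qed

lemma borel_Q: "f \<in> borel_measurable borel \<Longrightarrow> f \<in> borel_measurable Q"
  using measurable_restrict_space1[of f borel borel S] sets_Q by (metis measurable_cong_sets)

lemma id_Q[measurable]: "(\<lambda>x. x) \<in> measurable Q borel"
  unfolding measurable_cong_sets[OF sets_Q refl] by (rule measurable_restrict_space1) simp

lemma \<phi>_measurable[measurable]: "\<phi> (Suc i) \<in> borel_measurable borel"
  using onb fun_on[of "Suc i"] by (intro measurable_on_S) (auto simp: orthonormal_basis_L2_def square_integrable_def)

lemma integrable_bounded: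
  fixes f :: "'a \<Rightarrow> real"
  assumes "f \<in> borel_measurable Q" "\<And>x. x \<in> S \<Longrightarrow> \<bar>f x\<bar> \<le> r"
  shows "integrable Q f"
  using assms by (intro Q.integrable_const_bound[where B=r]) (auto intro!: AE_I2 simp: space_Q)

lemma orthonormal: "(\<integral>x. \<phi> (Suc i) x * \<phi> (Suc j) x \<partial>Q) = (if i = j then 1 else 0)"
  using onb by (simp add: orthonormal_basis_L2_def V_form_def)

text \<open>Used with the eigenvalues (the kernel R), with the shrinkage factors (the kernel K), and
  with the powers of the latter that arise by convolution.\<close>

definition kern :: "(nat \<Rightarrow> real) \<Rightarrow> 'a \<Rightarrow> 'a \<Rightarrow> real" where
  "kern w = series_kernel w \<phi>"

context
  fixes w :: "nat \<Rightarrow> real"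
  assumes w0: "\<And>i. 0 \<le> w (Suc i)" and w_sum: "summable (\<lambda>i. w (Suc i))"
begin

lemma kern_term_bound: "\<bar>w (Suc i) * \<phi> (Suc i) x * \<phi> (Suc i) y\<bar> \<le> w (Suc i) * c^2"
proof -
  have "\<bar>\<phi> (Suc i) x\<bar> * \<bar>\<phi> (Suc i) y\<bar> \<le> c * c"
    by (intro mult_mono \<phi>_bound c_nonneg) auto
  then show ?thesis using mult_left_mono[OF _ w0, of "\<bar>\<phi> (Suc i) x\<bar> * \<bar>\<phi> (Suc i) y\<bar>" "c*c" i] w0[of i]
    by (simp add: abs_mult power2_eq_square mult.assoc)
qed

lemma kern_abs_summable: "summable (\<lambda>i. \<bar>w (Suc i) * \<phi> (Suc i) x * \<phi> (Suc i) y\<bar>)"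
  using kern_term_bound by (intro summable_comparison_test'[OF summable_mult2[OF w_sum, of "c^2"], of 0]) auto

lemma kern_sums: "(\<lambda>i. w (Suc i) * \<phi> (Suc i) x * \<phi> (Suc i) y) sums kern w x y"
  unfolding kern_def series_kernel_def by (rule summable_sums[OF summable_rabs_cancel[OF kern_abs_summable]])

lemma kern_bound: "\<bar>kern w x y\<bar> \<le> c^2 * (\<Sum>i. w (Suc i))"
proof -
  have "\<bar>kern w x y\<bar> \<le> (\<Sum>i. \<bar>w (Suc i) * \<phi> (Suc i) x * \<phi> (Suc i) y\<bar>)"
    unfolding kern_def series_kernel_def by (rule summable_rabs[OF kern_abs_summable])
  also have "\<dots> \<le> (\<Sum>i. w (Suc i) * c^2)"
    by (intro suminf_le kern_term_bound kern_abs_summable summable_mult2 w_sum)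
  also have "\<dots> = c^2 * (\<Sum>i. w (Suc i))"
    using suminf_mult2[OF w_sum, of "c^2"] by (simp add: mult.commute)
  finally show ?thesis .
qed

lemma kern_sym: "kern w x y = kern w y x"
  by (simp add: kern_def series_kernel_def mult_ac)

lemma kern_measurable[measurable (raw)]:
  assumes [measurable]: "f \<in> measurable N borel" "g \<in> measurable N borel"
  shows "(\<lambda>x. kern w (f x) (g x)) \<in> borel_measurable N"
  unfolding kern_def series_kernel_def by measurable

text \<open>Termwise integration, dominated by the summable
  \<open>r * c\<^sup>2 * w (Suc i)\<close>.\<close>

lemma integral_kern:
  assumes g: "g \<in> borel_measurable Q" and gb: "\<And>x. x \<in> S \<Longrightarrow> \<bar>g x\<bar> \<le> r"
  shows "(\<lambda>i. w (Suc i) * \<phi> (Suc i) x * (\<integral>z. g z * \<phi> (Suc i) z \<partial>Q)) sums (\<integral>z. g z * kern w x z \<partial>Q)"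
proof -
  define f where "f i z = g z * (w (Suc i) * \<phi> (Suc i) x * \<phi> (Suc i) z)" for i z
  have r0: "0 \<le> r" using S_nonempty gb by force
  have fb: "\<bar>f i z\<bar> \<le> r * c^2 * w (Suc i)" if "z \<in> S" for i z
  proof -
    have "\<bar>g z\<bar> * \<bar>w (Suc i) * \<phi> (Suc i) x * \<phi> (Suc i) z\<bar> \<le> r * (w (Suc i) * c^2)"
      by (intro mult_mono gb that kern_term_bound r0) auto
    then show ?thesis by (simp add: f_def abs_mult mult_ac)
  qed
  have fm: "f i \<in> borel_measurable Q" for i
    unfolding f_def using g borel_Q[OF \<phi>_measurable] by (intro borel_measurable_times) auto
  have fi: "integrable Q (f i)" for i by (rule integrable_bounded[OF fm fb])
  have s: "summable (\<lambda>i. r * c^2 * w (Suc i))" by (intro summable_mult w_sum)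
  have s1: "AE z in Q. summable (\<lambda>i. norm (f i z))"
    using fb by (intro AE_I2 summable_comparison_test'[OF s, of 0]) (auto simp: space_Q)
  have "(\<integral>z. norm (f i z) \<partial>Q) \<le> (\<integral>z. r * c^2 * w (Suc i) \<partial>Q)" for i
    using fi fb by (intro integral_mono) (auto simp: space_Q)
  then have s2: "summable (\<lambda>i. \<integral>z. norm (f i z) \<partial>Q)"
    by (intro summable_comparison_test'[OF s, of 0]) (auto simp: Q.prob_space)
  have "(\<lambda>i. \<integral>z. f i z \<partial>Q) sums (\<integral>z. (\<Sum>i. f i z) \<partial>Q)"
    by (rule sums_integral[OF fi s1 s2])
  moreover have "(\<Sum>i. f i z) = g z * kern w x z" for z
    unfolding f_def by (rule sums_unique[OF sums_mult[OF kern_sums], symmetric])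
  moreover have "(\<integral>z. f i z \<partial>Q) = w (Suc i) * \<phi> (Suc i) x * (\<integral>z. g z * \<phi> (Suc i) z \<partial>Q)" for i
  proof -
    have "f i z = (w (Suc i) * \<phi> (Suc i) x) * (g z * \<phi> (Suc i) z)" for z by (simp add: f_def)
    then show ?thesis by simp
  qed
  ultimately show ?thesis by simp
qed

text \<open>The source of 1/h: for the shrinkage weights this is the mean of K(X, X).\<close>

lemma kern_trace: "(\<integral>z. kern w z z \<partial>Q) = (\<Sum>i. w (Suc i))"
proof -
  define f where "f i z = w (Suc i) * \<phi> (Suc i) z * \<phi> (Suc i) z" for i z
  have fm: "f i \<in> borel_measurable Q" for i
    unfolding f_def using borel_Q[OF \<phi>_measurable] by (intro borel_measurable_times) auto
  have fb: "\<bar>f i z\<bar> \<le> w (Suc i) * c^2" for i z unfolding f_def by (rule kern_term_bound)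
  have fi: "integrable Q (f i)" for i by (rule integrable_bounded[OF fm fb])
  have s: "summable (\<lambda>i. w (Suc i) * c^2)" by (intro summable_mult2 w_sum)
  have s1: "AE z in Q. summable (\<lambda>i. norm (f i z))"
    using fb by (intro AE_I2 summable_comparison_test'[OF s, of 0]) auto
  have "(\<integral>z. norm (f i z) \<partial>Q) \<le> (\<integral>z. w (Suc i) * c^2 \<partial>Q)" for i
    using fi fb by (intro integral_mono) auto
  then have s2: "summable (\<lambda>i. \<integral>z. norm (f i z) \<partial>Q)"
    by (intro summable_comparison_test'[OF s, of 0]) (auto simp: Q.prob_space)
  have "(\<lambda>i. \<integral>z. f i z \<partial>Q) sums (\<integral>z. (\<Sum>i. f i z) \<partial>Q)"
    by (rule sums_integral[OF fi s1 s2])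
  moreover have "(\<integral>z. f i z \<partial>Q) = w (Suc i)" for i
    unfolding f_def mult.assoc by (simp add: orthonormal)
  ultimately show ?thesis
    unfolding f_def kern_def series_kernel_def by (simp add: sums_iff)
qed

end

text \<open>Both integral operators are diagonal in the same basis, so composing them multiplies the
  weights.\<close>

lemma kern_conv:
  assumes w: "\<And>i. 0 \<le> w (Suc i)" "summable (\<lambda>i. w (Suc i))"
    and v: "\<And>i. 0 \<le> v (Suc i)" "summable (\<lambda>i. v (Suc i))"
  shows "(\<integral>z. kern w x z * kern v y z \<partial>Q) = kern (\<lambda>i. w i * v i) x y"
proof -
  have e: "(\<integral>z. kern w x z * \<phi> (Suc i) z \<partial>Q) = w (Suc i) * \<phi> (Suc i) x" for i
  proof -
    have "(\<lambda>j. w (Suc j) * \<phi> (Suc j) x * (\<integral>z. \<phi> (Suc i) z * \<phi> (Suc j) z \<partial>Q)) sums (\<integral>z. \<phi> (Suc i) z * kern w x z \<partial>Q)"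
      by (rule integral_kern[OF w borel_Q[OF \<phi>_measurable]]) (rule \<phi>_bound)
    moreover have "(\<lambda>j. w (Suc j) * \<phi> (Suc j) x * (\<integral>z. \<phi> (Suc i) z * \<phi> (Suc j) z \<partial>Q)) sums (w (Suc i) * \<phi> (Suc i) x)"
      using sums_single[of i "\<lambda>j. w (Suc j) * \<phi> (Suc j) x"] by (rule sums_cong[THEN iffD1, rotated]) (auto simp: orthonormal)
    ultimately show ?thesis by (simp add: mult.commute sums_unique2)
  qed
  have m: "kern w x \<in> borel_measurable Q"
    using kern_measurable[OF w, of "\<lambda>_. x" Q "\<lambda>z. z"] by simp
  have "(\<lambda>i. v (Suc i) * \<phi> (Suc i) y * (\<integral>z. kern w x z * \<phi> (Suc i) z \<partial>Q)) sums (\<integral>z. kern w x z * kern v y z \<partial>Q)"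
    by (rule integral_kern[OF v m]) (rule kern_bound[OF w])
  then have "(\<integral>z. kern w x z * kern v y z \<partial>Q) = (\<Sum>i. v (Suc i) * \<phi> (Suc i) y * (w (Suc i) * \<phi> (Suc i) x))"
    unfolding e by (rule sums_unique)
  also have "\<dots> = kern (\<lambda>i. w i * v i) x y"
    by (simp add: kern_def series_kernel_def mult_ac)
  finally show ?thesis .
qed

end

text \<open>Strict positivity and summability of the eigenvalues are not part of
  \<open>spectral_rkhs\<close>; the final proof derives them from the asymptotic conditions on h and
  from the tail condition.\<close>

locale spectral = bounded_orthonormal S Q \<phi> c
  for S :: "'a::euclidean_space set" and Q \<phi> c +
  fixes H :: "('a \<Rightarrow> real) set" and ip :: "('a \<Rightarrow> real) \<Rightarrow> ('a \<Rightarrow> real) \<Rightarrow> real" and \<mu> :: "nat \<Rightarrow> real"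
  assumes rk: "spectral_rkhs S Q H ip \<mu> \<phi>"
    and \<mu>_pos: "\<And>i. 0 < \<mu> (Suc i)" and \<mu>_sum: "summable (\<lambda>i. \<mu> (Suc i))"
begin

lemma hilbert: "hilbert_function_space S H ip"
  using rk by (simp add: spectral_rkhs_def rkhs_def)

sublocale ip: semi_inner_form H ip
proof -
  have pos: "0 \<le> ip f f" if "f \<in> H" for f
  proof (cases "f = (\<lambda>_. 0)")
    case True
    have "ip (\<lambda>x. 0 * f x) f = 0 * ip f f"
      using that hilbert unfolding hilbert_function_space_def by blast
    then show ?thesis using True by simp
  next
    case False
    then show ?thesis using that hilbert unfolding hilbert_function_space_def by (simp add: less_imp_le)
  qed
  show "semi_inner_form H ip"
    by unfold_locales (use hilbert pos in \<open>auto simp: hilbert_function_space_def\<close>)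
qed

lemma ip_pos: "f \<in> H \<Longrightarrow> f \<noteq> (\<lambda>_. 0) \<Longrightarrow> 0 < ip f f"
  using hilbert by (auto simp: hilbert_function_space_def)

lemma H_off: "f \<in> H \<Longrightarrow> x \<notin> S \<Longrightarrow> f x = 0"
  using hilbert by (auto simp: hilbert_function_space_def functions_on_def)

lemma \<phi>_mem: "\<phi> (Suc i) \<in> H"
  using rk \<mu>_pos[of i] by (simp add: spectral_rkhs_def)

lemma ip_\<phi>: "ip (\<phi> (Suc i)) (\<phi> (Suc j)) = (if i = j then 1 / \<mu> (Suc i) else 0)"
  using rk \<mu>_pos[of i] \<mu>_pos[of j] by (simp add: spectral_rkhs_def)

lemma \<mu>_nonneg: "0 \<le> \<mu> (Suc i)"
  using \<mu>_pos[of i] by simp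

lemma R_mem: "x \<in> S \<Longrightarrow> kern \<mu> x \<in> H"
  and reproducing: "x \<in> S \<Longrightarrow> f \<in> H \<Longrightarrow> ip f (kern \<mu> x) = f x"
  using rk by (auto simp: spectral_rkhs_def rkhs_def kern_def)

text \<open>A bound on the norm of point evaluation in H. It makes convergence in H uniform and
  \<open>V_form Q\<close> continuous.\<close>

definition eval_norm :: real where
  "eval_norm = c * sqrt (\<Sum>i. \<mu> (Suc i))"

lemma eval_norm_nonneg: "0 \<le> eval_norm"
  unfolding eval_norm_def using c_nonneg by (intro mult_nonneg_nonneg) (auto intro!: suminf_nonneg \<mu>_sum \<mu>_nonneg)

lemma eval_bound:
  assumes f: "f \<in> H" shows "\<bar>f x\<bar> \<le> sqrt (ip f f) * eval_norm"
proof (cases "x \<in> S")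
  case True
  have "ip (kern \<mu> x) (kern \<mu> x) = kern \<mu> x x" by (rule reproducing[OF True R_mem[OF True]])
  also have "\<dots> \<le> c^2 * (\<Sum>i. \<mu> (Suc i))" using kern_bound[OF \<mu>_nonneg \<mu>_sum, of x x] by simp
  finally have "sqrt (ip (kern \<mu> x) (kern \<mu> x)) \<le> eval_norm"
    unfolding eval_norm_def using real_sqrt_le_mono c_nonneg by (fastforce simp: real_sqrt_mult)
  moreover have "\<bar>ip f (kern \<mu> x)\<bar> \<le> sqrt (ip f f) * sqrt (ip (kern \<mu> x) (kern \<mu> x))"
    by (rule ip.cauchy_schwarz[OF f R_mem[OF True]])
  ultimately have "\<bar>ip f (kern \<mu> x)\<bar> \<le> sqrt (ip f f) * eval_norm"
    using ip.nonneg[OF f] by (elim order_trans) (intro mult_left_mono, auto)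
  then show ?thesis by (simp add: reproducing[OF True f])
next
  case False
  then show ?thesis using H_off[OF f] ip.nonneg[OF f] eval_norm_nonneg by simp
qed

lemma H_measurable: "f \<in> H \<Longrightarrow> f \<in> borel_measurable borel"
  using rk hilbert by (intro measurable_on_S) (auto simp: spectral_rkhs_def square_integrable_def hilbert_function_space_def)

lemma integrable_H_mult:
  assumes "f \<in> H" "g \<in> H" shows "integrable Q (\<lambda>x. f x * g x)"
proof (rule integrable_bounded)
  show "(\<lambda>x. f x * g x) \<in> borel_measurable Q"
    using assms by (intro borel_measurable_times borel_Q H_measurable)
  show "\<bar>f x * g x\<bar> \<le> (sqrt (ip f f) * eval_norm) * (sqrt (ip g g) * eval_norm)" for x
    unfolding abs_mult using assms ip.nonneg eval_norm_nonneg
    by (intro mult_mono eval_bound) (auto intro!: mult_nonneg_nonneg)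
qed

lemma V_bound:
  assumes "f \<in> H" "g \<in> H"
  shows "\<bar>V_form Q f g\<bar> \<le> (sqrt (ip f f) * eval_norm) * (sqrt (ip g g) * eval_norm)"
proof -
  have "\<bar>V_form Q f g\<bar> \<le> (\<integral>x. \<bar>f x * g x\<bar> \<partial>Q)"
    unfolding V_form_def by (rule integral_abs_bound)
  also have "\<dots> \<le> (\<integral>x. (sqrt (ip f f) * eval_norm) * (sqrt (ip g g) * eval_norm) \<partial>Q)"
  proof (rule integral_mono)
    show "\<bar>f x * g x\<bar> \<le> (sqrt (ip f f) * eval_norm) * (sqrt (ip g g) * eval_norm)" for x
      unfolding abs_mult using assms ip.nonneg eval_norm_nonneg
      by (intro mult_mono eval_bound) (auto intro!: mult_nonneg_nonneg)
  qed (use integrable_H_mult[OF assms] in auto)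
  finally show ?thesis by (simp add: Q.prob_space)
qed

sublocale V: semi_inner_form H "V_form Q"
proof
  show "V_form Q f g = V_form Q g f" for f g by (simp add: V_form_def mult.commute)
  show "V_form Q (\<lambda>x. f x + g x) u = V_form Q f u + V_form Q g u" if "f \<in> H" "g \<in> H" "u \<in> H" for f g u
    using that integrable_H_mult by (simp add: V_form_def distrib_right)
  show "V_form Q (\<lambda>x. r * f x) g = r * V_form Q f g" for r f g
    by (simp add: V_form_def mult.assoc)
  show "0 \<le> V_form Q f f" for f by (simp add: V_form_def)
qed (use ip.zero_mem ip.add_mem ip.scale_mem in auto)

lemma V_\<phi>: "V_form Q (\<phi> (Suc i)) (\<phi> (Suc j)) = (if i = j then 1 else 0)"
  by (simp add: V_form_def orthonormal)

text \<open>The factor \<open>\<mu> (Suc i)\<close> is built into the coefficients so that the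
  squared norm in H is the sum of \<open>(d i)\<^sup>2 * \<mu> (Suc i)\<close>.\<close>

definition psum :: "(nat \<Rightarrow> real) \<Rightarrow> nat \<Rightarrow> 'a \<Rightarrow> real" where
  "psum d p x = (\<Sum>i<p. (d i * \<mu> (Suc i)) * \<phi> (Suc i) x)"

lemma psum_mem: "psum d p \<in> H"
  unfolding psum_def[abs_def] by (intro ip.sum_mem \<phi>_mem)

lemma ip_psum: "g \<in> H \<Longrightarrow> ip g (psum d p) = (\<Sum>i<p. d i * \<mu> (Suc i) * ip g (\<phi> (Suc i)))"
  unfolding psum_def[abs_def] by (intro ip.sum_right \<phi>_mem)

lemma V_psum: "g \<in> H \<Longrightarrow> V_form Q g (psum d p) = (\<Sum>i<p. d i * \<mu> (Suc i) * V_form Q g (\<phi> (Suc i)))"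
  unfolding psum_def[abs_def] by (intro V.sum_right \<phi>_mem)

text \<open>Orthogonality turns summability into the Cauchy property, completeness supplies the
  limit, and evaluation, \<open>ip g\<close> and \<open>V_form Q g\<close> are all continuous in the
  norm of H.\<close>

lemma psum_limit:
  assumes d: "summable (\<lambda>i. (d i)^2 * \<mu> (Suc i))"
  obtains F where "F \<in> H" "\<And>x. (\<lambda>p. psum d p x) \<longlonglongrightarrow> F x"
    "\<And>g. g \<in> H \<Longrightarrow> (\<lambda>p. ip g (psum d p)) \<longlonglongrightarrow> ip g F"
    "\<And>g. g \<in> H \<Longrightarrow> (\<lambda>p. V_form Q g (psum d p)) \<longlonglongrightarrow> V_form Q g F"
proof -
  define nrm where "nrm f = sqrt (ip f f)" for f
  have blk: "ip (\<lambda>x. psum d m x - psum d l x) (\<lambda>x. psum d m x - psum d l x) = (\<Sum>i=l..<m. (d i)^2 * \<mu> (Suc i))"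
    if "l \<le> m" for l m
  proof -
    have e: "(\<lambda>x. psum d m x - psum d l x) = (\<lambda>x. \<Sum>i=l..<m. (d i * \<mu> (Suc i)) * \<phi> (Suc i) x)"
      using that by (auto simp: psum_def fun_eq_iff lessThan_atLeast0 sum.atLeastLessThan_concat[of 0 l m, symmetric])
    have "ip (\<lambda>x. psum d m x - psum d l x) (\<lambda>x. psum d m x - psum d l x) =
      (\<Sum>i=l..<m. (d i * \<mu> (Suc i)) * (\<Sum>j=l..<m. (d j * \<mu> (Suc j)) * ip (\<phi> (Suc i)) (\<phi> (Suc j))))"
      unfolding e by (subst ip.sum_left) (auto intro!: ip.sum_mem \<phi>_mem sum.cong simp: ip.sum_right \<phi>_mem)
    also have "\<dots> = (\<Sum>i=l..<m. (d i)^2 * \<mu> (Suc i))"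
    proof (rule sum.cong[OF refl])
      fix i assume i: "i \<in> {l..<m}"
      have "(\<Sum>j=l..<m. (d j * \<mu> (Suc j)) * ip (\<phi> (Suc i)) (\<phi> (Suc j))) = (\<Sum>j=l..<m. if i = j then d i else 0)"
        using \<mu>_pos by (intro sum.cong refl) (auto simp: ip_\<phi> less_imp_neq[symmetric])
      also have "\<dots> = d i" using i by simp
      finally show "(d i * \<mu> (Suc i)) * (\<Sum>j=l..<m. (d j * \<mu> (Suc j)) * ip (\<phi> (Suc i)) (\<phi> (Suc j))) = (d i)^2 * \<mu> (Suc i)"
        by (simp add: power2_eq_square)
    qed
    finally show ?thesis .
  qed
  have cauchy: "\<exists>k. \<forall>m\<ge>k. \<forall>l\<ge>k. nrm (\<lambda>x. psum d m x - psum d l x) < e" if e: "e > 0" for e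
  proof -
    from d[unfolded summable_Cauchy] e obtain k where k: "\<And>m n. m \<ge> k \<Longrightarrow> norm (\<Sum>i=m..<n. (d i)^2 * \<mu> (Suc i)) < e^2"
      by (meson zero_less_power)
    have "nrm (\<lambda>x. psum d m x - psum d l x) < e" if "l \<ge> k" "l \<le> m" for l m
    proof -
      have "ip (\<lambda>x. psum d m x - psum d l x) (\<lambda>x. psum d m x - psum d l x) < e^2"
        unfolding blk[OF that(2)] using k[OF that(1), of m] by simp
      then show ?thesis unfolding nrm_def using e real_sqrt_less_mono by fastforce
    qed
    moreover have "nrm (\<lambda>x. psum d m x - psum d l x) = nrm (\<lambda>x. psum d l x - psum d m x)" for l m
      unfolding nrm_def by (subst ip.diff_commute) (auto simp: psum_mem)
    ultimately show ?thesis by (metis nle_le)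
  qed
  have "\<exists>F\<in>H. (\<lambda>m. sqrt (ip (\<lambda>x. psum d m x - F x) (\<lambda>x. psum d m x - F x))) \<longlonglongrightarrow> 0"
    using hilbert psum_mem cauchy unfolding hilbert_function_space_def nrm_def by blast
  then obtain F where F: "F \<in> H" and lim: "(\<lambda>m. nrm (\<lambda>x. psum d m x - F x)) \<longlonglongrightarrow> 0"
    unfolding nrm_def by blast
  have dm: "(\<lambda>x. psum d m x - F x) \<in> H" for m by (intro ip.diff_mem psum_mem F)
  show thesis
  proof
    show "F \<in> H" by fact
    show "(\<lambda>p. psum d p x) \<longlonglongrightarrow> F x" for x
    proof (rule LIM_zero_cancel, rule Lim_null_comparison)
      show "\<forall>\<^sub>F p in sequentially. norm (psum d p x - F x) \<le> nrm (\<lambda>x. psum d p x - F x) * eval_norm"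
        unfolding nrm_def using eval_bound[OF dm] by auto
      show "(\<lambda>p. nrm (\<lambda>x. psum d p x - F x) * eval_norm) \<longlonglongrightarrow> 0"
        using tendsto_mult_right[OF lim, of eval_norm] by simp
    qed
    show "(\<lambda>p. ip g (psum d p)) \<longlonglongrightarrow> ip g F" if g: "g \<in> H" for g
    proof (rule LIM_zero_cancel, rule Lim_null_comparison)
      show "\<forall>\<^sub>F p in sequentially. norm (ip g (psum d p) - ip g F) \<le> nrm g * nrm (\<lambda>x. psum d p x - F x)"
        using ip.cauchy_schwarz[OF g dm] by (simp add: nrm_def ip.diff_right[OF psum_mem F g])
      show "(\<lambda>p. nrm g * nrm (\<lambda>x. psum d p x - F x)) \<longlonglongrightarrow> 0"
        using tendsto_mult_left[OF lim, of "nrm g"] by simp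
    qed
    show "(\<lambda>p. V_form Q g (psum d p)) \<longlonglongrightarrow> V_form Q g F" if g: "g \<in> H" for g
    proof (rule LIM_zero_cancel, rule Lim_null_comparison)
      show "\<forall>\<^sub>F p in sequentially. norm (V_form Q g (psum d p) - V_form Q g F) \<le> nrm g * eval_norm * eval_norm * nrm (\<lambda>x. psum d p x - F x)"
        using V_bound[OF g dm] by (simp add: nrm_def V.diff_right[OF psum_mem F g] mult_ac)
      show "(\<lambda>p. nrm g * eval_norm * eval_norm * nrm (\<lambda>x. psum d p x - F x)) \<longlonglongrightarrow> 0"
        using tendsto_mult_left[OF lim, of "nrm g * eval_norm * eval_norm"] by simp
    qed
  qed
qed

lemma summable_\<phi>: "summable (\<lambda>i. (\<phi> (Suc i) x)^2 * \<mu> (Suc i))"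
proof (rule summable_comparison_test'[OF summable_mult[OF \<mu>_sum, of "c^2"], of 0])
  fix i
  have "(\<phi> (Suc i) x)^2 \<le> c^2" using power_mono[OF \<phi>_bound[of i x], of 2] by simp
  then show "norm ((\<phi> (Suc i) x)^2 * \<mu> (Suc i)) \<le> c^2 * \<mu> (Suc i)"
    using \<mu>_nonneg[of i] by (simp add: mult_right_mono)
qed

text \<open>The choice \<open>d i = \<phi> (Suc i) x\<close> produces the kernel section at
  \<open>x\<close>; pairing its partial sums with \<open>f\<close> and passing to the limit
  reproduces \<open>f x\<close>.\<close>

lemma expansion:
  assumes f: "f \<in> H" and x: "x \<in> S"
  shows "(\<lambda>i. \<mu> (Suc i) * \<phi> (Suc i) x * ip f (\<phi> (Suc i))) sums f x"
proof -
  obtain F where F: "F \<in> H" "\<And>y. (\<lambda>p. psum (\<lambda>i. \<phi> (Suc i) x) p y) \<longlonglongrightarrow> F y"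
    "\<And>g. g \<in> H \<Longrightarrow> (\<lambda>p. ip g (psum (\<lambda>i. \<phi> (Suc i) x) p)) \<longlonglongrightarrow> ip g F"
    by (rule psum_limit[OF summable_\<phi>[of x]]) blast
  have "F y = kern \<mu> x y" for y
    using F(2)[of y] kern_sums[OF \<mu>_nonneg \<mu>_sum, of x y] unfolding psum_def sums_def
    by (auto intro: LIMSEQ_unique simp: mult_ac)
  then have "F = kern \<mu> x" by auto
  with F(3)[OF f] reproducing[OF x f] show ?thesis
    unfolding sums_def ip_psum[OF f] by (simp add: mult_ac)
qed

text \<open>The two orthogonality relations concern the eigenfunctions only. They extend to
  \<open>f\<close> because \<open>f\<close> is the limit of its own partial sums: Bessel's
  inequality makes the coefficients \<open>ip f (\<phi> (Suc i))\<close> admissible in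
  \<open>psum_limit\<close>, and \<open>expansion\<close> identifies the limit.\<close>

lemma V_eigen:
  assumes f: "f \<in> H" shows "V_form Q f (\<phi> (Suc j)) = \<mu> (Suc j) * ip f (\<phi> (Suc j))"
proof -
  define d where "d i = ip f (\<phi> (Suc i))" for i
  have bessel: "(\<Sum>i<p. (d i)^2 * \<mu> (Suc i)) \<le> ip f f" for p
  proof -
    have a: "ip f (psum d p) = (\<Sum>i<p. (d i)^2 * \<mu> (Suc i))"
      unfolding ip_psum[OF f] by (simp add: d_def power2_eq_square mult_ac)
    have "ip (\<phi> (Suc i)) (psum d p) = d i" if "i < p" for i
    proof -
      have "ip (\<phi> (Suc i)) (psum d p) = (\<Sum>j<p. if i = j then d i else 0)"
        unfolding ip_psum[OF \<phi>_mem] using \<mu>_pos by (intro sum.cong refl) (auto simp: ip_\<phi> less_imp_neq[symmetric])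
      then show ?thesis using that by simp
    qed
    then have b: "ip (psum d p) (psum d p) = (\<Sum>i<p. (d i)^2 * \<mu> (Suc i))"
      unfolding ip_psum[OF psum_mem] using ip.sym[OF psum_mem \<phi>_mem]
      by (intro sum.cong refl) (auto simp: power2_eq_square)
    show ?thesis using ip.nonneg[OF ip.diff_mem[OF f psum_mem[of d p]]]
      unfolding ip.square_diff[OF f psum_mem] a b by simp
  qed
  have sd: "summable (\<lambda>i. (d i)^2 * \<mu> (Suc i))"
    using bessel \<mu>_nonneg by (intro summableI_nonneg_bounded) auto
  obtain F where F: "F \<in> H" "\<And>y. (\<lambda>p. psum d p y) \<longlonglongrightarrow> F y"
    "\<And>g. g \<in> H \<Longrightarrow> (\<lambda>p. V_form Q g (psum d p)) \<longlonglongrightarrow> V_form Q g F"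
    by (rule psum_limit[OF sd]) blast
  have "F y = f y" for y
  proof (cases "y \<in> S")
    case True
    then show ?thesis using F(2)[of y] expansion[OF f True] unfolding psum_def sums_def d_def
      by (auto intro: LIMSEQ_unique simp: mult_ac)
  qed (simp add: H_off f F(1))
  then have Ff: "F = f" by auto
  have "(\<lambda>p. V_form Q (\<phi> (Suc j)) (psum d p)) \<longlonglongrightarrow> d j * \<mu> (Suc j)"
  proof (rule tendsto_eventually, rule eventually_sequentiallyI)
    fix p assume p: "Suc j \<le> p"
    have "V_form Q (\<phi> (Suc j)) (psum d p) = (\<Sum>i<p. if j = i then d i * \<mu> (Suc i) else 0)"
      unfolding V_psum[OF \<phi>_mem] by (intro sum.cong refl) (auto simp: V_\<phi>)
    then show "V_form Q (\<phi> (Suc j)) (psum d p) = d j * \<mu> (Suc j)" using p by simp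
  qed
  with F(3)[OF \<phi>_mem[of j]] have "V_form Q (\<phi> (Suc j)) f = d j * \<mu> (Suc j)"
    unfolding Ff by (rule LIMSEQ_unique)
  then show ?thesis using V.sym[OF f \<phi>_mem[of j]] by (simp add: d_def mult.commute)
qed

lemma shrinkage_eq: "shrinkage \<mu> lam (Suc i) = \<mu> (Suc i) / (\<mu> (Suc i) + lam)"
  using \<mu>_pos[of i] by (simp add: shrinkage_def field_simps)

end

section \<open>The penalised form and its reproducing kernel\<close>

locale ridge = spectral S Q \<phi> c H ip \<mu>
  for S :: "'a::euclidean_space set" and Q \<phi> c H ip \<mu> +
  fixes lam :: real assumes lam: "0 < lam"
begin

lemma shrinkage_nonneg: "0 \<le> shrinkage \<mu> lam (Suc i)" and shrinkage_le1: "shrinkage \<mu> lam (Suc i) \<le> 1"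
  unfolding shrinkage_eq using \<mu>_pos[of i] lam by auto

lemma shrinkage_summable: "summable (\<lambda>i. shrinkage \<mu> lam (Suc i))"
proof (rule summable_comparison_test'[OF summable_divide[OF \<mu>_sum, of lam], of 0])
  show "norm (shrinkage \<mu> lam (Suc i)) \<le> \<mu> (Suc i) / lam" for i
    unfolding shrinkage_eq using \<mu>_pos[of i] lam by (simp add: frac_le)
qed

lemmas shrinkage_facts = shrinkage_nonneg shrinkage_summable

definition Kern :: "'a \<Rightarrow> 'a \<Rightarrow> real" where
  "Kern = kern (shrinkage \<mu> lam)"

sublocale pen: semi_inner_form H "pen_ip Q ip lam"
proof
  show "0 \<le> pen_ip Q ip lam f f" if "f \<in> H" for f
    using V.nonneg[OF that] ip.nonneg[OF that] lam by (simp add: pen_ip_def)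
qed (auto simp: pen_ip_def V.sym ip.sym V.add_left ip.add_left V.scale_left ip.scale_left distrib_left
   intro: ip.zero_mem ip.add_mem ip.scale_mem)

lemma Kern_mem_reproducing:
  assumes x: "x \<in> S"
  shows "Kern x \<in> H" and "f \<in> H \<Longrightarrow> pen_ip Q ip lam f (Kern x) = f x"
proof -
  \<comment> \<open>\<open>d i * \<mu> (Suc i)\<close> is the shrunken coefficient of K, and
    \<open>V_eigen\<close> makes the penalised form supply the factor
    \<open>\<mu> (Suc i) + lam\<close> that cancels the denominator.\<close>
  define d where "d i = \<phi> (Suc i) x / (\<mu> (Suc i) + lam)" for i
  have sd: "summable (\<lambda>i. (d i)^2 * \<mu> (Suc i))"
  proof (rule summable_comparison_test'[OF summable_mult[OF summable_\<phi>[of x], of "1/lam^2"], of 0])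
    fix i
    have "1 / (\<mu> (Suc i) + lam)^2 \<le> 1 / lam^2"
      using lam \<mu>_pos[of i] by (intro divide_left_mono power_mono) auto
    then have "((\<phi> (Suc i) x)^2 * \<mu> (Suc i)) * (1 / (\<mu> (Suc i) + lam)^2) \<le> ((\<phi> (Suc i) x)^2 * \<mu> (Suc i)) * (1 / lam^2)"
      using \<mu>_nonneg[of i] by (intro mult_left_mono) auto
    then show "norm ((d i)^2 * \<mu> (Suc i)) \<le> 1/lam^2 * ((\<phi> (Suc i) x)^2 * \<mu> (Suc i))"
      using \<mu>_nonneg[of i] by (simp add: d_def power_divide mult_ac)
  qed
  obtain F where F: "F \<in> H" "\<And>y. (\<lambda>p. psum d p y) \<longlonglongrightarrow> F y"
    "\<And>g. g \<in> H \<Longrightarrow> (\<lambda>p. ip g (psum d p)) \<longlonglongrightarrow> ip g F"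
    "\<And>g. g \<in> H \<Longrightarrow> (\<lambda>p. V_form Q g (psum d p)) \<longlonglongrightarrow> V_form Q g F"
    by (rule psum_limit[OF sd]) blast
  have "F y = Kern x y" for y
    using F(2)[of y] kern_sums[OF shrinkage_facts, of x y] unfolding psum_def sums_def Kern_def
    by (auto intro!: LIMSEQ_unique simp: d_def shrinkage_eq mult_ac)
  then have FK: "F = Kern x" by auto
  then show "Kern x \<in> H" using F(1) by simp
  assume f: "f \<in> H"
  have "(\<lambda>p. V_form Q f (psum d p) + lam * ip f (psum d p)) \<longlonglongrightarrow> pen_ip Q ip lam f (Kern x)"
    unfolding pen_ip_def FK[symmetric] by (intro tendsto_intros F(3,4) f)
  moreover have "V_form Q f (psum d p) + lam * ip f (psum d p) = (\<Sum>i<p. \<mu> (Suc i) * \<phi> (Suc i) x * ip f (\<phi> (Suc i)))" for p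
  proof -
    have "d i * \<mu> (Suc i) * V_form Q f (\<phi> (Suc i)) + lam * (d i * \<mu> (Suc i) * ip f (\<phi> (Suc i)))
      = \<mu> (Suc i) * \<phi> (Suc i) x * ip f (\<phi> (Suc i))" for i
    proof -
      have "d i * \<mu> (Suc i) * V_form Q f (\<phi> (Suc i)) + lam * (d i * \<mu> (Suc i) * ip f (\<phi> (Suc i)))
        = (d i * (\<mu> (Suc i) + lam)) * \<mu> (Suc i) * ip f (\<phi> (Suc i))"
        unfolding V_eigen[OF f] by (simp add: algebra_simps)
      also have "d i * (\<mu> (Suc i) + lam) = \<phi> (Suc i) x" using lam \<mu>_pos[of i] by (simp add: d_def)
      finally show ?thesis by simp
    qed
    then show ?thesis unfolding V_psum[OF f] ip_psum[OF f] sum_distrib_left sum.distrib[symmetric] by simp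
  qed
  ultimately show "pen_ip Q ip lam f (Kern x) = f x"
    using expansion[OF f x] unfolding sums_def by (auto intro: LIMSEQ_unique)
qed

end

section \<open>The ridge estimator\<close>

text \<open>\<open>R x y / l\<close> is the kernel of the penalty \<open>l * ip\<close> alone; each
  list entry then accounts for one observation of weight \<open>r\<close>.\<close>

fun resolvent :: "('a \<Rightarrow> 'a \<Rightarrow> real) \<Rightarrow> real \<Rightarrow> real \<Rightarrow> 'a list \<Rightarrow> 'a \<Rightarrow> 'a \<Rightarrow> real" where
  "resolvent R l r [] x y = R x y / l"
| "resolvent R l r (p # ps) x y = resolvent R l r ps x y
     - r * resolvent R l r ps x p / (1 + r * resolvent R l r ps p p) * resolvent R l r ps p y"

lemma measurable_resolvent:
  assumes R: "\<And>f g. f \<in> borel_measurable N \<Longrightarrow> g \<in> borel_measurable N \<Longrightarrow> (\<lambda>\<omega>. R (f \<omega>) (g \<omega>) :: real) \<in> borel_measurable N"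
    and X: "\<And>i. i \<in> set is \<Longrightarrow> X i \<in> borel_measurable N"
    and "u \<in> borel_measurable N" "v \<in> borel_measurable N"
  shows "(\<lambda>\<omega>. resolvent R l r (map (\<lambda>i. X i \<omega>) is) (u \<omega>) (v \<omega>)) \<in> borel_measurable N"
  using X assms(3,4)
proof (induction "is" arbitrary: u v)
  case Nil
  then show ?case using R by simp
next
  case (Cons i "is")
  have [measurable]: "X i \<in> borel_measurable N" using Cons by simp
  have IH[measurable]: "(\<lambda>\<omega>. resolvent R l r (map (\<lambda>i. X i \<omega>) is) (u \<omega>) (v \<omega>)) \<in> borel_measurable N"
    if "u \<in> borel_measurable N" "v \<in> borel_measurable N" for u v
    using Cons.IH[OF _ that] Cons.prems(1) by simp
  note Cons.prems(2,3)[measurable]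
  show ?case by simp
qed

context ridge
begin

abbreviation pen where "pen \<equiv> pen_ip Q ip lam"

definition data_form :: "real \<Rightarrow> 'a list \<Rightarrow> ('a \<Rightarrow> real) \<Rightarrow> ('a \<Rightarrow> real) \<Rightarrow> real" where
  "data_form r ps f g = lam * ip f g + r * (\<Sum>p\<leftarrow>ps. f p * g p)"

lemma data_form_semi_inner:
  assumes r: "0 \<le> r" shows "semi_inner_form H (data_form r ps)"
proof
  show "0 \<le> data_form r ps f f" if "f \<in> H" for f
    unfolding data_form_def using ip.nonneg[OF that] lam r
    by (intro add_nonneg_nonneg mult_nonneg_nonneg sum_list_nonneg) auto
  show "data_form r ps f g = data_form r ps g f" if "f \<in> H" "g \<in> H" for f g
    unfolding data_form_def ip.sym[OF that] by (simp add: mult.commute)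
  show "data_form r ps (\<lambda>x. f x + g x) u = data_form r ps f u + data_form r ps g u"
    if "f \<in> H" "g \<in> H" "u \<in> H" for f g u
    unfolding data_form_def ip.add_left[OF that] by (simp add: distrib_right distrib_left sum_list_addf)
  show "data_form r ps (\<lambda>x. q * f x) g = q * data_form r ps f g" if "f \<in> H" "g \<in> H" for q f g
    unfolding data_form_def ip.scale_left[OF that] by (simp add: distrib_left mult_ac sum_list_const_mult)
qed (auto intro: ip.zero_mem ip.add_mem ip.scale_mem)

abbreviation res where "res r ps \<equiv> resolvent (kern \<mu>) lam r ps"

text \<open>Adding one observation is a rank-one perturbation of the form, so its kernel changes by the
  Sherman--Morrison formula. Being explicit, it also yields the measurability of the test statistic,
  without which \<open>distr\<close> would be meaningless.\<close>

lemma resolvent_reproducing: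
  assumes r: "0 \<le> r" and "set ps \<subseteq> S" and "x \<in> S"
  shows "res r ps x \<in> H \<and> (\<forall>f\<in>H. data_form r ps f (res r ps x) = f x)"
  using assms(2,3)
proof (induction ps arbitrary: x)
  case Nil
  have e: "res r [] x = (\<lambda>y. (1 / lam) * kern \<mu> x y)" by (auto simp: fun_eq_iff)
  show ?case
    using Nil lam ip.scale_mem[OF R_mem[of x], of "1 / lam"] ip.scale_right[OF R_mem[of x], of _ "1 / lam"]
    unfolding e data_form_def by (auto simp: reproducing)
next
  case (Cons p ps)
  interpret D: semi_inner_form H "data_form r ps" by (rule data_form_semi_inner[OF r])
  have x: "res r ps x \<in> H" "\<And>f. f \<in> H \<Longrightarrow> data_form r ps f (res r ps x) = f x"
    and p: "res r ps p \<in> H" "\<And>f. f \<in> H \<Longrightarrow> data_form r ps f (res r ps p) = f p"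
    using Cons.IH[of x] Cons.IH[of p] Cons.prems by auto
  define s where "s = r * res r ps x p / (1 + r * res r ps p p)"
  have e: "res r (p # ps) x = (\<lambda>y. res r ps x y - s * res r ps p y)"
    by (auto simp: fun_eq_iff s_def)
  \<comment> \<open>A reproducing kernel is nonnegative on its diagonal, which keeps the denominator
    of the update away from 0.\<close>
  have pp: "0 \<le> res r ps p p" using D.nonneg[OF p(1)] p(2)[OF p(1)] by simp
  have d0: "1 + r * res r ps p p > 0" using mult_nonneg_nonneg[OF r pp] by linarith
  have Cons_form: "data_form r (p # ps) f g = data_form r ps f g + r * f p * g p" for f g
    by (simp add: data_form_def algebra_simps)
  have m: "res r (p # ps) x \<in> H"
    unfolding e by (intro D.diff_mem D.scale_mem x p)
  moreover have "data_form r (p # ps) f (res r (p # ps) x) = f x" if f: "f \<in> H" for f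
  proof -
    have "data_form r (p # ps) f (res r (p # ps) x) = f x - s * f p + r * f p * (res r ps x p - s * res r ps p p)"
      unfolding Cons_form e using f by (simp add: D.diff_right D.scale_right D.scale_mem x p)
    also have "\<dots> = f x - f p * (s * (1 + r * res r ps p p) - r * res r ps x p)"
      by (simp add: algebra_simps)
    also have "s * (1 + r * res r ps p p) = r * res r ps x p" using d0 by (simp add: s_def)
    finally show ?thesis by (simp only: diff_self mult_zero_right diff_zero)
  qed
  ultimately show ?case by blast
qed

lemmas res_mem = resolvent_reproducing[THEN conjunct1]
lemmas res_reproducing = resolvent_reproducing[THEN conjunct2, rule_format]

text \<open>The reproducing property of K, whose diagonal is at most c^2 / h, combined with
  Cauchy-Schwarz.\<close>

lemma pen_eval:
  assumes "f \<in> H"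
  shows "\<bar>f z\<bar> \<le> sqrt (pen f f) * sqrt (c^2 * (\<Sum>i. shrinkage \<mu> lam (Suc i)))"
proof (cases "z \<in> S")
  case True
  have "\<bar>f z\<bar> \<le> sqrt (pen f f) * sqrt (pen (Kern z) (Kern z))"
    using pen.cauchy_schwarz[OF assms Kern_mem_reproducing(1)[OF True]] Kern_mem_reproducing(2)[OF True assms] by simp
  also have "pen (Kern z) (Kern z) = Kern z z"
    by (rule Kern_mem_reproducing(2)[OF True Kern_mem_reproducing(1)[OF True]])
  also have "sqrt (pen f f) * sqrt (Kern z z) \<le> sqrt (pen f f) * sqrt (c^2 * (\<Sum>i. shrinkage \<mu> lam (Suc i)))"
    using kern_bound[OF shrinkage_facts, of z z] pen.nonneg[OF assms] unfolding Kern_def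
    by (intro mult_left_mono real_sqrt_le_mono) auto
  finally show ?thesis .
next
  case False
  have "0 \<le> (\<Sum>i. shrinkage \<mu> lam (Suc i))" by (intro suminf_nonneg shrinkage_facts)
  then show ?thesis using H_off[OF assms False] pen.nonneg[OF assms] by simp
qed

lemma pen_pos_iff: "f \<in> H \<Longrightarrow> pen f f = 0 \<Longrightarrow> f = (\<lambda>_. 0)"
  using pen_eval[of f] by (auto simp: fun_eq_iff)

text \<open>The real supremum carries information only over a set that is bounded above;
  \<open>pen_eval\<close> provides the bound \<open>2 * m\<^sup>2\<close>. The rest is homogeneity,
  with functions of norm zero treated apart because they cannot be normalised.\<close>

lemma xi_sup_bound:
  assumes A: "finite A" and f: "f \<in> H" and g: "g \<in> H"
  shows "\<bar>empirical_mean A x (\<lambda>z. f z * g z) - (\<integral>z. f z * g z \<partial>Q)\<bar>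
    \<le> xi_sup Q H ip lam A x * (sqrt (pen f f) * sqrt (pen g g))"
proof -
  define dev where "dev f g = \<bar>empirical_mean A x (\<lambda>z. f z * g z) - (\<integral>z. f z * g z \<partial>Q)\<bar>" for f g
  define m where "m = sqrt (c^2 * (\<Sum>i. shrinkage \<mu> lam (Suc i)))"
  have m0: "0 \<le> m" unfolding m_def by (auto intro!: mult_nonneg_nonneg suminf_nonneg shrinkage_facts)
  have dev_le: "dev f g \<le> 2 * m^2" if "f \<in> H" "g \<in> H" "pen_norm Q ip lam f = 1" "pen_norm Q ip lam g = 1" for f g
  proof -
    have b: "\<bar>f z * g z\<bar> \<le> m^2" for z
    proof -
      have "\<bar>f z\<bar> \<le> m" "\<bar>g z\<bar> \<le> m"
        using pen_eval[of f z] pen_eval[of g z] that by (auto simp: m_def pen_norm_def)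
      then show ?thesis unfolding abs_mult power2_eq_square using m0 by (intro mult_mono) auto
    qed
    have "\<bar>empirical_mean A x (\<lambda>z. f z * g z)\<bar> \<le> m^2"
    proof -
      have "\<bar>\<Sum>i\<in>A. f (x i) * g (x i)\<bar> \<le> (\<Sum>i\<in>A. m^2)"
        by (rule order_trans[OF sum_abs sum_mono]) (rule b)
      then show ?thesis unfolding empirical_mean_def
        by (cases "card A = 0") (auto simp: field_simps)
    qed
    moreover have "\<bar>\<integral>z. f z * g z \<partial>Q\<bar> \<le> m^2"
    proof -
      have "\<bar>\<integral>z. f z * g z \<partial>Q\<bar> \<le> (\<integral>z. \<bar>f z * g z\<bar> \<partial>Q)" by (rule integral_abs_bound)
      also have "\<dots> \<le> (\<integral>z. m^2 \<partial>Q)"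
        by (intro integral_mono b integrable_abs integrable_H_mult that) auto
      finally show ?thesis by (simp add: Q.prob_space)
    qed
    ultimately show ?thesis unfolding dev_def by linarith
  qed
  define F where "F = {(f, g). f \<in> H \<and> g \<in> H \<and> pen_norm Q ip lam f = 1 \<and> pen_norm Q ip lam g = 1}"
  have xi: "xi_sup Q H ip lam A x = (SUP p\<in>F. case p of (f, g) \<Rightarrow> dev f g)"
    unfolding xi_sup_def F_def dev_def ..
  have bdd: "bdd_above ((\<lambda>p. case p of (f, g) \<Rightarrow> dev f g) ` F)"
    using dev_le by (intro bdd_aboveI[of _ "2*m^2"]) (auto simp: F_def)
  show ?thesis
  proof (cases "pen f f = 0 \<or> pen g g = 0")
    case True
    then have "f = (\<lambda>_. 0) \<or> g = (\<lambda>_. 0)" using pen_pos_iff f g by blast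
    then show ?thesis using True by (auto simp: empirical_mean_def)
  next
    case False
    then have p: "pen f f > 0" "pen g g > 0" using pen.nonneg f g by (auto simp: less_le)
    define a b where "a = sqrt (pen f f)" and "b = sqrt (pen g g)"
    have ab: "a > 0" "b > 0" using p by (auto simp: a_def b_def)
    define f' g' where "f' = (\<lambda>z. (1/a) * f z)" and "g' = (\<lambda>z. (1/b) * g z)"
    have "f' \<in> H" "g' \<in> H" unfolding f'_def g'_def by (intro pen.scale_mem f g)+
    moreover have sc: "pen (\<lambda>z. r * u z) (\<lambda>z. r * u z) = r * (r * pen u u)" if "u \<in> H" for r u
      by (simp add: pen.scale_left pen.scale_right pen.scale_mem that)
    then have "pen f' f' = 1" "pen g' g' = 1"
      unfolding f'_def g'_def sc[OF f] sc[OF g] using p by (auto simp: a_def b_def)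
    ultimately have "(f', g') \<in> F" by (simp add: F_def pen_norm_def)
    then have "dev f' g' \<le> xi_sup Q H ip lam A x"
      unfolding xi using cSUP_upper[OF _ bdd] by fastforce
    moreover have "dev f' g' = dev f g / (a * b)"
    proof -
      have e: "f' z * g' z = (1 / (a*b)) * (f z * g z)" for z by (simp add: f'_def g'_def)
      have "empirical_mean A x (\<lambda>z. f' z * g' z) = (1 / (a*b)) * empirical_mean A x (\<lambda>z. f z * g z)"
        unfolding e empirical_mean_def by (simp add: sum_distrib_left[symmetric] sum_divide_distrib[symmetric])
      moreover have "(\<integral>z. f' z * g' z \<partial>Q) = (1 / (a*b)) * (\<integral>z. f z * g z \<partial>Q)"
        unfolding e by (rule integral_mult_right_zero)
      ultimately show ?thesis unfolding dev_def using ab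
        by (simp add: right_diff_distrib[symmetric] abs_mult diff_divide_distrib[symmetric])
    qed
    ultimately show ?thesis using ab unfolding dev_def a_def[symmetric] b_def[symmetric]
      by (simp add: field_simps)
  qed
qed

definition points :: "nat set \<Rightarrow> (nat \<Rightarrow> 'a) \<Rightarrow> 'a list" where
  "points A x = map x (sorted_list_of_set A)"

definition sres :: "nat set \<Rightarrow> (nat \<Rightarrow> 'a) \<Rightarrow> 'a \<Rightarrow> 'a \<Rightarrow> real" where
  "sres A x = res (1 / real (card A)) (points A x)"

lemma sum_points: "finite A \<Longrightarrow> (\<Sum>p\<leftarrow>points A x. f p) = (\<Sum>i\<in>A. f (x i))"
  unfolding points_def map_map by (subst sum_list_distinct_conv_sum_set) (auto simp: comp_def)

context
  fixes A :: "nat set" and x :: "nat \<Rightarrow> 'a"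
  assumes A: "finite A" and xS: "\<And>i. i \<in> A \<Longrightarrow> x i \<in> S"
begin

lemma points_S: "set (points A x) \<subseteq> S"
  using A xS by (auto simp: points_def)

lemma sres_mem: "p \<in> S \<Longrightarrow> sres A x p \<in> H"
  unfolding sres_def by (rule res_mem[OF _ points_S]) auto

lemma sres_reproducing: "p \<in> S \<Longrightarrow> f \<in> H \<Longrightarrow>
  lam * ip f (sres A x p) + empirical_mean A x (\<lambda>z. f z * sres A x p z) = f p"
  using res_reproducing[OF _ points_S, of "1 / real (card A)" p f]
  unfolding sres_def[symmetric] data_form_def sum_points[OF A] empirical_mean_def by simp

text \<open>Against a kernel section of the sample form, the penalised form is evaluation plus a
  difference of population and empirical means, which is what \<xi> measures. The right-hand side is
  free of \<open>ip\<close>, and \<open>gram\<close> exploits this.\<close>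

lemma pen_sres:
  assumes "p \<in> S" "f \<in> H"
  shows "pen f (sres A x p) = V_form Q f (sres A x p) + f p - empirical_mean A x (\<lambda>z. f z * sres A x p z)"
  using sres_reproducing[OF assms] unfolding pen_ip_def by linarith

text \<open>For the difference \<open>g\<close> of the two sections, \<open>pen_sres\<close> bounds
  the squared norm by \<open>r * (n * sqrt (pen k k))\<close>, in which \<open>k\<close> is itself
  to be controlled. The triangle inequality replaces its norm by \<open>n + a\<close>, and
  \<open>r \<le> 1/2\<close> lets the part with \<open>n\<close> be absorbed on the left.\<close>

lemma sres_close:
  assumes p: "p \<in> S" and xi: "xi_sup Q H ip lam A x \<le> r" and r0: "0 \<le> r" and r: "r \<le> 1/2"
  shows "pen (\<lambda>z. sres A x p z - Kern p z) (\<lambda>z. sres A x p z - Kern p z) \<le> 4 * r^2 * Kern p p"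
proof -
  define k where "k = sres A x p"
  define g where "g = (\<lambda>z. k z - Kern p z)"
  note K = Kern_mem_reproducing[OF p]
  have k: "k \<in> H" unfolding k_def by (rule sres_mem[OF p])
  have g: "g \<in> H" unfolding g_def by (intro pen.diff_mem k K)
  define n a where "n = sqrt (pen g g)" and "a = sqrt (Kern p p)"
  have Kpp: "pen (Kern p) (Kern p) = Kern p p" by (rule K(2)[OF K(1)])
  have n0: "0 \<le> n" and a0: "0 \<le> a" using pen.nonneg[OF g] pen.nonneg[OF K(1)] unfolding n_def a_def Kpp by auto
  have "pen g g = pen g k - pen g (Kern p)"
    by (subst (2) g_def) (rule pen.diff_right[OF k K(1) g])
  also have "\<dots> = V_form Q g k - empirical_mean A x (\<lambda>z. g z * k z)"
    unfolding K(2)[OF g] k_def pen_sres[OF p g] by simp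
  also have "\<dots> \<le> xi_sup Q H ip lam A x * (n * sqrt (pen k k))"
    using xi_sup_bound[OF A g k, of x] unfolding n_def V_form_def by linarith
  also have "\<dots> \<le> r * (n * sqrt (pen k k))"
    using n0 pen.nonneg[OF k] by (intro mult_right_mono xi) auto
  finally have 1: "n * n \<le> n * (r * sqrt (pen k k))" using pen.nonneg[OF g] by (simp add: n_def mult_ac)
  have kk: "sqrt (pen k k) \<le> n + a"
    using pen.triangle[OF g K(1)] unfolding n_def a_def Kpp by (simp add: g_def)
  have "n \<le> 2 * r * a"
  proof (cases "n = 0")
    case False
    then have "n \<le> r * sqrt (pen k k)" using 1 n0 by simp
    also have "\<dots> \<le> r * (n + a)" by (rule mult_left_mono[OF kk r0])
    also have "\<dots> \<le> n / 2 + r * a" using mult_right_mono[OF r n0] by (simp add: distrib_left)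
    finally show ?thesis by simp
  qed (use r0 a0 in simp)
  then have "n^2 \<le> (2 * r * a)^2" using n0 by (intro power_mono)
  then show ?thesis using pen.nonneg[OF g] pen.nonneg[OF K(1)]
    unfolding n_def a_def Kpp g_def k_def by (simp add: power_mult_distrib)
qed

text \<open>Completing the square: the normal equations make the loss a constant plus half the
  sample form of \<open>f - fh\<close>. Since \<open>arg_min\<close> is a choice operator,
  uniqueness of the minimiser is needed as well; it comes from the definiteness of \<open>ip\<close>
  and \<open>lam > 0\<close>.\<close>

lemma ridge_estimator_eq:
  "ridge_estimator H ip lam A x y = (\<lambda>z. \<Sum>i\<in>A. (y i / real (card A)) * sres A x (x i) z)"
proof -
  define r where "r = 1 / real (card A)"
  have r: "0 \<le> r" by (simp add: r_def)
  interpret D: semi_inner_form H "data_form r (points A x)" by (rule data_form_semi_inner[OF r])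
  define fh where "fh = (\<lambda>z. \<Sum>i\<in>A. (y i / real (card A)) * sres A x (x i) z)"
  have fh: "fh \<in> H" unfolding fh_def by (intro D.sum_mem sres_mem xS)
  have normal: "data_form r (points A x) f fh = r * (\<Sum>i\<in>A. y i * f (x i))" if f: "f \<in> H" for f
  proof -
    have "data_form r (points A x) f fh = (\<Sum>i\<in>A. (y i / real (card A)) * data_form r (points A x) f (sres A x (x i)))"
      unfolding fh_def by (intro D.sum_right sres_mem xS f)
    also have "\<dots> = (\<Sum>i\<in>A. (y i / real (card A)) * f (x i))"
      unfolding sres_def r_def[symmetric]
      by (intro sum.cong refl arg_cong2[where f="(*)"] res_reproducing[OF r points_S] xS f)
    finally show ?thesis by (simp add: r_def sum_divide_distrib)
  qed
  define L0 where "L0 = r / 2 * (\<Sum>i\<in>A. (y i)^2) - data_form r (points A x) fh fh / 2"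
  have loss: "ridge_loss ip lam A x y f = L0 + data_form r (points A x) (\<lambda>z. f z - fh z) (\<lambda>z. f z - fh z) / 2"
    if f: "f \<in> H" for f
  proof -
    have "ridge_loss ip lam A x y f = r / 2 * (\<Sum>i\<in>A. (y i - f (x i))\<^sup>2) + lam / 2 * ip f f"
      by (simp add: ridge_loss_def r_def)
    also have "(\<Sum>i\<in>A. (y i - f (x i))\<^sup>2) = (\<Sum>i\<in>A. (y i)^2) - 2 * (\<Sum>i\<in>A. y i * f (x i)) + (\<Sum>i\<in>A. f (x i) * f (x i))"
    proof -
      have "(y i - f (x i))\<^sup>2 = (y i)^2 - 2 * (y i * f (x i)) + f (x i) * f (x i)" for i
        by (simp add: power2_eq_square algebra_simps)
      then show ?thesis by (simp add: sum.distrib sum_subtractf sum_distrib_left)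
    qed
    finally have "ridge_loss ip lam A x y f = r / 2 * (\<Sum>i\<in>A. (y i)^2) - r * (\<Sum>i\<in>A. y i * f (x i))
       + data_form r (points A x) f f / 2"
      by (simp add: data_form_def sum_points[OF A] algebra_simps)
    then show ?thesis unfolding D.square_diff[OF f fh] L0_def normal[OF f] by (simp add: field_simps)
  qed
  have z: "data_form r (points A x) (\<lambda>z. fh z - fh z) (\<lambda>z. fh z - fh z) = 0"
    using D.zero_left[OF D.zero_mem] by simp
  have "(SOME f. is_arg_min (ridge_loss ip lam A x y) (\<lambda>f. f \<in> H) f) = fh"
  proof (rule some_equality)
    show "is_arg_min (ridge_loss ip lam A x y) (\<lambda>f. f \<in> H) fh"
      unfolding is_arg_min_def
    proof (intro conjI notI fh, elim exE conjE)
      fix f assume f: "f \<in> H" and "ridge_loss ip lam A x y f < ridge_loss ip lam A x y fh"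
      then show False using D.nonneg[OF D.diff_mem[OF f fh]] unfolding loss[OF f] loss[OF fh] z by simp
    qed
    fix f assume "is_arg_min (ridge_loss ip lam A x y) (\<lambda>f. f \<in> H) f"
    then have f: "f \<in> H" and min: "\<not> ridge_loss ip lam A x y fh < ridge_loss ip lam A x y f"
      using fh unfolding is_arg_min_def by auto
    define g where "g = (\<lambda>z. f z - fh z)"
    have g: "g \<in> H" unfolding g_def by (rule D.diff_mem[OF f fh])
    have "data_form r (points A x) g g \<le> 0"
      using min unfolding loss[OF f] loss[OF fh] z g_def by simp
    moreover have "lam * ip g g \<le> data_form r (points A x) g g"
      unfolding data_form_def sum_points[OF A] using r by (simp add: sum_nonneg)
    ultimately have "lam * ip g g \<le> 0" by linarith
    then have "\<not> 0 < ip g g" using lam by (simp add: mult_le_0_iff)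
    then have "g = (\<lambda>_. 0)" using ip_pos[OF g] by blast
    then have "f z - fh z = 0" for z unfolding g_def by (metis (mono_tags))
    then show "f = fh" by (simp add: fun_eq_iff)
  qed
  then show ?thesis unfolding ridge_estimator_def arg_min_def fh_def .
qed

end

text \<open>The indices are cut at the first eigenvalue below \<open>lam\<close>. Before the cut
  every factor is at least 1/2, so \<open>k\<close> is at most 4 times the sum of squares. After it
  a factor is at most its eigenvalue over \<open>lam\<close>, and the tail condition bounds their
  sum linearly in \<open>k\<close>.\<close>

lemma shrinkage_square_sum:
  fixes C :: real
  assumes C: "0 \<le> C" and dec: "\<And>i. \<mu> (Suc (Suc i)) \<le> \<mu> (Suc i)"
    and tail: "\<And>k. 1 \<le> k \<Longrightarrow> (\<Sum>\<nu>. \<mu> (Suc (\<nu> + k))) \<le> C * real k * \<mu> k"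
  shows "(\<Sum>i. shrinkage \<mu> lam (Suc i)) \<le> (1 + C) * (4 * (\<Sum>i. (shrinkage \<mu> lam (Suc i))^2) + 1)"
proof -
  define a where "a i = shrinkage \<mu> lam (Suc i)" for i
  have a: "0 \<le> a i" "a i \<le> 1" "summable a" for i
    using shrinkage_nonneg[of i] shrinkage_le1[of i] shrinkage_summable by (auto simp: a_def[abs_def])
  have "(\<lambda>i. \<mu> (Suc i)) \<longlonglongrightarrow> 0" by (rule summable_LIMSEQ_zero[OF \<mu>_sum])
  then have "\<forall>\<^sub>F i in sequentially. \<mu> (Suc i) < lam" using lam by (rule order_tendstoD)
  then obtain i0 where i0: "\<mu> (Suc i0) < lam" by (auto simp: eventually_sequentially)
  define k where "k = (LEAST i. \<mu> (Suc i) < lam)"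
  have k: "\<mu> (Suc k) < lam" unfolding k_def by (rule LeastI[of "\<lambda>i. \<mu> (Suc i) < lam", OF i0])
  have less: "lam \<le> \<mu> (Suc i)" if "i < k" for i
    using not_less_Least[of i "\<lambda>i. \<mu> (Suc i) < lam"] that unfolding k_def[symmetric] by simp
  have half: "1/2 \<le> a i" if "i < k" for i
    using less[OF that] lam \<mu>_pos[of i] unfolding a_def shrinkage_eq by (simp add: field_simps)
  have square_summable: "summable (\<lambda>i. (a i)^2)"
  proof (rule summable_comparison_test'[OF a(3), of 0])
    show "norm ((a i)^2) \<le> a i" for i
      using mult_left_mono[OF a(2)[of i] a(1)[of i]] a(1)[of i] by (simp add: power2_eq_square)
  qed
  have "real k * (1/4) = (\<Sum>i<k. (1/2)^2)" by (simp add: power2_eq_square)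
  also have "\<dots> \<le> (\<Sum>i<k. (a i)^2)" by (intro sum_mono power_mono half) auto
  also have "\<dots> \<le> (\<Sum>i. (a i)^2)" by (intro sum_le_suminf square_summable) auto
  finally have lower: "real k \<le> 4 * (\<Sum>i. (a i)^2)" by simp
  have s\<mu>: "summable (\<lambda>i. \<mu> (Suc (i + j)))" for j
    using summable_ignore_initial_segment[OF \<mu>_sum, of j] by simp
  have "(\<Sum>i. a (i + k)) \<le> (\<Sum>i. \<mu> (Suc (i + k)) / lam)"
  proof (rule suminf_le)
    show "a (i + k) \<le> \<mu> (Suc (i + k)) / lam" for i
      unfolding a_def shrinkage_eq using \<mu>_pos[of "i+k"] lam by (simp add: frac_le)
  qed (use a(3) s\<mu> in \<open>auto intro: summable_ignore_initial_segment summable_divide\<close>)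
  also have "\<dots> = (\<Sum>i. \<mu> (Suc (i + k))) / lam" by (rule suminf_divide[OF s\<mu>])
  finally have head: "(\<Sum>i. a (i + k)) \<le> (\<Sum>i. \<mu> (Suc (i + k))) / lam" .
  \<comment> \<open>One term is split off so that the tail condition applies at
    \<open>Suc k\<close>: that index is at least 1 even if \<open>k = 0\<close>, and its eigenvalue
    is below \<open>lam\<close>.\<close>
  have "(\<Sum>i. \<mu> (Suc (i + k))) = \<mu> (Suc k) + (\<Sum>i. \<mu> (Suc (i + Suc k)))"
    using suminf_split_head[OF s\<mu>[of k]] by simp
  also have "\<dots> \<le> \<mu> (Suc k) + C * real (Suc k) * \<mu> (Suc k)"
    using tail[of "Suc k"] by (intro add_left_mono) auto
  also have "\<dots> = (1 + C * real (Suc k)) * \<mu> (Suc k)" by (simp add: algebra_simps)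
  also have "\<dots> \<le> (1 + C * real (Suc k)) * lam" using k C by (intro mult_left_mono) auto
  finally have "(\<Sum>i. \<mu> (Suc (i + k))) / lam \<le> (1 + C * real (Suc k)) * lam / lam"
    using lam by (intro divide_right_mono) auto
  then have up: "(\<Sum>i. a (i + k)) \<le> 1 + C * real (Suc k)" using head lam by simp
  have "(\<Sum>i. a i) = (\<Sum>i. a (i + k)) + (\<Sum>i<k. a i)" by (rule suminf_split_initial_segment[OF a(3)])
  also have "(\<Sum>i<k. a i) \<le> (\<Sum>i<k. 1)" by (intro sum_mono a)
  finally have "(\<Sum>i. a i) \<le> (1 + C) * (real k + 1)" using up by (simp add: algebra_simps)
  also have "\<dots> \<le> (1 + C) * (4 * (\<Sum>i. (a i)^2) + 1)" using lower C by (intro mult_left_mono) auto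
  finally show ?thesis unfolding a_def .
qed

end

section \<open>The regression model under the null hypothesis\<close>

lemma (in prob_space) indep_vars_Suc:
  assumes "indep_vars (\<lambda>_. E) X {1..}"
  shows "indep_vars (\<lambda>_. E) (\<lambda>i. X (Suc i)) UNIV"
  unfolding indep_vars_def2 indep_sets_def
proof (intro conjI ballI allI impI)
  show "random_variable E (X (Suc i))" for i using assms by (auto simp: indep_vars_def2)
  then show "{X (Suc i) -` A \<inter> space M |A. A \<in> sets E} \<subseteq> events" for i by auto
  fix J :: "nat set" and A
  assume J: "J \<noteq> {}" "finite J" and A: "A \<in> (\<Pi> j\<in>J. {X (Suc j) -` A \<inter> space M |A. A \<in> sets E})"
  define A' where "A' j = A (j - 1)" for j
  have "prob (\<Inter>j\<in>Suc ` J. A' j) = (\<Prod>j\<in>Suc ` J. prob (A' j))"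
  proof -
    have "A' \<in> (\<Pi> j\<in>Suc ` J. {X j -` A \<inter> space M |A. A \<in> sets E})"
      using A by (auto simp: A'_def Pi_iff)
    moreover have "Suc ` J \<subseteq> {1..}" "Suc ` J \<noteq> {}" "finite (Suc ` J)" using J by auto
    ultimately show ?thesis using assms unfolding indep_vars_def2 indep_sets_def by blast
  qed
  then show "prob (\<Inter>j\<in>J. A j) = (\<Prod>j\<in>J. prob (A j))"
    by (simp add: A'_def prod.reindex)
qed

locale null_model = prob_space M
  for M :: "'w measure" +
  fixes S :: "'a::euclidean_space set" and p :: "'a \<Rightarrow> real" and X :: "nat \<Rightarrow> 'w \<Rightarrow> 'a"
    and Y \<epsilon> :: "nat \<Rightarrow> 'w \<Rightarrow> real" and v :: "'a \<Rightarrow> real" and \<sigma> \<tau> :: real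
  assumes S_sets: "S \<in> sets borel"
    and model: "regression_model M S p X Y \<epsilon> (\<lambda>_. 0) v"
    and homoscedastic: "\<And>x. x \<in> S \<Longrightarrow> v x = \<sigma>\<^sup>2"
    and fourth: "\<And>i. 1 \<le> i \<Longrightarrow> AE \<omega> in M.
               nn_cond_exp M (sigma_of M (X i)) (\<lambda>\<omega>. ennreal ((\<epsilon> i \<omega>) ^ 4)) \<omega> < ennreal \<tau>"
    and \<tau>_pos: "0 < \<tau>"
begin

lemma Y_eps: "1 \<le> i \<Longrightarrow> \<omega> \<in> space M \<Longrightarrow> Y i \<omega> = \<epsilon> i \<omega>"
  using model by (simp add: regression_model_def)

lemma eps_integrable: "1 \<le> i \<Longrightarrow> integrable M (\<epsilon> i)"
  using model by (simp add: regression_model_def)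

lemma eps_measurable: "1 \<le> i \<Longrightarrow> \<epsilon> i \<in> borel_measurable M"
  using eps_integrable by auto

lemma pair_indep: "indep_vars (\<lambda>_. borel \<Otimes>\<^sub>M borel) (\<lambda>i \<omega>. (Y i \<omega>, X i \<omega>)) {1..}"
  using model by (simp add: regression_model_def)

lemma pair_measurable: "1 \<le> i \<Longrightarrow> (\<lambda>\<omega>. (Y i \<omega>, X i \<omega>)) \<in> measurable M (borel \<Otimes>\<^sub>M borel)"
  using pair_indep by (auto simp: indep_vars_def2)

lemma X_measurable[measurable]: "1 \<le> i \<Longrightarrow> X i \<in> borel_measurable M"
  using measurable_compose[OF pair_measurable measurable_snd] by simp

lemma Y_measurable[measurable]: "1 \<le> i \<Longrightarrow> Y i \<in> borel_measurable M"
  using measurable_compose[OF pair_measurable measurable_fst] by simp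

lemma X_measurable_S: "1 \<le> i \<Longrightarrow> X i \<in> measurable M (restrict_space lborel S)"
  and X_law: "1 \<le> i \<Longrightarrow> distr M (restrict_space lborel S) (X i) = design_law S p"
  using model by (auto simp: regression_model_def distributed_def design_law_def)

lemma X_S: "1 \<le> i \<Longrightarrow> \<omega> \<in> space M \<Longrightarrow> X i \<omega> \<in> S"
  using measurable_space[OF X_measurable_S] by (simp add: space_restrict_space)

lemma subalg: "1 \<le> i \<Longrightarrow> sigma_finite_subalgebra M (sigma_of M (X i))"
proof -
  assume i: "1 \<le> i"
  have "subalgebra M (sigma_of M (X i))"
    unfolding subalgebra_def sigma_of_def
    using X_measurable[OF i] by (auto simp: sets_vimage_algebra2)
  then show ?thesis
    by (intro finite_measure_subalgebra_is_sigma_finite finite_measure_subalgebra.intro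
        finite_measure_subalgebra_axioms.intro finite_measure_axioms)
qed

lemma sigma_of_measurable: "g \<in> borel_measurable borel \<Longrightarrow> (\<lambda>\<omega>. g (X i \<omega>)) \<in> borel_measurable (sigma_of M (X i))"
  unfolding sigma_of_def by (rule measurable_compose[OF measurable_vimage_algebra1]) auto

lemma integral_X:
  assumes i: "1 \<le> i" and g: "g \<in> borel_measurable borel"
  shows "expectation (\<lambda>\<omega>. g (X i \<omega>)) = (\<integral>x. g x \<partial>design_law S p :: real)"
  unfolding X_law[OF i, symmetric] using g X_measurable_S[OF i]
  by (subst integral_distr) (auto intro: measurable_restrict_space1)

lemma prob_design: "prob_space (design_law S p)"
  using prob_space_distr[OF X_measurable_S[of 1]] X_law[of 1] by simp

section \<open>Moments of the noise against functions of the covariate\<close>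

context
  fixes i :: nat and g :: "'a \<Rightarrow> real" and B :: real
  assumes i: "1 \<le> i" and g: "g \<in> borel_measurable borel" and gB: "\<And>x. x \<in> S \<Longrightarrow> \<bar>g x\<bar> \<le> B"
begin

interpretation sigma_finite_subalgebra M "sigma_of M (X i)" by (rule subalg[OF i])

lemma gX: "(\<lambda>\<omega>. g (X i \<omega>)) \<in> borel_measurable M"
  using measurable_compose[OF X_measurable[OF i] g] .

text \<open>Stated for \<open>Y\<close>, which equals the noise under the null hypothesis, because
  independence is assumed for the pairs of response and covariate.\<close>

lemma eps_mean: "expectation (\<lambda>\<omega>. Y i \<omega> * g (X i \<omega>)) = 0"
proof -
  have "integrable M (\<lambda>\<omega>. g (X i \<omega>) * \<epsilon> i \<omega>)"
  proof (rule Bochner_Integration.integrable_bound)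
    show "integrable M (\<lambda>\<omega>. B * \<epsilon> i \<omega>)" using eps_integrable[OF i] by simp
    show "AE \<omega> in M. norm (g (X i \<omega>) * \<epsilon> i \<omega>) \<le> norm (B * \<epsilon> i \<omega>)"
      by (intro AE_I2) (auto simp: abs_mult intro!: mult_right_mono order_trans[OF gB[OF X_S[OF i]] abs_ge_self])
  qed (use gX eps_measurable[OF i] in measurable)
  from real_cond_exp_intg(2)[OF this sigma_of_measurable[OF g] eps_measurable[OF i]]
  have "expectation (\<lambda>\<omega>. g (X i \<omega>) * \<epsilon> i \<omega>) = expectation (\<lambda>\<omega>. g (X i \<omega>) * real_cond_exp M (sigma_of M (X i)) (\<epsilon> i) \<omega>)"
    by simp
  also have "\<dots> = 0"
  proof (rule integral_eq_zero_AE)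
    have "AE \<omega> in M. real_cond_exp M (sigma_of M (X i)) (\<epsilon> i) \<omega> = 0"
      using model i by (simp add: regression_model_def)
    then show "AE \<omega> in M. g (X i \<omega>) * real_cond_exp M (sigma_of M (X i)) (\<epsilon> i) \<omega> = 0" by eventually_elim simp
  qed
  also have "expectation (\<lambda>\<omega>. g (X i \<omega>) * \<epsilon> i \<omega>) = expectation (\<lambda>\<omega>. Y i \<omega> * g (X i \<omega>))"
    by (intro Bochner_Integration.integral_cong refl) (simp add: Y_eps[OF i])
  finally show ?thesis .
qed

text \<open>In extended nonnegative integrals, as integrability of the squared noise is still to be
  established.\<close>

lemma nn_eps_square:
  "(\<integral>\<^sup>+\<omega>. ennreal \<bar>g (X i \<omega>)\<bar> * ennreal (Y i \<omega> ^ 2) \<partial>M) = ennreal (\<sigma>^2) * (\<integral>\<^sup>+\<omega>. ennreal \<bar>g (X i \<omega>)\<bar> \<partial>M)"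
proof -
  note gX[measurable] eps_measurable[OF i, measurable]
  have ag: "(\<lambda>x. ennreal \<bar>g x\<bar>) \<in> borel_measurable borel" using g by measurable
  have "(\<integral>\<^sup>+\<omega>. ennreal \<bar>g (X i \<omega>)\<bar> * ennreal (Y i \<omega> ^ 2) \<partial>M) = (\<integral>\<^sup>+\<omega>. ennreal \<bar>g (X i \<omega>)\<bar> * ennreal (\<epsilon> i \<omega> ^ 2) \<partial>M)"
    by (intro nn_integral_cong) (simp add: Y_eps[OF i])
  also have "\<dots> = (\<integral>\<^sup>+\<omega>. ennreal \<bar>g (X i \<omega>)\<bar> * nn_cond_exp M (sigma_of M (X i)) (\<lambda>\<omega>. ennreal (\<epsilon> i \<omega> ^ 2)) \<omega> \<partial>M)"
    by (rule nn_cond_exp_intg[symmetric]) (use sigma_of_measurable[OF g] in measurable)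
  also have "\<dots> = (\<integral>\<^sup>+\<omega>. ennreal (\<sigma>^2) * ennreal \<bar>g (X i \<omega>)\<bar> \<partial>M)"
  proof (rule nn_integral_cong_AE)
    have "AE \<omega> in M. nn_cond_exp M (sigma_of M (X i)) (\<lambda>\<omega>. ennreal ((\<epsilon> i \<omega>)\<^sup>2)) \<omega> = ennreal (v (X i \<omega>))"
      using model i by (simp add: regression_model_def)
    with AE_space show "AE \<omega> in M. ennreal \<bar>g (X i \<omega>)\<bar> * nn_cond_exp M (sigma_of M (X i)) (\<lambda>\<omega>. ennreal (\<epsilon> i \<omega> ^ 2)) \<omega>
        = ennreal (\<sigma>^2) * ennreal \<bar>g (X i \<omega>)\<bar>"
      by eventually_elim (simp add: homoscedastic X_S[OF i] mult.commute)
  qed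
  also have "\<dots> = ennreal (\<sigma>^2) * (\<integral>\<^sup>+\<omega>. ennreal \<bar>g (X i \<omega>)\<bar> \<partial>M)"
    by (rule nn_integral_cmult) measurable
  finally show ?thesis .
qed

lemma nn_eps_fourth:
  "(\<integral>\<^sup>+\<omega>. ennreal \<bar>g (X i \<omega>)\<bar> * ennreal (Y i \<omega> ^ 4) \<partial>M) \<le> ennreal \<tau> * (\<integral>\<^sup>+\<omega>. ennreal \<bar>g (X i \<omega>)\<bar> \<partial>M)"
proof -
  note gX[measurable] eps_measurable[OF i, measurable]
  have "(\<integral>\<^sup>+\<omega>. ennreal \<bar>g (X i \<omega>)\<bar> * ennreal (Y i \<omega> ^ 4) \<partial>M) = (\<integral>\<^sup>+\<omega>. ennreal \<bar>g (X i \<omega>)\<bar> * ennreal (\<epsilon> i \<omega> ^ 4) \<partial>M)"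
    by (intro nn_integral_cong) (simp add: Y_eps[OF i])
  also have "\<dots> = (\<integral>\<^sup>+\<omega>. ennreal \<bar>g (X i \<omega>)\<bar> * nn_cond_exp M (sigma_of M (X i)) (\<lambda>\<omega>. ennreal (\<epsilon> i \<omega> ^ 4)) \<omega> \<partial>M)"
    by (rule nn_cond_exp_intg[symmetric]) (use sigma_of_measurable[OF g] in measurable)
  also have "\<dots> \<le> (\<integral>\<^sup>+\<omega>. ennreal \<tau> * ennreal \<bar>g (X i \<omega>)\<bar> \<partial>M)"
  proof (rule nn_integral_mono_AE)
    show "AE \<omega> in M. ennreal \<bar>g (X i \<omega>)\<bar> * nn_cond_exp M (sigma_of M (X i)) (\<lambda>\<omega>. ennreal (\<epsilon> i \<omega> ^ 4)) \<omega>
        \<le> ennreal \<tau> * ennreal \<bar>g (X i \<omega>)\<bar>"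
      using fourth[OF i] by eventually_elim (subst mult.commute, rule mult_right_mono[OF less_imp_le], auto)
  qed
  also have "\<dots> = ennreal \<tau> * (\<integral>\<^sup>+\<omega>. ennreal \<bar>g (X i \<omega>)\<bar> \<partial>M)"
    by (rule nn_integral_cmult) measurable
  finally show ?thesis .
qed

lemma gX_integrable: "integrable M (\<lambda>\<omega>. g (X i \<omega>))"
  using gX gB X_S[OF i] by (intro integrable_const_bound[where B=B]) (auto intro!: AE_I2)

end

lemma Y_fourth:
  assumes i: "1 \<le> i" and g: "g \<in> borel_measurable borel" and gB: "\<And>x. x \<in> S \<Longrightarrow> \<bar>g x\<bar> \<le> B"
    and g0: "\<And>x. 0 \<le> g x"
  shows "integrable M (\<lambda>\<omega>. Y i \<omega> ^ 4 * g (X i \<omega>))"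
    and "expectation (\<lambda>\<omega>. Y i \<omega> ^ 4 * g (X i \<omega>)) \<le> \<tau> * expectation (\<lambda>\<omega>. g (X i \<omega>))"
proof -
  note gX[OF i g gB, measurable]
  note Y_measurable[OF i, measurable]
  have m: "(\<lambda>\<omega>. Y i \<omega> ^ 4 * g (X i \<omega>)) \<in> borel_measurable M" by measurable
  have fin: "(\<integral>\<^sup>+\<omega>. ennreal \<bar>g (X i \<omega>)\<bar> \<partial>M) = ennreal (expectation (\<lambda>\<omega>. g (X i \<omega>)))"
    using gX_integrable[OF i g gB] g0 by (subst nn_integral_eq_integral[symmetric]) auto
  have e: "(\<integral>\<^sup>+\<omega>. ennreal (Y i \<omega> ^ 4 * g (X i \<omega>)) \<partial>M) = (\<integral>\<^sup>+\<omega>. ennreal \<bar>g (X i \<omega>)\<bar> * ennreal (Y i \<omega> ^ 4) \<partial>M)"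
    using g0 by (intro nn_integral_cong) (simp add: ennreal_mult' mult.commute)
  have le: "(\<integral>\<^sup>+\<omega>. ennreal (Y i \<omega> ^ 4 * g (X i \<omega>)) \<partial>M) \<le> ennreal (\<tau> * expectation (\<lambda>\<omega>. g (X i \<omega>)))"
    unfolding e using nn_eps_fourth[OF i g gB] \<tau>_pos unfolding fin by (simp add: ennreal_mult')
  show int: "integrable M (\<lambda>\<omega>. Y i \<omega> ^ 4 * g (X i \<omega>))"
  proof (rule integrableI_bounded[OF m])
    have "(\<integral>\<^sup>+\<omega>. ennreal (norm (Y i \<omega> ^ 4 * g (X i \<omega>))) \<partial>M) = (\<integral>\<^sup>+\<omega>. ennreal (Y i \<omega> ^ 4 * g (X i \<omega>)) \<partial>M)"
      using g0 by (intro nn_integral_cong) (simp add: abs_mult)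
    also have "\<dots> < \<infinity>" using le by (rule order_le_less_trans) simp
    finally show "(\<integral>\<^sup>+\<omega>. ennreal (norm (Y i \<omega> ^ 4 * g (X i \<omega>))) \<partial>M) < \<infinity>" .
  qed
  have "ennreal (expectation (\<lambda>\<omega>. Y i \<omega> ^ 4 * g (X i \<omega>))) \<le> ennreal (\<tau> * expectation (\<lambda>\<omega>. g (X i \<omega>)))"
    using le int g0 by (subst nn_integral_eq_integral[symmetric]) auto
  then show "expectation (\<lambda>\<omega>. Y i \<omega> ^ 4 * g (X i \<omega>)) \<le> \<tau> * expectation (\<lambda>\<omega>. g (X i \<omega>))"
    using \<tau>_pos g0 by (simp add: Bochner_Integration.integral_nonneg)
qed

lemma Y_L4: "1 \<le> i \<Longrightarrow> L4 (Y i)"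
  using Y_fourth(1)[of i "\<lambda>_. 1" 1] Y_measurable[of i] by (simp add: L4_def)

lemma Y_fourth_moment: "1 \<le> i \<Longrightarrow> expectation (\<lambda>\<omega>. Y i \<omega> ^ 4) \<le> \<tau>"
  using Y_fourth(2)[of i "\<lambda>_. 1" 1] by (simp add: prob_space)

text \<open>\<open>nn_eps_square\<close> sees the absolute value of \<open>g\<close> only, so a
  signed \<open>g\<close> is split into its positive and negative parts.\<close>

lemma Y_square:
  assumes i: "1 \<le> i" and g: "g \<in> borel_measurable borel" and gB: "\<And>x. x \<in> S \<Longrightarrow> \<bar>g x\<bar> \<le> B"
  shows "integrable M (\<lambda>\<omega>. Y i \<omega> ^ 2 * g (X i \<omega>))"
    and "expectation (\<lambda>\<omega>. Y i \<omega> ^ 2 * g (X i \<omega>)) = \<sigma>^2 * expectation (\<lambda>\<omega>. g (X i \<omega>))"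
proof -
  have int: "integrable M (\<lambda>\<omega>. Y i \<omega> ^ 2 * g (X i \<omega>))"
    if g: "g \<in> borel_measurable borel" and gB: "\<And>x. x \<in> S \<Longrightarrow> \<bar>g x\<bar> \<le> B" for g B
  proof (rule Bochner_Integration.integrable_bound)
    show "integrable M (\<lambda>\<omega>. B * Y i \<omega> ^ 2)" using L4_integrable(2)[OF Y_L4[OF i]] by simp
    show "AE \<omega> in M. norm (Y i \<omega> ^ 2 * g (X i \<omega>)) \<le> norm (B * Y i \<omega> ^ 2)"
      by (intro AE_I2) (auto simp: abs_mult mult.commute intro!: mult_right_mono order_trans[OF gB[OF X_S[OF i]] abs_ge_self])
  qed (use gX[OF i g gB] Y_measurable[OF i] in measurable)
  have pos: "expectation (\<lambda>\<omega>. Y i \<omega> ^ 2 * g (X i \<omega>)) = \<sigma>^2 * expectation (\<lambda>\<omega>. g (X i \<omega>))"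
    if g: "g \<in> borel_measurable borel" and gB: "\<And>x. x \<in> S \<Longrightarrow> \<bar>g x\<bar> \<le> B" and g0: "\<And>x. 0 \<le> g x" for g B
  proof -
    have fin: "(\<integral>\<^sup>+\<omega>. ennreal \<bar>g (X i \<omega>)\<bar> \<partial>M) = ennreal (expectation (\<lambda>\<omega>. g (X i \<omega>)))"
      using gX_integrable[OF i g gB] g0 by (subst nn_integral_eq_integral[symmetric]) auto
    have "ennreal (expectation (\<lambda>\<omega>. Y i \<omega> ^ 2 * g (X i \<omega>))) = (\<integral>\<^sup>+\<omega>. ennreal (Y i \<omega> ^ 2 * g (X i \<omega>)) \<partial>M)"
      using int[OF g gB] g0 by (subst nn_integral_eq_integral) auto
    also have "\<dots> = (\<integral>\<^sup>+\<omega>. ennreal \<bar>g (X i \<omega>)\<bar> * ennreal (Y i \<omega> ^ 2) \<partial>M)"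
      using g0 by (intro nn_integral_cong) (simp add: ennreal_mult' mult.commute)
    also have "\<dots> = ennreal (\<sigma>^2 * expectation (\<lambda>\<omega>. g (X i \<omega>)))"
      by (subst nn_eps_square[OF i g gB], assumption, subst fin, rule ennreal_mult'[symmetric]) simp
    finally show ?thesis using g0 by (simp add: Bochner_Integration.integral_nonneg)
  qed
  show "integrable M (\<lambda>\<omega>. Y i \<omega> ^ 2 * g (X i \<omega>))" by (rule int[OF g gB])
  define gp gm where "gp x = max (g x) 0" and "gm x = max (- g x) 0" for x
  have [measurable]: "gp \<in> borel_measurable borel" "gm \<in> borel_measurable borel"
    using g unfolding gp_def gm_def by measurable
  have b: "\<bar>gp x\<bar> \<le> B" "\<bar>gm x\<bar> \<le> B" if "x \<in> S" for x using gB[OF that] by (auto simp: gp_def gm_def)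
  have e: "g x = gp x - gm x" for x by (simp add: gp_def gm_def)
  have "expectation (\<lambda>\<omega>. Y i \<omega> ^ 2 * g (X i \<omega>)) = expectation (\<lambda>\<omega>. Y i \<omega> ^ 2 * gp (X i \<omega>)) - expectation (\<lambda>\<omega>. Y i \<omega> ^ 2 * gm (X i \<omega>))"
    unfolding e right_diff_distrib using int[of gp B] int[of gm B] b by simp
  also have "\<dots> = \<sigma>^2 * (expectation (\<lambda>\<omega>. gp (X i \<omega>)) - expectation (\<lambda>\<omega>. gm (X i \<omega>)))"
    using pos[of gp B] pos[of gm B] b by (simp add: gp_def gm_def right_diff_distrib)
  also have "expectation (\<lambda>\<omega>. gp (X i \<omega>)) - expectation (\<lambda>\<omega>. gm (X i \<omega>)) = expectation (\<lambda>\<omega>. g (X i \<omega>))"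
    unfolding e using gX_integrable[of i gp B] gX_integrable[of i gm B] i b by simp
  finally show "expectation (\<lambda>\<omega>. Y i \<omega> ^ 2 * g (X i \<omega>)) = \<sigma>^2 * expectation (\<lambda>\<omega>. g (X i \<omega>))" .
qed

lemma \<sigma>_pos: "0 < \<sigma>^2"
proof -
  obtain \<omega> where "\<omega> \<in> space M" using not_empty by auto
  then have x: "X 1 \<omega> \<in> S" by (intro X_S) auto
  then have "0 < v (X 1 \<omega>)" using model by (simp add: regression_model_def)
  then show ?thesis using homoscedastic[OF x] by simp
qed

text \<open>Shifts the sample from indices starting at 1 to indices starting at 0, the convention of
  \<open>iid_sample\<close>.\<close>

definition obs :: "nat \<Rightarrow> 'w \<Rightarrow> real \<times> 'a" where
  "obs i \<omega> = (Y (Suc i) \<omega>, X (Suc i) \<omega>)"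

abbreviation obs_space :: "(real \<times> 'a) measure" where
  "obs_space \<equiv> borel \<Otimes>\<^sub>M borel"

definition obs_law :: "(real \<times> 'a) measure" where
  "obs_law = distr M obs_space (\<lambda>\<omega>. (Y 1 \<omega>, X 1 \<omega>))"

sublocale sample: iid_sample M obs_space obs_law obs
proof
  show "indep_vars (\<lambda>_. obs_space) obs UNIV"
    unfolding obs_def[abs_def] using indep_vars_Suc[OF pair_indep] by simp
  show "distr M obs_space (obs i) = obs_law" for i
  proof -
    have "\<forall>i\<ge>1. distr M obs_space (\<lambda>\<omega>. (Y i \<omega>, X i \<omega>)) = distr M obs_space (\<lambda>\<omega>. (Y 1 \<omega>, X 1 \<omega>))"
      using model unfolding regression_model_def by (elim conjE)
    then show ?thesis unfolding obs_def[abs_def] obs_law_def by (elim allE[of _ "Suc i"]) auto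
  qed
qed

text \<open>All other observations, later ones included, because the weights of the quadratic forms
  depend on the entire design.\<close>

lemma pair_indep_rest:
  assumes "l \<in> {1..N}"
  shows "indep_pair (PiM ({1..N} - {l}) (\<lambda>_. obs_space)) (\<lambda>\<omega>. \<lambda>i\<in>{1..N} - {l}. (Y i \<omega>, X i \<omega>))
           obs_space (\<lambda>\<omega>. (Y l \<omega>, X l \<omega>))"
proof -
  have "indep_var (PiM ({1..N} - {l}) (\<lambda>_. obs_space)) (\<lambda>\<omega>. restrict (\<lambda>i. (Y i \<omega>, X i \<omega>)) ({1..N} - {l}))
      (PiM {l} (\<lambda>_. obs_space)) (\<lambda>\<omega>. restrict (\<lambda>i. (Y i \<omega>, X i \<omega>)) {l})"
    by (rule indep_var_restrict[OF pair_indep]) (use assms in auto)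
  from indep_pair_compose[OF this, of "\<lambda>z. z" _ "\<lambda>z. z l" obs_space] show ?thesis by simp
qed

definition design :: "nat \<Rightarrow> 'w \<Rightarrow> nat \<Rightarrow> 'a" where
  "design N \<omega> = (\<lambda>i\<in>{1..N}. X i \<omega>)"

text \<open>The weight \<open>b\<close> may depend on all covariates, so the responses are
  uncorrelated given the whole design. Everything but observation \<open>l\<close> is frozen, and
  what remains is a bounded function of \<open>X l\<close> times \<open>Y l\<close> or its
  square.\<close>

lemma expectation_cross:
  fixes b :: "(nat \<Rightarrow> 'a) \<Rightarrow> real"
  assumes b: "b \<in> borel_measurable (PiM {1..N} (\<lambda>_. borel))"
    and bB: "\<And>x. (\<And>i. i \<in> {1..N} \<Longrightarrow> x i \<in> S) \<Longrightarrow> \<bar>b x\<bar> \<le> B"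
    and i: "i \<in> {1..N}" and l: "l \<in> {1..N}"
  shows "integrable M (\<lambda>\<omega>. Y i \<omega> * Y l \<omega> * b (design N \<omega>))"
    and "expectation (\<lambda>\<omega>. Y i \<omega> * Y l \<omega> * b (design N \<omega>)) = (if i = l then \<sigma>^2 * expectation (\<lambda>\<omega>. b (design N \<omega>)) else 0)"
proof -
  have dm: "design N \<in> measurable M (PiM {1..N} (\<lambda>_. borel))"
    unfolding design_def by (rule measurable_restrict) (use X_measurable in auto)
  have bm[measurable]: "(\<lambda>\<omega>. b (design N \<omega>)) \<in> borel_measurable M" by (rule measurable_compose[OF dm b])
  have [measurable]: "Y i \<in> borel_measurable M" "Y l \<in> borel_measurable M" using i l by auto
  have bd: "\<bar>b (design N \<omega>)\<bar> \<le> B" if "\<omega> \<in> space M" for \<omega>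
    using X_S that by (intro bB) (simp add: design_def)
  show int: "integrable M (\<lambda>\<omega>. Y i \<omega> * Y l \<omega> * b (design N \<omega>))"
  proof (rule Bochner_Integration.integrable_bound)
    show "integrable M (\<lambda>\<omega>. B * (Y i \<omega> * Y l \<omega>))"
      using L4_mult_integrable[OF Y_L4 Y_L4] i l by simp
    show "AE \<omega> in M. norm (Y i \<omega> * Y l \<omega> * b (design N \<omega>)) \<le> norm (B * (Y i \<omega> * Y l \<omega>))"
      by (intro AE_I2) (auto simp: abs_mult mult.commute intro!: mult_right_mono mult_left_mono order_trans[OF bd abs_ge_self])
  qed measurable
  have intb: "integrable M (\<lambda>\<omega>. b (design N \<omega>))"
    using bd by (intro integrable_const_bound[where B=B]) (auto intro!: AE_I2)
  define rest where "rest \<omega> = (\<lambda>j\<in>{1..N} - {l}. (Y j \<omega>, X j \<omega>))" for \<omega>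
  define G where "G z x = b (\<lambda>j\<in>{1..N}. if j = l then x else snd (z j))" for z :: "nat \<Rightarrow> real \<times> 'a" and x
  have Gm: "(\<lambda>w. G (fst w) (snd (snd w))) \<in> borel_measurable (PiM ({1..N} - {l}) (\<lambda>_. obs_space) \<Otimes>\<^sub>M obs_space)"
    unfolding G_def
  proof (rule measurable_compose[OF measurable_restrict b])
    fix j assume "j \<in> {1..N}"
    then show "(\<lambda>w. if j = l then snd (snd w) else snd (fst w j)) \<in> borel_measurable (PiM ({1..N} - {l}) (\<lambda>_. obs_space) \<Otimes>\<^sub>M obs_space)"
      by (cases "j = l") auto
  qed
  have rest_design: "G (rest \<omega>) (X l \<omega>) = b (design N \<omega>)" for \<omega>
    unfolding G_def rest_def design_def by (intro arg_cong[where f=b]) (auto simp: fun_eq_iff)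
  have Gl: "(\<lambda>x. G (rest \<omega>) x) \<in> borel_measurable borel" for \<omega>
    unfolding G_def
  proof (rule measurable_compose[OF measurable_restrict b])
    fix j assume "j \<in> {1..N}"
    then show "(\<lambda>x. if j = l then x else snd (rest \<omega> j)) \<in> borel_measurable borel"
      by (cases "j = l") auto
  qed
  have GB: "\<bar>G (rest \<omega>) x\<bar> \<le> B" if "\<omega> \<in> space M" "x \<in> S" for \<omega> x
    unfolding G_def using that X_S by (intro bB) (auto simp: rest_def)
  have l1: "1 \<le> l" using l by simp
  note ind = pair_indep_rest[OF l, folded rest_def]
  define a where "a z y = (if i = l then y else fst (z i))" for z :: "nat \<Rightarrow> real \<times> 'a" and y :: real
  have am: "(\<lambda>w. a (fst w) (fst (snd w))) \<in> borel_measurable (PiM ({1..N} - {l}) (\<lambda>_. obs_space) \<Otimes>\<^sub>M obs_space)"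
    unfolding a_def using i by (cases "i = l") auto
  define F where "F w = a (fst w) (fst (snd w)) * fst (snd w) * G (fst w) (snd (snd w))" for w
  have Fm: "F \<in> borel_measurable (PiM ({1..N} - {l}) (\<lambda>_. obs_space) \<Otimes>\<^sub>M obs_space)"
    unfolding F_def[abs_def] using Gm am by measurable
  have F_eq: "F (rest \<omega>, (Y l \<omega>, X l \<omega>)) = Y i \<omega> * Y l \<omega> * b (design N \<omega>)" for \<omega>
    using i by (auto simp: F_def a_def rest_design) (auto simp: rest_def)
  have "expectation (\<lambda>\<omega>. Y i \<omega> * Y l \<omega> * b (design N \<omega>)) =
     (\<integral>\<omega>. (\<integral>\<omega>'. F (rest \<omega>, (Y l \<omega>', X l \<omega>')) \<partial>M) \<partial>M)"
    using indep_pair_fubini(1)[OF ind Fm] int unfolding F_eq by simp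
  also have "\<dots> = (\<integral>\<omega>. (if i = l then \<sigma>^2 * (\<integral>\<omega>'. G (rest \<omega>) (X l \<omega>') \<partial>M) else 0) \<partial>M)"
  proof (intro Bochner_Integration.integral_cong refl)
    fix \<omega> assume \<omega>: "\<omega> \<in> space M"
    show "(\<integral>\<omega>'. F (rest \<omega>, (Y l \<omega>', X l \<omega>')) \<partial>M) = (if i = l then \<sigma>^2 * (\<integral>\<omega>'. G (rest \<omega>) (X l \<omega>') \<partial>M) else 0)"
    proof (cases "i = l")
      case True
      then show ?thesis using Y_square(2)[OF l1 Gl[of \<omega>] GB[OF \<omega>]] by (simp add: F_def a_def power2_eq_square)
    next
      case False
      then show ?thesis using eps_mean[OF l1 Gl[of \<omega>] GB[OF \<omega>]] by (simp add: F_def a_def mult.assoc)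
    qed
  qed
  also have "\<dots> = (if i = l then \<sigma>^2 * expectation (\<lambda>\<omega>. b (design N \<omega>)) else 0)"
    using indep_pair_fubini(1)[OF ind Gm] intb by (simp add: rest_design)
  finally show "expectation (\<lambda>\<omega>. Y i \<omega> * Y l \<omega> * b (design N \<omega>)) = (if i = l then \<sigma>^2 * expectation (\<lambda>\<omega>. b (design N \<omega>)) else 0)" .
qed

end

locale null_ridge =
  null_model M S p X Y \<epsilon> v \<sigma> \<tau> + ridge S "design_law S p" \<phi> c H ip \<mu> lam
  for M :: "'w measure" and S :: "'a::euclidean_space set" and p X Y \<epsilon> v \<sigma> \<tau> \<phi> c H ip \<mu> lam
begin

lemma integral_obs:
  fixes f :: "real \<times> 'a \<Rightarrow> real"
  assumes "f \<in> borel_measurable obs_space"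
  shows "(\<integral>z. f z \<partial>obs_law) = expectation (\<lambda>\<omega>. f (Y 1 \<omega>, X 1 \<omega>))"
  unfolding obs_law_def using assms pair_measurable[of 1] by (subst integral_distr) auto

text \<open>The factor \<open>r\<close> and the weights \<open>w\<close> stay general so that the
  family is closed under \<open>self_conv\<close>; \<open>r = 2\<close> with the shrinkage weights
  gives the kernel of W.\<close>

definition product_kernel :: "real \<Rightarrow> (nat \<Rightarrow> real) \<Rightarrow> real \<times> 'a \<Rightarrow> real \<times> 'a \<Rightarrow> real" where
  "product_kernel r w z z' = r * fst z * fst z' * kern w (snd z) (snd z')"

context
  fixes w :: "nat \<Rightarrow> real" and r :: real
  assumes w0: "\<And>i. 0 \<le> w (Suc i)" and w_sum: "summable (\<lambda>i. w (Suc i))" and w1: "\<And>i. w (Suc i) \<le> 1"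
begin

lemma square_nonneg: "0 \<le> w (Suc i) * w (Suc i)" and square_le: "w (Suc i) * w (Suc i) \<le> w (Suc i)"
  using w0[of i] w1[of i] by (auto simp: mult_left_le)

lemma square_summable: "summable (\<lambda>i. w (Suc i) * w (Suc i))"
  using square_nonneg square_le by (intro summable_comparison_test'[OF w_sum, of 0]) auto

lemma sum_nonneg: "0 \<le> (\<Sum>i. w (Suc i))"
  by (intro suminf_nonneg w0 w_sum)

lemma kern_fixed[measurable]: "kern w x \<in> borel_measurable borel"
  by (rule kern_measurable[OF w0 w_sum, of "\<lambda>_. x" borel "\<lambda>z. z"]) auto

lemma kern_pair[measurable (raw)]:
  assumes "f \<in> borel_measurable L" "g \<in> borel_measurable L"
  shows "(\<lambda>x. kern w (f x) (g x)) \<in> borel_measurable L"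
  by (rule kern_measurable[OF w0 w_sum assms])

lemma product_kernel_degenerate:
  "sample.degenerate (product_kernel r w) (\<lambda>z. sqrt (\<bar>r\<bar> * (c^2 * (\<Sum>i. w (Suc i)))) * \<bar>fst z\<bar>)"
  unfolding sample.degenerate_def
proof (intro conjI ballI)
  show "(\<lambda>(z, z'). product_kernel r w z z') \<in> borel_measurable (obs_space \<Otimes>\<^sub>M obs_space)"
    unfolding product_kernel_def by measurable
  show "(\<lambda>z. sqrt (\<bar>r\<bar> * (c^2 * (\<Sum>i. w (Suc i)))) * \<bar>fst z\<bar>) \<in> borel_measurable obs_space" by measurable
  have i4: "integrable obs_law (\<lambda>z. fst z ^ 4)"
    unfolding obs_law_def using L4_integrable(4)[OF Y_L4[of 1]] pair_measurable[of 1]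
    by (subst integrable_distr_eq) auto
  show "integrable obs_law (\<lambda>z. (sqrt (\<bar>r\<bar> * (c^2 * (\<Sum>i. w (Suc i)))) * \<bar>fst z\<bar>) ^ 4)"
    using i4 by (simp add: power_mult_distrib)
  show "product_kernel r w z z' = product_kernel r w z' z" for z z'
    by (simp add: product_kernel_def kern_sym[OF w0 w_sum, of "snd z"] mult_ac)
  show "\<bar>product_kernel r w z z'\<bar> \<le> sqrt (\<bar>r\<bar> * (c^2 * (\<Sum>i. w (Suc i)))) * \<bar>fst z\<bar> * (sqrt (\<bar>r\<bar> * (c^2 * (\<Sum>i. w (Suc i)))) * \<bar>fst z'\<bar>)" for z z'
  proof -
    have "\<bar>product_kernel r w z z'\<bar> = (\<bar>r\<bar> * \<bar>fst z\<bar> * \<bar>fst z'\<bar>) * \<bar>kern w (snd z) (snd z')\<bar>"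
      by (simp add: product_kernel_def abs_mult)
    also have "\<dots> \<le> (\<bar>r\<bar> * \<bar>fst z\<bar> * \<bar>fst z'\<bar>) * (c^2 * (\<Sum>i. w (Suc i)))"
      by (intro mult_left_mono kern_bound[OF w0 w_sum]) auto
    also have "\<dots> = (sqrt (\<bar>r\<bar> * (c^2 * (\<Sum>i. w (Suc i)))))^2 * \<bar>fst z\<bar> * \<bar>fst z'\<bar>"
      using sum_nonneg by simp
    finally show ?thesis by (simp only: power2_eq_square mult_ac)
  qed
  show "(\<integral>z'. product_kernel r w z z' \<partial>obs_law) = 0" for z
  proof -
    have "(\<integral>z'. product_kernel r w z z' \<partial>obs_law) = expectation (\<lambda>\<omega>. r * fst z * (Y 1 \<omega> * kern w (snd z) (X 1 \<omega>)))"
      unfolding product_kernel_def by (subst integral_obs) (auto simp: mult_ac)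
    also have "\<dots> = r * fst z * expectation (\<lambda>\<omega>. Y 1 \<omega> * kern w (snd z) (X 1 \<omega>))" by simp
    also have "\<dots> = 0" by (subst eps_mean[OF _ kern_fixed kern_bound[OF w0 w_sum]]) auto
    finally show ?thesis .
  qed
qed (use sum_nonneg in simp)

text \<open>Integrating out one observation turns the squared response into \<sigma>^2, which is
  where homoscedasticity keeps the family closed, and \<open>kern_conv\<close> squares the
  weights.\<close>

lemma self_conv_product_kernel:
  "sample.self_conv (product_kernel r w) = product_kernel (r^2 * \<sigma>^2) (\<lambda>i. w i * w i)"
proof (intro ext)
  fix z z' :: "real \<times> 'a"
  define g where "g x = kern w (snd z) x * kern w (snd z') x" for x
  have gm: "g \<in> borel_measurable borel" unfolding g_def by measurable
  have gb: "\<bar>g x\<bar> \<le> (c^2 * (\<Sum>i. w (Suc i))) * (c^2 * (\<Sum>i. w (Suc i)))" for x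
    unfolding g_def abs_mult using sum_nonneg by (intro mult_mono kern_bound[OF w0 w_sum]) auto
  have "sample.self_conv (product_kernel r w) z z' = expectation (\<lambda>\<omega>. (r^2 * fst z * fst z') * (Y 1 \<omega> ^ 2 * g (X 1 \<omega>)))"
    unfolding sample.self_conv_def product_kernel_def g_def
    by (subst integral_obs) (auto simp: mult_ac power2_eq_square)
  also have "\<dots> = (r^2 * fst z * fst z') * (\<sigma>^2 * expectation (\<lambda>\<omega>. g (X 1 \<omega>)))"
    using Y_square(2)[OF _ gm gb, of 1] by simp
  also have "expectation (\<lambda>\<omega>. g (X 1 \<omega>)) = kern (\<lambda>i. w i * w i) (snd z) (snd z')"
    unfolding integral_X[OF order_refl gm] unfolding g_def by (rule kern_conv[OF w0 w_sum w0 w_sum])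
  finally show "sample.self_conv (product_kernel r w) z z' = product_kernel (r^2 * \<sigma>^2) (\<lambda>i. w i * w i) z z'"
    unfolding product_kernel_def[of "r^2 * \<sigma>^2"] by (simp only: mult_ac)
qed

lemma kern_sq_diag[measurable]: "(\<lambda>x. kern (\<lambda>i. w i * w i) x x) \<in> borel_measurable borel"
  by (rule kern_measurable[of "\<lambda>i. w i * w i", OF square_nonneg square_summable]) auto

text \<open>The inner integral is the diagonal of \<open>self_conv\<close>; the outer one is a
  trace.\<close>

lemma second_moment_product_kernel:
  "sample.kernel_moment (product_kernel r w) 2 = r^2 * \<sigma>^4 * (\<Sum>i. w (Suc i) * w (Suc i))"
proof -
  have inner: "(\<integral>z'. product_kernel r w z z' ^ 2 \<partial>obs_law) = r^2 * \<sigma>^2 * (fst z ^ 2 * kern (\<lambda>i. w i * w i) (snd z) (snd z))" for z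
  proof -
    have "(\<integral>z'. product_kernel r w z z' ^ 2 \<partial>obs_law) = sample.self_conv (product_kernel r w) z z"
      by (simp only: sample.self_conv_def power2_eq_square)
    also have "\<dots> = r^2 * \<sigma>^2 * (fst z ^ 2 * kern (\<lambda>i. w i * w i) (snd z) (snd z))"
      unfolding self_conv_product_kernel by (simp add: product_kernel_def power2_eq_square)
    finally show ?thesis .
  qed
  have m: "(\<lambda>z. r^2 * \<sigma>^2 * (fst z ^ 2 * kern (\<lambda>i. w i * w i) (snd z) (snd z))) \<in> borel_measurable obs_space"
    using measurable_compose[OF measurable_snd kern_sq_diag, of borel] by measurable
  have "sample.kernel_moment (product_kernel r w) 2 = r^2 * \<sigma>^2 * expectation (\<lambda>\<omega>. Y 1 \<omega> ^ 2 * kern (\<lambda>i. w i * w i) (X 1 \<omega>) (X 1 \<omega>))"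
    unfolding sample.kernel_moment_def inner by (subst integral_obs[OF m]) simp
  also have "\<dots> = r^2 * \<sigma>^2 * (\<sigma>^2 * expectation (\<lambda>\<omega>. kern (\<lambda>i. w i * w i) (X 1 \<omega>) (X 1 \<omega>)))"
    using Y_square(2)[OF _ kern_sq_diag kern_bound[OF square_nonneg square_summable], of 1] by simp
  also have "expectation (\<lambda>\<omega>. kern (\<lambda>i. w i * w i) (X 1 \<omega>) (X 1 \<omega>)) = (\<Sum>i. w (Suc i) * w (Suc i))"
    unfolding integral_X[OF order_refl kern_sq_diag] by (rule kern_trace[OF square_nonneg square_summable])
  finally show ?thesis by (simp add: power2_eq_square power4_eq_xxxx)
qed

text \<open>Only two of the four kernel factors are bounded by the supremum \<open>b\<close>. The
  other two are integrated by \<open>kern_conv\<close> and leave one more \<open>b\<close>, which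
  gives the third power in place of the fourth.\<close>

lemma fourth_moment_product_kernel:
  "sample.kernel_moment (product_kernel r w) 4 \<le> r^4 * \<tau>^2 * (c^2 * (\<Sum>i. w (Suc i)))^3"
proof -
  define b where "b = c^2 * (\<Sum>i. w (Suc i))"
  have b0: "0 \<le> b" unfolding b_def using sum_nonneg by simp
  have inner: "(\<integral>z'. product_kernel r w z z' ^ 4 \<partial>obs_law) \<le> (r^4 * \<tau> * b^3) * fst z ^ 4" for z
  proof -
    define g where "g x = kern w (snd z) x ^ 4" for x
    have gm: "g \<in> borel_measurable borel" unfolding g_def by measurable
    have gk: "kern w (snd z) x ^ 4 \<le> b^2 * (kern w (snd z) x * kern w (snd z) x)" for x
    proof -
      have "\<bar>kern w (snd z) x\<bar> ^ 2 \<le> b ^ 2"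
        unfolding b_def by (intro power_mono kern_bound[OF w0 w_sum]) auto
      then have "(kern w (snd z) x)^2 * (kern w (snd z) x)^2 \<le> b^2 * (kern w (snd z) x)^2"
        by (intro mult_right_mono) auto
      then show ?thesis by (simp add: power2_eq_square power4_eq_xxxx mult_ac)
    qed
    have gb: "\<bar>g x\<bar> \<le> b^4" for x
      using power_mono[OF kern_bound[OF w0 w_sum, of "snd z" x], of 4] by (simp add: g_def b_def)
    have gkm: "(\<lambda>x. kern w (snd z) x * kern w (snd z) x) \<in> borel_measurable borel" by measurable
    have kb2: "\<bar>kern w (snd z) x * kern w (snd z) x\<bar> \<le> b * b" for x
      unfolding abs_mult b_def using sum_nonneg by (intro mult_mono kern_bound[OF w0 w_sum]) auto
    have Eg: "expectation (\<lambda>\<omega>. g (X 1 \<omega>)) \<le> b^3"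
    proof -
      have "expectation (\<lambda>\<omega>. g (X 1 \<omega>)) \<le> expectation (\<lambda>\<omega>. b^2 * (kern w (snd z) (X 1 \<omega>) * kern w (snd z) (X 1 \<omega>)))"
      using gX_integrable[OF _ gm gb, of 1] gX_integrable[OF _ gkm kb2, of 1] gk
      by (intro integral_mono) (auto simp: g_def)
    also have "\<dots> = b^2 * kern (\<lambda>i. w i * w i) (snd z) (snd z)"
      using integral_X[OF order_refl gkm] kern_conv[OF w0 w_sum w0 w_sum] by simp
    also have "\<dots> \<le> b^2 * b"
    proof (intro mult_left_mono)
      have "kern (\<lambda>i. w i * w i) (snd z) (snd z) \<le> c^2 * (\<Sum>i. w (Suc i) * w (Suc i))"
        using kern_bound[OF square_nonneg square_summable, of "snd z" "snd z"] by simp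
      also have "\<dots> \<le> b" unfolding b_def by (intro mult_left_mono suminf_le square_le square_summable w_sum) auto
      finally show "kern (\<lambda>i. w i * w i) (snd z) (snd z) \<le> b" .
    qed auto
      finally show ?thesis by (simp add: power2_eq_square power3_eq_cube)
    qed
    have "(\<integral>z'. product_kernel r w z z' ^ 4 \<partial>obs_law) = expectation (\<lambda>\<omega>. (r^4 * fst z ^ 4) * (Y 1 \<omega> ^ 4 * g (X 1 \<omega>)))"
      unfolding product_kernel_def g_def by (subst integral_obs) (auto simp: mult_ac power_mult_distrib)
    also have "\<dots> = (r^4 * fst z ^ 4) * expectation (\<lambda>\<omega>. Y 1 \<omega> ^ 4 * g (X 1 \<omega>))" by simp
    also have "\<dots> \<le> (r^4 * fst z ^ 4) * (\<tau> * expectation (\<lambda>\<omega>. g (X 1 \<omega>)))"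
      by (intro mult_left_mono Y_fourth(2)[OF _ gm gb]) (auto simp: g_def)
    also have "\<dots> \<le> (r^4 * fst z ^ 4) * (\<tau> * b^3)"
      using \<tau>_pos by (intro mult_left_mono Eg) auto
    finally show ?thesis by (simp only: mult_ac)
  qed
  have i4: "integrable obs_law (\<lambda>z. fst z ^ 4)"
    unfolding obs_law_def using L4_integrable(4)[OF Y_L4[of 1]] pair_measurable[of 1]
    by (subst integrable_distr_eq) auto
  have "sample.kernel_moment (product_kernel r w) 4 \<le> (\<integral>z. (r^4 * \<tau> * b^3) * fst z ^ 4 \<partial>obs_law)"
    unfolding sample.kernel_moment_def
    by (intro integral_mono inner integrable_mult_right i4 sample.integrable_fourth_moment[OF product_kernel_degenerate])
  also have "\<dots> = (r^4 * \<tau> * b^3) * expectation (\<lambda>\<omega>. Y 1 \<omega> ^ 4)"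
    using integral_obs[of "\<lambda>z. fst z ^ 4"] by simp
  also have "\<dots> \<le> (r^4 * \<tau> * b^3) * \<tau>"
    using \<tau>_pos b0 by (intro mult_left_mono Y_fourth_moment) auto
  finally show ?thesis by (simp add: b_def power2_eq_square mult_ac)
qed

end

text \<open>Pairs are regrouped by their larger index, which becomes the time of the
  martingale.\<close>

lemma W_stat_incr:
  assumes "\<omega> \<in> space M"
  shows "W_stat (K_kernel \<mu> \<phi> lam) N (\<lambda>i. X i \<omega>) (\<lambda>i. \<epsilon> i \<omega>) =
    (\<Sum>l<N. sample.incr (product_kernel 2 (shrinkage \<mu> lam)) l \<omega>)"
proof -
  have "W_stat (K_kernel \<mu> \<phi> lam) N (\<lambda>i. X i \<omega>) (\<lambda>i. \<epsilon> i \<omega>) =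
    (\<Sum>(l, i)\<in>Sigma {..<N} (\<lambda>l. {..<l}). product_kernel 2 (shrinkage \<mu> lam) (obs i \<omega>) (obs l \<omega>))"
    unfolding W_stat_def
    by (rule sum.reindex_bij_witness[of _ "\<lambda>(l, i). (Suc i, Suc l)" "\<lambda>(i, l). (l - 1, i - 1)"])
       (auto simp: product_kernel_def obs_def Y_eps assms K_kernel_def kern_def)
  also have "\<dots> = (\<Sum>l<N. sample.incr (product_kernel 2 (shrinkage \<mu> lam)) l \<omega>)"
    unfolding sample.incr_def by (rule sum.Sigma[symmetric]) auto
  finally show ?thesis .
qed

text \<open>Two effective dimensions: \<open>dim1\<close> is 1/h, the mean of K(X, X), and
  \<open>dim2\<close> is the second moment of K at independent covariates, which determines the
  variance of W.\<close>

abbreviation "dim1 \<equiv> \<Sum>i. shrinkage \<mu> lam (Suc i)"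
abbreviation "dim2 \<equiv> \<Sum>i. shrinkage \<mu> lam (Suc i) * shrinkage \<mu> lam (Suc i)"

definition W :: "nat \<Rightarrow> 'w \<Rightarrow> real" where
  "W N \<omega> = W_stat (K_kernel \<mu> \<phi> lam) N (\<lambda>i. X i \<omega>) (\<lambda>i. \<epsilon> i \<omega>)"

lemmas shrinkage_kernel_degenerate = product_kernel_degenerate[OF shrinkage_facts shrinkage_le1]

lemma W_cong: "\<omega> \<in> space M \<Longrightarrow> W N \<omega> = (\<Sum>l<N. sample.incr (product_kernel 2 (shrinkage \<mu> lam)) l \<omega>)"
  unfolding W_def by (rule W_stat_incr)

lemma W_L4: "L4 (W N)"
proof -
  note L = sample.ustat_moments(1)[OF shrinkage_kernel_degenerate[of 2], of N]
  have "W N \<in> borel_measurable M"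
    by (subst measurable_cong[OF W_cong]) (use L4_measurable[OF L] in auto)
  then show ?thesis by (rule L4_dominated[OF L]) (auto intro!: AE_I2 simp: W_cong)
qed

lemma W_variance: "variance (W N) = 2 * \<sigma>^4 * dim2 * real N * (real N - 1)"
proof -
  have e: "expectation (W N) = 0"
    using sample.ustat_moments(2)[OF shrinkage_kernel_degenerate[of 2], of N] by (subst Bochner_Integration.integral_cong[OF refl W_cong]) auto
  have "expectation (\<lambda>\<omega>. (W N \<omega>)^2) = sample.kernel_moment (product_kernel 2 (shrinkage \<mu> lam)) 2 * real N * (real N - 1) / 2"
    using sample.ustat_moments(3)[OF shrinkage_kernel_degenerate[of 2], of N]
    by (subst Bochner_Integration.integral_cong[OF refl, of _ _ "\<lambda>\<omega>. (\<Sum>l<N. sample.incr (product_kernel 2 (shrinkage \<mu> lam)) l \<omega>)^2"])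
       (auto simp: W_cong)
  then show ?thesis unfolding e second_moment_product_kernel[OF shrinkage_facts shrinkage_le1] by simp
qed

text \<open>An instance of \<open>char_ustat_bound\<close>. The second moment of the convolved
  kernel involves fourth powers of factors between 0 and 1, whose sum is at most
  \<open>dim1\<close>. For comparable \<open>dim1\<close> and \<open>dim2\<close> the two ratios
  behave like \<open>1 / dim1\<close> and \<open>dim1 / N\<close>.\<close>

lemma char_W_bound:
  assumes N: "2 \<le> N" and dim2: "0 < dim2"
  shows "cmod (expectation (\<lambda>\<omega>. iexp (t * (W N \<omega> / sqrt (variance (W N))))) - exp (- (t^2 / 2)))
    \<le> 13 / 3 * \<bar>t\<bar>^3 * sqrt (\<tau>^2 * c^6 * dim1^3 / (\<sigma>^8 * real N * dim2^2))
      + 2 * t^2 * sqrt (8 * (dim1 / dim2^2) + 2 * (\<tau>^2 * c^6 * dim1^3 / (\<sigma>^8 * real N * dim2^2))) + 2 * t^4 / real N"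
proof -
  define k where "k = product_kernel 2 (shrinkage \<mu> lam)"
  note deg2 = shrinkage_kernel_degenerate[of 2, folded k_def]
  have m2: "sample.kernel_moment k 2 = 4 * \<sigma>^4 * dim2"
    unfolding k_def second_moment_product_kernel[OF shrinkage_facts shrinkage_le1] by simp
  have \<sigma>4: "0 < \<sigma>^4" using zero_less_power[OF \<sigma>_pos, of 2] by simp
  have m2_pos: "0 < sample.kernel_moment k 2" unfolding m2 using \<sigma>4 dim2 by simp
  have m4: "sample.kernel_moment k 4 \<le> 16 * \<tau>^2 * (c^2 * dim1)^3"
    unfolding k_def using fourth_moment_product_kernel[OF shrinkage_facts shrinkage_le1, of 2] by simp
  have \<theta>: "sample.kernel_moment (sample.self_conv k) 2 \<le> 16 * \<sigma>^8 * dim1"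
  proof -
    define w where "w i = shrinkage \<mu> lam i * shrinkage \<mu> lam i" for i
    have w: "0 \<le> w (Suc i)" "w (Suc i) \<le> 1" "w (Suc i) \<le> shrinkage \<mu> lam (Suc i)" for i
      using square_nonneg[OF shrinkage_facts shrinkage_le1, of i] square_le[OF shrinkage_facts shrinkage_le1, of i] shrinkage_le1[of i] by (auto simp: w_def)
    have ws: "summable (\<lambda>i. w (Suc i))" unfolding w_def by (rule square_summable[OF shrinkage_facts shrinkage_le1])
    have "sample.kernel_moment (sample.self_conv k) 2 = (4 * \<sigma>^2)^2 * \<sigma>^4 * (\<Sum>i. w (Suc i) * w (Suc i))"
      unfolding k_def self_conv_product_kernel[OF shrinkage_facts shrinkage_le1]
      using second_moment_product_kernel[OF w(1) ws w(2), of "4 * \<sigma>^2"] by (simp add: w_def[abs_def])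
    also have "\<dots> \<le> (4 * \<sigma>^2)^2 * \<sigma>^4 * dim1"
    proof (intro mult_left_mono suminf_le square_summable[OF w(1) ws w(2)] shrinkage_summable)
      show "w (Suc i) * w (Suc i) \<le> shrinkage \<mu> lam (Suc i)" for i
        using square_le[OF w(1) ws w(2), of i] w(3)[of i] by linarith
    qed (use \<sigma>4 in auto)
    also have "(4 * \<sigma>^2)^2 * \<sigma>^4 = 16 * \<sigma>^8"
      by (simp add: power_mult_distrib flip: power_mult power_add)
    finally show ?thesis .
  qed
  have m2sq: "(4 * \<sigma>^4 * dim2)^2 = 16 * \<sigma>^8 * dim2^2"
    by (simp add: power_mult_distrib flip: power_mult)
  have \<sigma>8: "0 < \<sigma>^8" using zero_less_power[OF \<sigma>4, of 2] by (simp flip: power_mult)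
  have \<rho>: "sample.kernel_moment k 4 / (real N * (sample.kernel_moment k 2)^2) \<le> \<tau>^2 * c^6 * dim1^3 / (\<sigma>^8 * real N * dim2^2)"
  proof -
    have "sample.kernel_moment k 4 / (real N * (sample.kernel_moment k 2)^2) \<le> 16 * \<tau>^2 * (c^2 * dim1)^3 / (real N * (16 * \<sigma>^8 * dim2^2))"
      unfolding m2 m2sq using m4 by (intro divide_right_mono) auto
    also have "\<dots> = 16 * (\<tau>^2 * c^6 * dim1^3) / (16 * (\<sigma>^8 * real N * dim2^2))"
      by (simp add: power_mult_distrib mult_ac flip: power_mult)
    also have "\<dots> = \<tau>^2 * c^6 * dim1^3 / (\<sigma>^8 * real N * dim2^2)"
      by (rule mult_divide_mult_cancel_left) simp
    finally show ?thesis .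
  qed
  have q2: "sample.kernel_moment (sample.self_conv k) 2 / (sample.kernel_moment k 2)^2 \<le> dim1 / dim2^2"
  proof -
    have "sample.kernel_moment (sample.self_conv k) 2 / (sample.kernel_moment k 2)^2 \<le> 16 * \<sigma>^8 * dim1 / (16 * \<sigma>^8 * dim2^2)"
      unfolding m2 m2sq using \<theta> by (intro divide_right_mono) auto
    also have "\<dots> = dim1 / dim2^2" using \<sigma>8 by simp
    finally show ?thesis .
  qed
  have s: "sqrt (sample.kernel_moment k 2 * real N * (real N - 1) / 2) = sqrt (variance (W N))"
    unfolding W_variance m2 by simp
  have "expectation (\<lambda>\<omega>. iexp (t * (W N \<omega> / sqrt (variance (W N))))) =
      expectation (\<lambda>\<omega>. iexp (t * ((\<Sum>l<N. sample.incr k l \<omega>) / sqrt (variance (W N)))))"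
    by (intro Bochner_Integration.integral_cong refl) (simp only: W_cong k_def)
  then have "cmod (expectation (\<lambda>\<omega>. iexp (t * (W N \<omega> / sqrt (variance (W N))))) - exp (- (t^2 / 2)))
    \<le> 13 / 3 * \<bar>t\<bar>^3 * sqrt (sample.kernel_moment k 4 / (real N * (sample.kernel_moment k 2)^2))
      + 2 * t^2 * sqrt (8 * sample.kernel_moment (sample.self_conv k) 2 / (sample.kernel_moment k 2)^2
          + 2 * (sample.kernel_moment k 4 / (real N * (sample.kernel_moment k 2)^2))) + 2 * t^4 / real N"
    using sample.char_ustat_bound[OF deg2 N m2_pos, of t] unfolding s by simp
  also have "\<dots> \<le> 13 / 3 * \<bar>t\<bar>^3 * sqrt (\<tau>^2 * c^6 * dim1^3 / (\<sigma>^8 * real N * dim2^2))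
      + 2 * t^2 * sqrt (8 * (dim1 / dim2^2) + 2 * (\<tau>^2 * c^6 * dim1^3 / (\<sigma>^8 * real N * dim2^2))) + 2 * t^4 / real N"
    using \<rho> q2 by (intro add_mono mult_left_mono real_sqrt_le_mono) auto
  finally show ?thesis .
qed

end

section \<open>The remainder\<close>

lemma sum_square_split:
  fixes f :: "nat \<Rightarrow> nat \<Rightarrow> real"
  assumes "\<And>i l. f i l = f l i"
  shows "(\<Sum>i=1..N. \<Sum>l=1..N. f i l) = (\<Sum>i=1..N. f i i) + (\<Sum>l<N. \<Sum>i<l. 2 * f (Suc i) (Suc l))"
proof (induction N)
  case (Suc N)
  have "(\<Sum>i=1..N. f i (Suc N)) = (\<Sum>i<N. f (Suc i) (Suc N))"
    by (rule sum.reindex_bij_witness[of _ Suc "\<lambda>i. i - 1"]) auto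
  moreover have "(\<Sum>l=1..N. f (Suc N) l) = (\<Sum>i=1..N. f i (Suc N))"
    by (intro sum.cong refl assms)
  ultimately show ?case using Suc by (simp add: sum.distrib sum_distrib_left)
qed simp

section \<open>Linearisation error for a fixed division\<close>

definition division :: "nat \<Rightarrow> nat \<Rightarrow> nat \<Rightarrow> (nat \<Rightarrow> nat set) \<Rightarrow> bool" where
  "division N s n d \<longleftrightarrow> disjoint_family_on d {1..s} \<and> (\<Union>j\<in>{1..s}. d j) = {1..N} \<and> (\<forall>j\<in>{1..s}. card (d j) = n)"

text \<open>A union in place of a choice of \<open>j\<close>: it makes sense for every family of
  subsets of \<open>{1..N}\<close>, the generality in which measurability is proved, and equals
  \<open>d j\<close> for a division.\<close>

definition block :: "nat \<Rightarrow> (nat \<Rightarrow> nat set) \<Rightarrow> nat \<Rightarrow> nat set" where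
  "block s d i = (\<Union>j\<in>{j\<in>{1..s}. i \<in> d j}. d j)"

lemma block_subset: "(\<And>j. j \<in> {1..s} \<Longrightarrow> d j \<subseteq> {1..N}) \<Longrightarrow> block s d i \<subseteq> {1..N}"
  by (auto simp: block_def)

lemma block_finite: "(\<And>j. j \<in> {1..s} \<Longrightarrow> d j \<subseteq> {1..N}) \<Longrightarrow> finite (block s d i)"
  by (rule finite_subset[OF block_subset]) auto

lemma block_eq:
  assumes "division N s n d" "j \<in> {1..s}" "i \<in> d j"
  shows "block s d i = d j"
proof -
  have "j' = j" if "j' \<in> {1..s}" "i \<in> d j'" for j'
    using assms that unfolding division_def disjoint_family_on_def by blast
  then have "{j\<in>{1..s}. i \<in> d j} = {j}" using assms by blast
  then show ?thesis by (simp add: block_def)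
qed

lemma division_subset: "division N s n d \<Longrightarrow> j \<in> {1..s} \<Longrightarrow> d j \<subseteq> {1..N}"
  unfolding division_def by blast

lemma division_ex: "division N s n d \<Longrightarrow> i \<in> {1..N} \<Longrightarrow> \<exists>j\<in>{1..s}. i \<in> d j \<and> block s d i = d j"
  using block_eq unfolding division_def by blast

context null_ridge
begin

definition rep :: "nat \<Rightarrow> (nat \<Rightarrow> nat set) \<Rightarrow> (nat \<Rightarrow> 'a) \<Rightarrow> nat \<Rightarrow> 'a \<Rightarrow> real" where
  "rep s d x i = sres (block s d i) x (x i)"

text \<open>On a division this is the penalised inner product of two representers, rewritten by
  \<open>pen_sres\<close>. In this form it consists of explicit kernels, finite sums and one
  integral over the design law, all measurable in the sample, whereas nothing is known about the
  measurability of \<open>ip\<close>.\<close>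

definition gram :: "nat \<Rightarrow> (nat \<Rightarrow> nat set) \<Rightarrow> (nat \<Rightarrow> 'a) \<Rightarrow> nat \<Rightarrow> nat \<Rightarrow> real" where
  "gram s d x i l = V_form (design_law S p) (rep s d x i) (rep s d x l) + rep s d x i (x l)
     - empirical_mean (block s d l) x (\<lambda>z. rep s d x i z * rep s d x l z)"

text \<open>The same for the differences from the sections of \<open>Kern\<close>, with the mixed
  terms evaluated by the reproducing property.\<close>

definition err_gram :: "nat \<Rightarrow> (nat \<Rightarrow> nat set) \<Rightarrow> (nat \<Rightarrow> 'a) \<Rightarrow> nat \<Rightarrow> nat \<Rightarrow> real" where
  "err_gram s d x i l = gram s d x i l - rep s d x i (x l) - rep s d x l (x i) + Kern (x i) (x l)"

definition err :: "nat \<Rightarrow> nat \<Rightarrow> (nat \<Rightarrow> nat set) \<Rightarrow> (nat \<Rightarrow> 'a) \<Rightarrow> (nat \<Rightarrow> real) \<Rightarrow> real" where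
  "err N s d x y = (\<Sum>i=1..N. \<Sum>l=1..N. (y i / real N) * (y l / real N) * err_gram s d x i l)"

text \<open>Given the design and the division, \<open>err\<close> has mean \<open>\<sigma>\<^sup>2 * dispersion / N\<close>.\<close>

definition dispersion :: "nat \<Rightarrow> nat \<Rightarrow> (nat \<Rightarrow> nat set) \<Rightarrow> (nat \<Rightarrow> 'a) \<Rightarrow> real" where
  "dispersion N s d x = (\<Sum>i=1..N. err_gram s d x i i) / real N"

lemma rep_measurable:
  assumes x: "\<And>i. i \<in> {1..N} \<Longrightarrow> x i \<in> borel_measurable L" and d: "\<And>j. j \<in> {1..s} \<Longrightarrow> d j \<subseteq> {1..N}"
    and i: "i \<in> {1..N}" and u: "u \<in> borel_measurable L"
  shows "(\<lambda>\<omega>. rep s d (\<lambda>i. x i \<omega>) i (u \<omega>)) \<in> borel_measurable L"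
  unfolding rep_def sres_def points_def
proof (rule measurable_resolvent[OF kern_measurable[of \<mu>, OF \<mu>_nonneg \<mu>_sum]])
  fix j assume "j \<in> set (sorted_list_of_set (block s d i))"
  then have "j \<in> {1..N}" using block_finite[of s d N i, OF d] block_subset[of s d N i, OF d] by auto
  then show "x j \<in> borel_measurable L" by (rule x)
qed (use x i u in auto)

lemma gram_measurable:
  assumes x: "\<And>i. i \<in> {1..N} \<Longrightarrow> x i \<in> borel_measurable L" and d: "\<And>j. j \<in> {1..s} \<Longrightarrow> d j \<subseteq> {1..N}"
    and i: "i \<in> {1..N}" and l: "l \<in> {1..N}"
  shows "(\<lambda>\<omega>. gram s d (\<lambda>i. x i \<omega>) i l) \<in> borel_measurable L"
proof -
  have x': "(\<lambda>w. x j (fst w)) \<in> borel_measurable (L \<Otimes>\<^sub>M design_law S p)" if "j \<in> {1..N}" for j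
    using x[OF that] by measurable
  have r: "(\<lambda>w. rep s d (\<lambda>i. x i (fst w)) j (snd w)) \<in> borel_measurable (L \<Otimes>\<^sub>M design_law S p)" if "j \<in> {1..N}" for j
    by (rule rep_measurable[OF x' d that]) (use measurable_compose[OF measurable_snd id_Q] in auto)
  have V: "(\<lambda>\<omega>. V_form (design_law S p) (rep s d (\<lambda>i. x i \<omega>) i) (rep s d (\<lambda>i. x i \<omega>) l)) \<in> borel_measurable L"
    unfolding V_form_def
  proof (rule Q.borel_measurable_lebesgue_integral)
    show "(\<lambda>(\<omega>, z). rep s d (\<lambda>i. x i \<omega>) i z * rep s d (\<lambda>i. x i \<omega>) l z) \<in> borel_measurable (L \<Otimes>\<^sub>M design_law S p)"
      using borel_measurable_times[OF r[OF i] r[OF l]] by (simp add: split_beta')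
  qed
  have e: "(\<lambda>\<omega>. rep s d (\<lambda>i. x i \<omega>) i (x j \<omega>)) \<in> borel_measurable L" if "i \<in> {1..N}" "j \<in> {1..N}" for i j
    by (rule rep_measurable[OF x d that(1) x[OF that(2)]])
  have em: "(\<lambda>\<omega>. empirical_mean (block s d l) (\<lambda>i. x i \<omega>) (\<lambda>z. rep s d (\<lambda>i. x i \<omega>) i z * rep s d (\<lambda>i. x i \<omega>) l z)) \<in> borel_measurable L"
    unfolding empirical_mean_def using block_subset[of s d N l, OF d] i l
    by (intro borel_measurable_divide borel_measurable_sum borel_measurable_times e borel_measurable_const) auto
  show ?thesis unfolding gram_def
    by (intro borel_measurable_add borel_measurable_diff V em e i l)
qed

lemma err_gram_measurable:
  assumes x: "\<And>i. i \<in> {1..N} \<Longrightarrow> x i \<in> borel_measurable L" and d: "\<And>j. j \<in> {1..s} \<Longrightarrow> d j \<subseteq> {1..N}"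
    and i: "i \<in> {1..N}" and l: "l \<in> {1..N}"
  shows "(\<lambda>\<omega>. err_gram s d (\<lambda>i. x i \<omega>) i l) \<in> borel_measurable L"
  unfolding err_gram_def Kern_def
  using kern_measurable[of "shrinkage \<mu> lam", OF shrinkage_facts x[OF i] x[OF l]]
  by (intro borel_measurable_add borel_measurable_diff gram_measurable[OF x d] rep_measurable[OF x d] x i l)

lemma dispersion_measurable:
  assumes x: "\<And>i. i \<in> {1..N} \<Longrightarrow> x i \<in> borel_measurable L" and d: "\<And>j. j \<in> {1..s} \<Longrightarrow> d j \<subseteq> {1..N}"
  shows "(\<lambda>\<omega>. dispersion N s d (\<lambda>i. x i \<omega>)) \<in> borel_measurable L"
  unfolding dispersion_def
  by (intro borel_measurable_divide borel_measurable_sum err_gram_measurable[OF x d] borel_measurable_const) auto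

lemma err_measurable:
  assumes x: "\<And>i. i \<in> {1..N} \<Longrightarrow> x i \<in> borel_measurable L" and d: "\<And>j. j \<in> {1..s} \<Longrightarrow> d j \<subseteq> {1..N}"
    and y: "\<And>i. i \<in> {1..N} \<Longrightarrow> y i \<in> borel_measurable L"
  shows "(\<lambda>\<omega>. err N s d (\<lambda>i. x i \<omega>) (\<lambda>i. y i \<omega>)) \<in> borel_measurable L"
  unfolding err_def
  by (intro borel_measurable_sum borel_measurable_times borel_measurable_divide err_gram_measurable[OF x d] y borel_measurable_const) auto

text \<open>For passing between the full sequence of covariates and its restriction to
  \<open>{1..N}\<close>, which is an element of the product space.\<close>

lemma err_gram_cong:
  assumes xx: "\<And>i. i \<in> {1..N} \<Longrightarrow> x i = x' i" and d: "\<And>j. j \<in> {1..s} \<Longrightarrow> d j \<subseteq> {1..N}"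
    and "i \<in> {1..N}" "l \<in> {1..N}"
  shows "err_gram s d x i l = err_gram s d x' i l"
proof -
  have r: "rep s d x i = rep s d x' i" if "i \<in> {1..N}" for i
  proof -
    have "points (block s d i) x = points (block s d i) x'"
      unfolding points_def using block_finite[of s d N i, OF d] block_subset[of s d N i, OF d] xx
      by (intro map_cong) auto
    then show ?thesis unfolding rep_def sres_def using xx[OF that] by simp
  qed
  have em: "empirical_mean (block s d l) x f = empirical_mean (block s d l) x' f" for f
    unfolding empirical_mean_def using block_subset[of s d N l, OF d] xx
    by (intro arg_cong2[of _ _ _ _ "(/)"] sum.cong refl) auto
  show ?thesis unfolding err_gram_def gram_def em using r xx assms by simp
qed

context
  fixes N s n :: nat and d :: "nat \<Rightarrow> nat set" and x :: "nat \<Rightarrow> 'a"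
  assumes d: "division N s n d" and Nns: "N = n * s" and xS: "\<And>i. i \<in> {1..N} \<Longrightarrow> x i \<in> S"
begin

lemma block_props: "finite (block s d i)" "j \<in> block s d i \<Longrightarrow> x j \<in> S"
  using block_finite[of s d N i, OF division_subset[OF d]] block_subset[of s d N i, OF division_subset[OF d]] xS by auto

lemma rep_mem: "i \<in> {1..N} \<Longrightarrow> rep s d x i \<in> H"
  unfolding rep_def by (rule sres_mem[OF block_props xS])

lemma K_mem: "i \<in> {1..N} \<Longrightarrow> Kern (x i) \<in> H"
  by (rule Kern_mem_reproducing(1)[OF xS])

lemma gram_eq:
  assumes "i \<in> {1..N}" "l \<in> {1..N}" shows "gram s d x i l = pen (rep s d x i) (rep s d x l)"
  unfolding gram_def rep_def[of s d x l] using pen_sres[OF block_props xS[OF assms(2)] rep_mem[OF assms(1)], of l] by simp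

lemma err_gram_eq:
  assumes "i \<in> {1..N}" "l \<in> {1..N}"
  shows "err_gram s d x i l = pen (\<lambda>z. rep s d x i z - Kern (x i) z) (\<lambda>z. rep s d x l z - Kern (x l) z)"
proof -
  note m = rep_mem[OF assms(1)] rep_mem[OF assms(2)] K_mem[OF assms(1)] K_mem[OF assms(2)]
  have "pen (\<lambda>z. rep s d x i z - Kern (x i) z) (\<lambda>z. rep s d x l z - Kern (x l) z) =
    pen (rep s d x i) (rep s d x l) - pen (rep s d x i) (Kern (x l)) - (pen (Kern (x i)) (rep s d x l) - pen (Kern (x i)) (Kern (x l)))"
    using m by (simp add: pen.diff_left pen.diff_right pen.diff_mem)
  also have "pen (rep s d x i) (Kern (x l)) = rep s d x i (x l)"
    by (rule Kern_mem_reproducing(2)[OF xS m(1)]) fact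
  also have "pen (Kern (x i)) (rep s d x l) = rep s d x l (x i)"
    unfolding pen.sym[OF m(3,2)] by (rule Kern_mem_reproducing(2)[OF xS m(2)]) fact
  also have "pen (Kern (x i)) (Kern (x l)) = Kern (x i) (x l)"
    by (rule Kern_mem_reproducing(2)[OF xS m(3)]) fact
  finally show ?thesis unfolding err_gram_def gram_eq[OF assms] by simp
qed

lemma err_gram_diag_nonneg: "i \<in> {1..N} \<Longrightarrow> 0 \<le> err_gram s d x i i"
  unfolding err_gram_eq by (intro pen.nonneg pen.diff_mem rep_mem K_mem)

text \<open>A crude bound that serves to make the weights bounded: a nonnegative diagonal entry is
  at most the sum of all of them, and Cauchy-Schwarz covers the off-diagonal ones.\<close>

lemma err_gram_bound:
  assumes "dispersion N s d x \<le> \<delta>" "i \<in> {1..N}" "l \<in> {1..N}"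
  shows "\<bar>err_gram s d x i l\<bar> \<le> real N * \<delta>"
proof -
  have N0: "real N > 0" using assms(2) by auto
  have tot: "(\<Sum>i=1..N. err_gram s d x i i) \<le> real N * \<delta>"
    using assms(1) N0 by (simp add: dispersion_def field_simps)
  have diag: "err_gram s d x i i \<le> real N * \<delta>" if "i \<in> {1..N}" for i
  proof -
    have "err_gram s d x i i \<le> (\<Sum>i=1..N. err_gram s d x i i)"
      using that err_gram_diag_nonneg by (intro member_le_sum) auto
    then show ?thesis using tot by linarith
  qed
  have nonneg: "0 \<le> real N * \<delta>"
    using err_gram_diag_nonneg[OF assms(2)] diag[OF assms(2)] by linarith
  have "\<bar>err_gram s d x i l\<bar> \<le> sqrt (err_gram s d x i i) * sqrt (err_gram s d x l l)"
    unfolding err_gram_eq[OF assms(2,3)] err_gram_eq[OF assms(2,2)] err_gram_eq[OF assms(3,3)]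
    by (intro pen.cauchy_schwarz pen.diff_mem rep_mem K_mem assms)
  also have "\<dots> \<le> sqrt (real N * \<delta>) * sqrt (real N * \<delta>)"
    using diag assms err_gram_diag_nonneg nonneg by (intro mult_mono real_sqrt_le_mono) auto
  also have "\<dots> = real N * \<delta>"
    using nonneg by simp
  finally show ?thesis .
qed

lemma averaged_estimator_eq:
  "averaged_estimator H ip lam s d x y = (\<lambda>z. \<Sum>i=1..N. (y i / real N) * rep s d x i z)"
proof
  fix z
  have fin: "finite (d j)" if "j \<in> {1..s}" for j using division_subset[OF d that] by (rule finite_subset) simp
  have "averaged_estimator H ip lam s d x y z = 1 / real s * (\<Sum>j=1..s. \<Sum>i\<in>d j. (y i / real (card (d j))) * sres (d j) x (x i) z)"
    unfolding averaged_estimator_def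
    using fin division_subset[OF d] xS
    by (intro arg_cong2[of _ _ _ _ "(*)"] refl sum.cong refl) (subst ridge_estimator_eq; force)
  also have "\<dots> = 1 / real s * (\<Sum>j=1..s. \<Sum>i\<in>d j. (y i / real n) * rep s d x i z)"
    using block_eq[OF d] d by (intro arg_cong2[of _ _ _ _ "(*)"] refl sum.cong refl) (auto simp: rep_def division_def)
  also have "\<dots> = (\<Sum>j=1..s. \<Sum>i\<in>d j. (y i / real N) * rep s d x i z)"
    by (simp add: sum_distrib_left Nns mult_ac)
  also have "\<dots> = (\<Sum>i\<in>(\<Union>j\<in>{1..s}. d j). (y i / real N) * rep s d x i z)"
    using d fin unfolding division_def by (intro sum.UNION_disjoint_family[symmetric]) auto
  also have "(\<Union>j\<in>{1..s}. d j) = {1..N}" using d by (simp add: division_def)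
  finally show "averaged_estimator H ip lam s d x y z = (\<Sum>i=1..N. (y i / real N) * rep s d x i z)" .
qed

lemma T_stat_gram:
  "T_stat (design_law S p) H ip lam s d x y = (\<Sum>i=1..N. \<Sum>l=1..N. (y i / real N) * (y l / real N) * gram s d x i l)"
proof -
  define f where "f = (\<lambda>z. \<Sum>i=1..N. (y i / real N) * rep s d x i z)"
  have f: "f \<in> H" unfolding f_def by (intro pen.sum_mem rep_mem) auto
  have "T_stat (design_law S p) H ip lam s d x y = pen f f"
    unfolding T_stat_def averaged_estimator_eq pen_norm_def f_def[symmetric] using pen.nonneg[OF f] by simp
  also have "\<dots> = (\<Sum>i=1..N. (y i / real N) * pen (rep s d x i) f)"
    by (subst (1) f_def) (intro pen.sum_left rep_mem f, auto)
  also have "\<dots> = (\<Sum>i=1..N. (y i / real N) * (\<Sum>l=1..N. (y l / real N) * pen (rep s d x i) (rep s d x l)))"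
    unfolding f_def by (intro sum.cong refl arg_cong2[of _ _ _ _ "(*)"] pen.sum_right rep_mem) auto
  finally show ?thesis by (simp add: gram_eq sum_distrib_left mult.assoc)
qed

text \<open>The averaged estimator is \<open>f + g\<close>, with \<open>f\<close> the linear part
  built from \<open>Kern\<close> and \<open>g\<close> the error; the double sum and
  \<open>err\<close> are their squared norms. The weight \<theta> splits the cross term and is
  balanced in \<open>char_T_bound\<close>.\<close>

lemma err_nonneg: "0 \<le> err N s d x y"
  and Kern_form_nonneg: "0 \<le> (\<Sum>i=1..N. \<Sum>l=1..N. (y i / real N) * (y l / real N) * Kern (x i) (x l))"
  and T_stat_close: "\<theta> > 0 \<Longrightarrow> \<bar>T_stat (design_law S p) H ip lam s d x y
       - (\<Sum>i=1..N. \<Sum>l=1..N. (y i / real N) * (y l / real N) * Kern (x i) (x l))\<bar>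
     \<le> \<theta> * (\<Sum>i=1..N. \<Sum>l=1..N. (y i / real N) * (y l / real N) * Kern (x i) (x l)) + (1 / \<theta> + 1) * err N s d x y"
proof -
  define f g where "f = (\<lambda>z. \<Sum>i=1..N. (y i / real N) * Kern (x i) z)"
    and "g = (\<lambda>z. \<Sum>i=1..N. (y i / real N) * (rep s d x i z - Kern (x i) z))"
  have m: "(\<lambda>z. rep s d x i z - Kern (x i) z) \<in> H" if "i \<in> {1..N}" for i
    by (intro pen.diff_mem rep_mem K_mem that)
  have f: "f \<in> H" unfolding f_def by (intro pen.sum_mem K_mem) auto
  have g: "g \<in> H" unfolding g_def by (intro pen.sum_mem m) auto
  have ff: "pen f f = (\<Sum>i=1..N. \<Sum>l=1..N. (y i / real N) * (y l / real N) * Kern (x i) (x l))"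
  proof -
    have "pen f f = (\<Sum>i=1..N. (y i / real N) * pen (Kern (x i)) f)"
      by (subst (1) f_def) (intro pen.sum_left K_mem f, auto)
    also have "\<dots> = (\<Sum>i=1..N. (y i / real N) * (\<Sum>l=1..N. (y l / real N) * pen (Kern (x i)) (Kern (x l))))"
      unfolding f_def by (intro sum.cong refl arg_cong2[of _ _ _ _ "(*)"] pen.sum_right K_mem) auto
    also have "\<dots> = (\<Sum>i=1..N. (y i / real N) * (\<Sum>l=1..N. (y l / real N) * Kern (x i) (x l)))"
      by (intro sum.cong refl arg_cong2[of _ _ _ _ "(*)"] Kern_mem_reproducing(2) xS K_mem)
    finally show ?thesis by (simp add: sum_distrib_left mult.assoc)
  qed
  have gg: "pen g g = err N s d x y"
  proof -
    have "pen g g = (\<Sum>i=1..N. (y i / real N) * pen (\<lambda>z. rep s d x i z - Kern (x i) z) g)"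
      by (subst (1) g_def) (intro pen.sum_left m g, auto)
    also have "\<dots> = (\<Sum>i=1..N. (y i / real N) * (\<Sum>l=1..N. (y l / real N) * pen (\<lambda>z. rep s d x i z - Kern (x i) z) (\<lambda>z. rep s d x l z - Kern (x l) z)))"
      unfolding g_def by (intro sum.cong refl arg_cong2[of _ _ _ _ "(*)"] pen.sum_right m) auto
    finally show ?thesis unfolding err_def by (simp add: err_gram_eq sum_distrib_left mult.assoc)
  qed
  show "0 \<le> err N s d x y" using pen.nonneg[OF g] gg by simp
  show "0 \<le> (\<Sum>i=1..N. \<Sum>l=1..N. (y i / real N) * (y l / real N) * Kern (x i) (x l))"
    using pen.nonneg[OF f] ff by simp
  have fg: "(\<lambda>z. \<Sum>i=1..N. (y i / real N) * rep s d x i z) = (\<lambda>z. f z + g z)"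
    unfolding f_def g_def by (simp add: sum.distrib[symmetric] algebra_simps)
  have T: "T_stat (design_law S p) H ip lam s d x y = pen f f + 2 * pen f g + pen g g"
    unfolding T_stat_def averaged_estimator_eq pen_norm_def fg
    using pen.nonneg[OF pen.add_mem[OF f g]] pen.square_add[OF f g] by simp
  assume \<theta>: "\<theta> > 0"
  have "\<bar>pen f g\<bar> \<le> sqrt (pen f f) * sqrt (pen g g)" by (rule pen.cauchy_schwarz[OF f g])
  also have "2 * (sqrt (pen f f) * sqrt (pen g g)) \<le> \<theta> * pen f f + pen g g / \<theta>"
  proof -
    define u w where "u = sqrt (pen f f)" and "w = sqrt (pen g g)"
    have "0 \<le> (\<theta> * u - w)^2 / \<theta>" using \<theta> by simp
    also have "\<dots> = \<theta> * u^2 + w^2 / \<theta> - 2 * (u * w)"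
      using \<theta> by (simp add: field_simps power2_eq_square)
    finally show ?thesis using pen.nonneg f g by (simp add: u_def w_def)
  qed
  finally have "2 * \<bar>pen f g\<bar> \<le> \<theta> * pen f f + pen g g / \<theta>" by simp
  moreover have "\<bar>2 * pen f g + pen g g\<bar> \<le> 2 * \<bar>pen f g\<bar> + pen g g" using pen.nonneg[OF g] by linarith
  ultimately show "\<bar>T_stat (design_law S p) H ip lam s d x y
       - (\<Sum>i=1..N. \<Sum>l=1..N. (y i / real N) * (y l / real N) * Kern (x i) (x l))\<bar>
     \<le> \<theta> * (\<Sum>i=1..N. \<Sum>l=1..N. (y i / real N) * (y l / real N) * Kern (x i) (x l)) + (1 / \<theta> + 1) * err N s d x y"
    unfolding T ff[symmetric] gg[symmetric] by (simp add: distrib_right)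
qed

text \<open>The 4 comes from \<open>sres_close\<close>, and \<open>c\<^sup>2 * dim1\<close> bounds
  the diagonal of \<open>Kern\<close>.\<close>

lemma dispersion_le:
  assumes xi: "\<And>j. j \<in> {1..s} \<Longrightarrow> xi_sup (design_law S p) H ip lam (d j) x \<le> r" and r: "0 \<le> r" "r \<le> 1/2"
    and \<delta>: "4 * c^2 * dim1 * r^2 \<le> \<delta>" and N: "1 \<le> N"
  shows "dispersion N s d x \<le> \<delta>"
proof -
  have "err_gram s d x i i \<le> \<delta>" if i: "i \<in> {1..N}" for i
  proof -
    obtain j where j: "j \<in> {1..s}" "i \<in> d j" "block s d i = d j" using division_ex[OF d i] by blast
    have "err_gram s d x i i \<le> 4 * r^2 * Kern (x i) (x i)"
      unfolding err_gram_eq[OF i i] rep_def j(3) using division_subset[OF d j(1)] xS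
      by (intro sres_close xi r xS i j) (auto intro: finite_subset)
    also have "\<dots> \<le> 4 * r^2 * (c^2 * dim1)"
      using kern_bound[OF shrinkage_facts, of "x i" "x i"] unfolding Kern_def by (intro mult_left_mono) auto
    also have "\<dots> \<le> \<delta>" using \<delta> by (simp only: mult_ac)
    finally show ?thesis .
  qed
  then have "(\<Sum>i=1..N. err_gram s d x i i) \<le> (\<Sum>i=1..N. \<delta>)" by (intro sum_mono)
  then show ?thesis using N by (simp add: dispersion_def field_simps)
qed

end

end

text \<open>The complex phase is Lipschitz with constant \<open>\<bar>t\<bar>\<close> and of modulus
  1, so closeness in mean is needed on \<open>G\<close> only, and the complement costs twice its
  probability.\<close>

lemma (in prob_space) char_close:
  fixes A B :: "'a \<Rightarrow> real"
  assumes A[measurable]: "A \<in> borel_measurable M" and B[measurable]: "B \<in> borel_measurable M"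
    and G[measurable]: "G \<in> events"
    and close: "(\<integral>\<^sup>+\<omega>. ennreal (indicator G \<omega> * \<bar>A \<omega> - B \<omega>\<bar>) \<partial>M) \<le> ennreal K" and K: "0 \<le> K"
    and q: "prob (space M - G) \<le> q"
  shows "cmod (expectation (\<lambda>\<omega>. iexp (t * A \<omega>)) - expectation (\<lambda>\<omega>. iexp (t * B \<omega>))) \<le> \<bar>t\<bar> * K + 2 * q"
proof -
  have lip: "cmod (iexp a - iexp b) \<le> \<bar>a - b\<bar>" for a b
  proof -
    have "iexp a = iexp b * iexp (a - b)" by (simp add: exp_add[symmetric] algebra_simps)
    then have "iexp a - iexp b = iexp b * (iexp (a - b) - 1)" by (simp add: right_diff_distrib)
    then have "cmod (iexp a - iexp b) = cmod (iexp (a - b) - 1)" by (simp add: norm_mult)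
    then show ?thesis using iexp_approx1[of "a - b" 0] by simp
  qed
  have int: "integrable M (\<lambda>\<omega>. indicator G \<omega> * \<bar>A \<omega> - B \<omega>\<bar>)"
  proof (rule integrableI_bounded)
    have "(\<integral>\<^sup>+\<omega>. ennreal (norm (indicator G \<omega> * \<bar>A \<omega> - B \<omega>\<bar>)) \<partial>M) = (\<integral>\<^sup>+\<omega>. ennreal (indicator G \<omega> * \<bar>A \<omega> - B \<omega>\<bar>) \<partial>M)"
      by (intro nn_integral_cong) (simp add: abs_mult)
    also have "\<dots> < \<infinity>" using close by (rule order_le_less_trans) simp
    finally show "(\<integral>\<^sup>+\<omega>. ennreal (norm (indicator G \<omega> * \<bar>A \<omega> - B \<omega>\<bar>)) \<partial>M) < \<infinity>" .
  qed measurable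
  have le: "expectation (\<lambda>\<omega>. indicator G \<omega> * \<bar>A \<omega> - B \<omega>\<bar>) \<le> K"
    using close K int by (subst (asm) nn_integral_eq_integral) auto
  have Gc: "space M - G \<in> events" by measurable
  have "cmod (expectation (\<lambda>\<omega>. iexp (t * A \<omega>)) - expectation (\<lambda>\<omega>. iexp (t * B \<omega>)))
    = cmod (expectation (\<lambda>\<omega>. iexp (t * A \<omega>) - iexp (t * B \<omega>)))"
    by (subst Bochner_Integration.integral_diff) (auto intro!: integrable_iexp)
  also have "\<dots> \<le> expectation (\<lambda>\<omega>. cmod (iexp (t * A \<omega>) - iexp (t * B \<omega>)))"
    by (rule integral_norm_bound)
  also have "\<dots> \<le> expectation (\<lambda>\<omega>. \<bar>t\<bar> * (indicator G \<omega> * \<bar>A \<omega> - B \<omega>\<bar>) + 2 * indicator (space M - G) \<omega>)"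
  proof (rule integral_mono)
    show "integrable M (\<lambda>\<omega>. cmod (iexp (t * A \<omega>) - iexp (t * B \<omega>)))"
      by (intro integrable_norm Bochner_Integration.integrable_diff integrable_iexp) auto
    show "integrable M (\<lambda>\<omega>. \<bar>t\<bar> * (indicator G \<omega> * \<bar>A \<omega> - B \<omega>\<bar>) + 2 * indicator (space M - G) \<omega>)"
      using int Gc by (intro Bochner_Integration.integrable_add integrable_mult_right) (auto simp: emeasure_eq_measure)
    fix \<omega> assume \<omega>: "\<omega> \<in> space M"
    show "cmod (iexp (t * A \<omega>) - iexp (t * B \<omega>)) \<le> \<bar>t\<bar> * (indicator G \<omega> * \<bar>A \<omega> - B \<omega>\<bar>) + 2 * indicator (space M - G) \<omega>"
    proof (cases "\<omega> \<in> G")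
      case True
      then show ?thesis using lip[of "t * A \<omega>" "t * B \<omega>"] by (simp add: right_diff_distrib[symmetric] abs_mult)
    next
      case False
      have "cmod (iexp (t * A \<omega>) - iexp (t * B \<omega>)) \<le> cmod (iexp (t * A \<omega>)) + cmod (iexp (t * B \<omega>))"
        by (rule norm_triangle_ineq4)
      then show ?thesis using False \<omega> by simp
    qed
  qed
  also have "\<dots> = \<bar>t\<bar> * expectation (\<lambda>\<omega>. indicator G \<omega> * \<bar>A \<omega> - B \<omega>\<bar>) + 2 * prob (space M - G)"
    using int Gc by (subst Bochner_Integration.integral_add) (auto simp: emeasure_eq_measure)
  also have "\<dots> \<le> \<bar>t\<bar> * K + 2 * q"
    using le q by (intro add_mono mult_left_mono) auto
  finally show ?thesis .
qed

section \<open>Linearisation error under a random division\<close>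

context null_ridge
begin

lemma dispersion_cong:
  assumes "\<And>i. i \<in> {1..N} \<Longrightarrow> x i = x' i" "\<And>j. j \<in> {1..s} \<Longrightarrow> d j \<subseteq> {1..N}"
  shows "dispersion N s d x = dispersion N s d x'"
  unfolding dispersion_def using err_gram_cong[OF assms] by (intro arg_cong2[of _ _ _ _ "(/)"] sum.cong refl) auto

lemma err_cong:
  assumes "\<And>i. i \<in> {1..N} \<Longrightarrow> x i = x' i" "\<And>j. j \<in> {1..s} \<Longrightarrow> d j \<subseteq> {1..N}"
    "\<And>i. i \<in> {1..N} \<Longrightarrow> y i = y' i"
  shows "err N s d x y = err N s d x' y'"
  unfolding err_def using err_gram_cong[OF assms(1,2)] assms(3) by (intro sum.cong refl arg_cong2[of _ _ _ _ "(*)"]) auto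

text \<open>The truncation depends on the design alone and can be merged into the weights of the
  quadratic form. \<open>expectation_cross\<close> then removes the off-diagonal part, and the
  truncated diagonal weights sum to at most \<open>\<delta> / N\<close>.\<close>

lemma err_fixed_division:
  assumes d: "division N s n d" and Nns: "N = n * s" and N: "1 \<le> N" and \<delta>: "0 \<le> \<delta>"
  shows "(\<integral>\<^sup>+\<omega>. ennreal (if dispersion N s d (\<lambda>i. X i \<omega>) \<le> \<delta> then err N s d (\<lambda>i. X i \<omega>) (\<lambda>i. Y i \<omega>) else 0) \<partial>M)
    \<le> ennreal (\<sigma>^2 * \<delta> / real N)"
proof -
  note ds = division_subset[OF d]
  define b where "b i l x = (if dispersion N s d x \<le> \<delta> then err_gram s d x i l / (real N)^2 else 0)" for i l x
  have comp: "(\<lambda>x. x i) \<in> borel_measurable (PiM {1..N} (\<lambda>_. borel))" if "i \<in> {1..N}" for i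
    by (rule measurable_component_singleton[OF that])
  have bm: "b i l \<in> borel_measurable (PiM {1..N} (\<lambda>_. borel))" if "i \<in> {1..N}" "l \<in> {1..N}" for i l
    unfolding b_def[abs_def]
    using dispersion_measurable[of N "\<lambda>i x. x i", OF comp ds] err_gram_measurable[of N "\<lambda>i x. x i", OF comp ds that]
    by (intro measurable_If borel_measurable_divide borel_measurable_const) (auto intro: borel_measurable_le)
  have bB: "\<bar>b i l x\<bar> \<le> \<delta> / real N" if "\<And>i. i \<in> {1..N} \<Longrightarrow> x i \<in> S" "i \<in> {1..N}" "l \<in> {1..N}" for i l x
  proof (cases "dispersion N s d x \<le> \<delta>")
    case True
    have "\<bar>err_gram s d x i l\<bar> / (real N)^2 \<le> (real N * \<delta>) / (real N)^2"
      by (intro divide_right_mono err_gram_bound[OF d Nns that(1) True that(2,3)]) auto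
    then show ?thesis using N True by (simp add: b_def power2_eq_square)
  qed (use \<delta> in \<open>simp add: b_def\<close>)
  define f where "f \<omega> = (\<Sum>i=1..N. \<Sum>l=1..N. Y i \<omega> * Y l \<omega> * b i l (design N \<omega>))" for \<omega>
  have XS: "X i \<omega> \<in> S" if "\<omega> \<in> space M" "i \<in> {1..N}" for i \<omega> using X_S that by simp
  have f_eq: "(if dispersion N s d (\<lambda>i. X i \<omega>) \<le> \<delta> then err N s d (\<lambda>i. X i \<omega>) (\<lambda>i. Y i \<omega>) else 0) = f \<omega>" for \<omega>
  proof -
    have ag: "design N \<omega> i = X i \<omega>" if "i \<in> {1..N}" for i using that by (simp add: design_def)
    have 1: "dispersion N s d (\<lambda>i. X i \<omega>) = dispersion N s d (design N \<omega>)"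
      by (rule dispersion_cong[OF _ ds]) (simp add: ag)
    have 2: "err N s d (\<lambda>i. X i \<omega>) (\<lambda>i. Y i \<omega>) = err N s d (design N \<omega>) (\<lambda>i. Y i \<omega>)"
      by (rule err_cong[OF _ ds]) (simp_all add: ag)
    show ?thesis unfolding 1 2 unfolding f_def b_def err_def by (auto intro!: sum.cong simp: power2_eq_square)
  qed
  have int: "integrable M (\<lambda>\<omega>. Y i \<omega> * Y l \<omega> * b i l (design N \<omega>))" if "i \<in> {1..N}" "l \<in> {1..N}" for i l
    using bB that by (intro expectation_cross(1)[OF bm[OF that] _ that]) auto
  have E: "expectation (\<lambda>\<omega>. Y i \<omega> * Y l \<omega> * b i l (design N \<omega>)) = (if i = l then \<sigma>^2 * expectation (\<lambda>\<omega>. b i l (design N \<omega>)) else 0)"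
    if "i \<in> {1..N}" "l \<in> {1..N}" for i l
    using bB that by (intro expectation_cross(2)[OF bm[OF that] _ that]) auto
  have dm: "design N \<in> measurable M (PiM {1..N} (\<lambda>_. borel))"
    unfolding design_def by (rule measurable_restrict) (use X_measurable in auto)
  have intb: "integrable M (\<lambda>\<omega>. b i i (design N \<omega>))" if i: "i \<in> {1..N}" for i
    using bB[OF _ i i] XS measurable_compose[OF dm bm[OF i i]]
    by (intro integrable_const_bound[where B="\<delta> / real N"]) (auto intro!: AE_I2 simp: design_def)
  have "expectation f = (\<Sum>i=1..N. expectation (\<lambda>\<omega>. \<Sum>l=1..N. Y i \<omega> * Y l \<omega> * b i l (design N \<omega>)))"
    unfolding f_def by (intro Bochner_Integration.integral_sum Bochner_Integration.integrable_sum int)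
  also have "\<dots> = (\<Sum>i=1..N. \<Sum>l=1..N. expectation (\<lambda>\<omega>. Y i \<omega> * Y l \<omega> * b i l (design N \<omega>)))"
    by (intro sum.cong refl Bochner_Integration.integral_sum int)
  also have "\<dots> = (\<Sum>i=1..N. \<Sum>l=1..N. if i = l then \<sigma>^2 * expectation (\<lambda>\<omega>. b i i (design N \<omega>)) else 0)"
    by (intro sum.cong refl) (subst E; simp)
  also have "\<dots> = \<sigma>^2 * expectation (\<lambda>\<omega>. \<Sum>i=1..N. b i i (design N \<omega>))"
    using intb by (simp add: sum_distrib_left)
  also have "\<dots> \<le> \<sigma>^2 * expectation (\<lambda>\<omega>. \<delta> / real N)"
  proof (intro mult_left_mono integral_mono)
    show "integrable M (\<lambda>\<omega>. \<Sum>i=1..N. b i i (design N \<omega>))" by (intro Bochner_Integration.integrable_sum intb)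
    show "(\<Sum>i=1..N. b i i (design N \<omega>)) \<le> \<delta> / real N" if "\<omega> \<in> space M" for \<omega>
    proof (cases "dispersion N s d (design N \<omega>) \<le> \<delta>")
      case True
      have "(\<Sum>i=1..N. b i i (design N \<omega>)) = dispersion N s d (design N \<omega>) / real N"
        using True by (simp add: b_def dispersion_def sum_divide_distrib power2_eq_square)
      also have "\<dots> \<le> \<delta> / real N" using True by (intro divide_right_mono) auto
      finally show ?thesis .
    qed (use \<delta> in \<open>simp add: b_def\<close>)
  qed auto
  finally have le: "expectation f \<le> \<sigma>^2 * \<delta> / real N" by (simp add: prob_space)
  have "integrable M f" unfolding f_def by (intro Bochner_Integration.integrable_sum int)
  moreover have "0 \<le> f \<omega>" if "\<omega> \<in> space M" for \<omega>
    unfolding f_eq[symmetric] using err_nonneg[OF d Nns XS[OF that]] by simp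
  ultimately have "(\<integral>\<^sup>+\<omega>. ennreal (f \<omega>) \<partial>M) = ennreal (expectation f)"
    by (intro nn_integral_eq_integral) (auto intro!: AE_I2)
  then show ?thesis unfolding f_eq using le by (simp add: ennreal_leI)
qed

context
  fixes N s n :: nat and D :: "nat \<Rightarrow> 'w \<Rightarrow> nat set"
  assumes rd: "random_division M (\<lambda>i \<omega>. (Y i \<omega>, X i \<omega>)) N s n D" and Nns: "N = n * s"
begin

definition blocks :: "'w \<Rightarrow> nat \<Rightarrow> nat set" where
  "blocks \<omega> = (\<lambda>j\<in>{1..s}. D j \<omega>)"

abbreviation all_blocks :: "(nat \<Rightarrow> nat set) set" where
  "all_blocks \<equiv> PiE {1..s} (\<lambda>_. Pow {1..N})"

lemma blocks_division: "\<omega> \<in> space M \<Longrightarrow> division N s n (blocks \<omega>)"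
  using rd by (auto simp: random_division_def division_def blocks_def disjoint_family_on_def)

lemma blocks_mem: "\<omega> \<in> space M \<Longrightarrow> blocks \<omega> \<in> all_blocks"
  using division_subset[OF blocks_division, of \<omega>] by (auto simp: blocks_def)

text \<open>The division takes finitely many values, so every subset of \<open>all_blocks\<close> is
  measurable in the product of discrete spaces, and independence carries over to the discrete
  variable \<open>blocks\<close>.\<close>

lemma indep_blocks:
  "indep_pair (count_space all_blocks) blocks (PiM {1..N} (\<lambda>_. obs_space)) (\<lambda>\<omega>. \<lambda>i\<in>{1..N}. (Y i \<omega>, X i \<omega>))"
proof (rule indep_pairI)
  let ?P = "\<Pi>\<^sub>M j\<in>{1..s}. count_space (Pow {1..N})"
  let ?Z = "\<lambda>\<omega>. \<lambda>i\<in>{1..N}. (Y i \<omega>, X i \<omega>)"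
  have ind: "indep_set (sets (vimage_algebra (space M) blocks ?P)) (sets (vimage_algebra (space M) ?Z (PiM {1..N} (\<lambda>_. obs_space))))"
    using rd unfolding random_division_def blocks_def[abs_def] by blast
  have fin: "finite all_blocks" by (intro finite_PiE) auto
  have single: "{d} \<in> sets ?P" if "d \<in> all_blocks" for d
  proof -
    have "PiE {1..s} (\<lambda>j. {d j}) \<in> sets ?P"
      using that by (intro sets_PiM_I_finite) (auto simp: PiE_iff)
    also have "PiE {1..s} (\<lambda>j. {d j}) = {d}"
      using that by (intro PiE_singleton) (auto simp: PiE_iff)
    finally show ?thesis .
  qed
  have sub: "U \<in> sets ?P" if "U \<subseteq> all_blocks" for U
  proof -
    have "(\<Union>d\<in>U. {d}) \<in> sets ?P"
      using that single finite_subset[OF that fin] by (intro sets.finite_UN) auto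
    then show ?thesis by simp
  qed
  show Zm: "?Z \<in> measurable M (PiM {1..N} (\<lambda>_. obs_space))"
    by (rule measurable_restrict) (use pair_measurable in auto)
  have ev: "blocks -` U \<inter> space M \<in> sets (vimage_algebra (space M) blocks ?P)" if "U \<subseteq> all_blocks" for U
    by (rule in_vimage_algebra[OF sub[OF that]])
  show "blocks \<in> measurable M (count_space all_blocks)"
  proof (rule measurableI)
    show "blocks \<omega> \<in> space (count_space all_blocks)" if "\<omega> \<in> space M" for \<omega> using blocks_mem[OF that] by simp
    show "blocks -` U \<inter> space M \<in> events" if "U \<in> sets (count_space all_blocks)" for U
      using ev[of U] that ind unfolding indep_sets2_eq by auto
  qed
  fix U V assume U: "U \<in> sets (count_space all_blocks)" and V: "V \<in> sets (PiM {1..N} (\<lambda>_. obs_space))"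
  show "prob ((blocks -` U \<inter> space M) \<inter> (?Z -` V \<inter> space M)) = prob (blocks -` U \<inter> space M) * prob (?Z -` V \<inter> space M)"
    using ev[of U] U in_vimage_algebra[OF V, of ?Z "space M"] ind unfolding indep_sets2_eq by auto
qed

lemma blocks_measurable: "blocks \<in> measurable M (count_space all_blocks)"
  using indep_blocks by (simp add: indep_pair_def)

text \<open>As the division takes finitely many values, measurability for each fixed family
  suffices.\<close>

lemma measurable_blocks:
  assumes "\<And>d. d \<in> all_blocks \<Longrightarrow> f d \<in> borel_measurable M"
  shows "(\<lambda>\<omega>. f (blocks \<omega>) \<omega>) \<in> borel_measurable M"
proof (rule measurable_compose_countable'[OF _ blocks_measurable])
  show "countable all_blocks" by (intro countable_finite finite_PiE) auto
qed (rule assms)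

lemma all_blocks_subset: "d \<in> all_blocks \<Longrightarrow> j \<in> {1..s} \<Longrightarrow> d j \<subseteq> {1..N}"
  by (auto simp: PiE_iff)

lemma X_borel: "i \<in> {1..N} \<Longrightarrow> X i \<in> borel_measurable M"
  by (rule X_measurable) simp

lemma Y_borel: "i \<in> {1..N} \<Longrightarrow> Y i \<in> borel_measurable M"
  by (rule Y_measurable) simp

lemma T_stat_blocks:
  "T_stat (design_law S p) H ip lam s (\<lambda>j. D j \<omega>) x y = T_stat (design_law S p) H ip lam s (blocks \<omega>) x y"
proof -
  have "averaged_estimator H ip lam s (\<lambda>j. D j \<omega>) x y = averaged_estimator H ip lam s (blocks \<omega>) x y"
    unfolding averaged_estimator_def by (auto simp: blocks_def)
  then show ?thesis by (simp add: T_stat_def)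
qed

definition T :: "'w \<Rightarrow> real" where
  "T \<omega> = T_stat (design_law S p) H ip lam s (\<lambda>j. D j \<omega>) (\<lambda>i. X i \<omega>) (\<lambda>i. Y i \<omega>)"

lemma XS: "\<omega> \<in> space M \<Longrightarrow> i \<in> {1..N} \<Longrightarrow> X i \<omega> \<in> S"
  using X_S by simp

lemma T_measurable: "T \<in> borel_measurable M"
proof -
  have eq: "T \<omega> = (\<Sum>i=1..N. \<Sum>l=1..N. (Y i \<omega> / real N) * (Y l \<omega> / real N) * gram s (blocks \<omega>) (\<lambda>i. X i \<omega>) i l)"
    if "\<omega> \<in> space M" for \<omega>
    unfolding T_def T_stat_blocks using T_stat_gram[OF blocks_division[OF that] Nns XS[OF that]] .
  have "(\<lambda>\<omega>. \<Sum>i=1..N. \<Sum>l=1..N. (Y i \<omega> / real N) * (Y l \<omega> / real N) * gram s (blocks \<omega>) (\<lambda>i. X i \<omega>) i l) \<in> borel_measurable M"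
    by (rule measurable_blocks)
       (intro borel_measurable_sum borel_measurable_times borel_measurable_divide borel_measurable_const
          Y_borel gram_measurable[OF X_borel all_blocks_subset])
  then show ?thesis by (subst measurable_cong[OF eq])
qed

text \<open>Cut out by \<open>dispersion\<close>, which is measurable, and not by the suprema, which
  enter only through the inclusion \<open>bad_subset\<close>.\<close>

definition good :: "real \<Rightarrow> 'w set" where
  "good \<delta> = {\<omega> \<in> space M. dispersion N s (blocks \<omega>) (\<lambda>i. X i \<omega>) \<le> \<delta>}"

lemma good_event: "good \<delta> \<in> events"
proof -
  have "(\<lambda>\<omega>. dispersion N s (blocks \<omega>) (\<lambda>i. X i \<omega>)) \<in> borel_measurable M"
    by (rule measurable_blocks) (rule dispersion_measurable[OF X_borel all_blocks_subset])
  then show ?thesis unfolding good_def by measurable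
qed

text \<open>The division is frozen first: by its independence of the data, the bound for a fixed
  division applies to each of its values.\<close>

lemma err_random_division:
  assumes N: "1 \<le> N" and \<delta>: "0 \<le> \<delta>"
  shows "(\<integral>\<^sup>+\<omega>. ennreal (indicator (good \<delta>) \<omega> * err N s (blocks \<omega>) (\<lambda>i. X i \<omega>) (\<lambda>i. Y i \<omega>)) \<partial>M) \<le> ennreal (\<sigma>^2 * \<delta> / real N)"
proof -
  define Z where "Z \<omega> = (\<lambda>i\<in>{1..N}. (Y i \<omega>, X i \<omega>))" for \<omega>
  define F where "F w = ennreal (if dispersion N s (fst w) (\<lambda>i. snd (snd w i)) \<le> \<delta>
      then err N s (fst w) (\<lambda>i. snd (snd w i)) (\<lambda>i. fst (snd w i)) else 0)" for w :: "(nat \<Rightarrow> nat set) \<times> (nat \<Rightarrow> real \<times> 'a)"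
  have Fm: "F \<in> borel_measurable (count_space all_blocks \<Otimes>\<^sub>M PiM {1..N} (\<lambda>_. obs_space))"
  proof (rule measurable_pair_measure_countable1)
    show "countable all_blocks" by (intro countable_finite finite_PiE) auto
    fix d assume d: "d \<in> all_blocks"
    note ds = all_blocks_subset[OF d]
    have x: "(\<lambda>z. snd (z i)) \<in> borel_measurable (PiM {1..N} (\<lambda>_. obs_space))"
      and y: "(\<lambda>z. fst (z i)) \<in> borel_measurable (PiM {1..N} (\<lambda>_. obs_space))" if "i \<in> {1..N}" for i
      using measurable_compose[OF measurable_component_singleton[OF that, of "\<lambda>_. obs_space"] measurable_snd]
        measurable_compose[OF measurable_component_singleton[OF that, of "\<lambda>_. obs_space"] measurable_fst] by auto
    have 1: "(\<lambda>z. dispersion N s d (\<lambda>i. snd (z i))) \<in> borel_measurable (PiM {1..N} (\<lambda>_. obs_space))"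
      by (rule dispersion_measurable[OF x ds])
    have 2: "(\<lambda>z. err N s d (\<lambda>i. snd (z i)) (\<lambda>i. fst (z i))) \<in> borel_measurable (PiM {1..N} (\<lambda>_. obs_space))"
      by (rule err_measurable[OF x ds y])
    have "Measurable.pred (PiM {1..N} (\<lambda>_. obs_space)) (\<lambda>z. dispersion N s d (\<lambda>i. snd (z i)) \<le> \<delta>)"
      using 1 by measurable
    then show "(\<lambda>z. F (d, z)) \<in> borel_measurable (PiM {1..N} (\<lambda>_. obs_space))"
      unfolding F_def fst_conv snd_conv
      by (intro measurable_compose[OF _ measurable_ennreal] measurable_If 2 borel_measurable_const) auto
  qed
  have F_eq: "F (blocks \<omega>', Z \<omega>) = ennreal (if dispersion N s (blocks \<omega>') (\<lambda>i. X i \<omega>) \<le> \<delta>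
      then err N s (blocks \<omega>') (\<lambda>i. X i \<omega>) (\<lambda>i. Y i \<omega>) else 0)" if "\<omega>' \<in> space M" for \<omega> \<omega>'
  proof -
    note ds = all_blocks_subset[OF blocks_mem[OF that]]
    have "dispersion N s (blocks \<omega>') (\<lambda>i. snd (Z \<omega> i)) = dispersion N s (blocks \<omega>') (\<lambda>i. X i \<omega>)"
      by (rule dispersion_cong[OF _ ds]) (simp add: Z_def)
    moreover have "err N s (blocks \<omega>') (\<lambda>i. snd (Z \<omega> i)) (\<lambda>i. fst (Z \<omega> i)) = err N s (blocks \<omega>') (\<lambda>i. X i \<omega>) (\<lambda>i. Y i \<omega>)"
      by (rule err_cong[OF _ ds]) (simp_all add: Z_def)
    ultimately show ?thesis by (simp add: F_def)
  qed
  have "(\<integral>\<^sup>+\<omega>. ennreal (indicator (good \<delta>) \<omega> * err N s (blocks \<omega>) (\<lambda>i. X i \<omega>) (\<lambda>i. Y i \<omega>)) \<partial>M) = (\<integral>\<^sup>+\<omega>. F (blocks \<omega>, Z \<omega>) \<partial>M)"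
    by (intro nn_integral_cong) (simp add: F_eq good_def)
  also have "\<dots> = (\<integral>\<^sup>+\<omega>'. (\<integral>\<^sup>+\<omega>. F (blocks \<omega>', Z \<omega>) \<partial>M) \<partial>M)"
    by (rule indep_pair_nn_fubini[OF indep_blocks[folded Z_def] Fm])
  also have "\<dots> \<le> (\<integral>\<^sup>+\<omega>'. ennreal (\<sigma>^2 * \<delta> / real N) \<partial>M)"
    by (intro nn_integral_mono) (simp add: F_eq err_fixed_division[OF blocks_division Nns N \<delta>] cong: nn_integral_cong)
  finally show ?thesis by (simp add: emeasure_space_1)
qed

lemma bad_subset:
  assumes s: "1 \<le> s" and N: "1 \<le> N" and r: "0 \<le> r" "r \<le> 1/2" and \<delta>: "4 * c^2 * dim1 * r^2 \<le> \<delta>"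
  shows "space M - good \<delta> \<subseteq> {\<omega>\<in>space M. r < \<bar>MAX j\<in>{1..s}. xi_sup (design_law S p) H ip lam (D j \<omega>) (\<lambda>i. X i \<omega>)\<bar>}"
proof (safe, rule ccontr)
  fix \<omega> assume \<omega>: "\<omega> \<in> space M" and bad: "\<omega> \<notin> good \<delta>"
    and "\<not> r < \<bar>MAX j\<in>{1..s}. xi_sup (design_law S p) H ip lam (D j \<omega>) (\<lambda>i. X i \<omega>)\<bar>"
  then have max: "(MAX j\<in>{1..s}. xi_sup (design_law S p) H ip lam (D j \<omega>) (\<lambda>i. X i \<omega>)) \<le> r" by linarith
  have "xi_sup (design_law S p) H ip lam (blocks \<omega> j) (\<lambda>i. X i \<omega>) \<le> r" if j: "j \<in> {1..s}" for j
  proof -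
    have "xi_sup (design_law S p) H ip lam (D j \<omega>) (\<lambda>i. X i \<omega>) \<le> (MAX j\<in>{1..s}. xi_sup (design_law S p) H ip lam (D j \<omega>) (\<lambda>i. X i \<omega>))"
      using j by (intro Max_ge) auto
    then show ?thesis using max j by (simp add: blocks_def)
  qed
  from dispersion_le[OF blocks_division[OF \<omega>] Nns XS[OF \<omega>] this r \<delta> N] have "\<omega> \<in> good \<delta>"
    using \<omega> by (simp add: good_def)
  with bad show False by simp
qed

definition lin_form :: "'w \<Rightarrow> real" where
  "lin_form \<omega> = (\<Sum>i=1..N. \<Sum>l=1..N. (Y i \<omega> / real N) * (Y l \<omega> / real N) * Kern (X i \<omega>) (X l \<omega>))"

lemma lin_form_expectation:
  assumes N: "1 \<le> N"
  shows "(\<integral>\<^sup>+\<omega>. ennreal (lin_form \<omega>) \<partial>M) = ennreal (\<sigma>^2 * dim1 / real N)"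
proof -
  have b: "(\<lambda>x. Kern (x i) (x l)) \<in> borel_measurable (PiM {1..N} (\<lambda>_. borel))" if "i \<in> {1..N}" "l \<in> {1..N}" for i l
    unfolding Kern_def by (rule kern_measurable[of "shrinkage \<mu> lam", OF shrinkage_facts]) (use that in measurable)
  have bB: "\<bar>Kern (x i) (x l)\<bar> \<le> c^2 * dim1" for i l and x :: "nat \<Rightarrow> 'a"
    unfolding Kern_def by (rule kern_bound[OF shrinkage_facts])
  have dX: "design N \<omega> i = X i \<omega>" if "i \<in> {1..N}" for i \<omega> using that by (simp add: design_def)
  have int: "integrable M (\<lambda>\<omega>. Y i \<omega> * Y l \<omega> * Kern (X i \<omega>) (X l \<omega>))" if "i \<in> {1..N}" "l \<in> {1..N}" for i l
    using expectation_cross(1)[OF b[OF that] bB that] that by (simp add: dX)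
  have E: "expectation (\<lambda>\<omega>. Y i \<omega> * Y l \<omega> * Kern (X i \<omega>) (X l \<omega>)) = (if i = l then \<sigma>^2 * dim1 else 0)"
    if "i \<in> {1..N}" "l \<in> {1..N}" for i l
  proof -
    have "expectation (\<lambda>\<omega>. Kern (X i \<omega>) (X i \<omega>)) = dim1"
    proof -
      have "(\<lambda>x. kern (shrinkage \<mu> lam) x x) \<in> borel_measurable borel"
        by (rule kern_measurable[of "shrinkage \<mu> lam", OF shrinkage_facts]) auto
      then show ?thesis unfolding Kern_def using integral_X[of i "\<lambda>x. kern (shrinkage \<mu> lam) x x"] that kern_trace[OF shrinkage_facts] by simp
    qed
    then show ?thesis using expectation_cross(2)[OF b[OF that] bB that] that by (auto simp: dX)
  qed
  have lf: "lin_form \<omega> = (\<Sum>i=1..N. \<Sum>l=1..N. (1 / (real N)^2) * (Y i \<omega> * Y l \<omega> * Kern (X i \<omega>) (X l \<omega>)))" for \<omega>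
    unfolding lin_form_def by (intro sum.cong refl) (simp add: power2_eq_square)
  have "expectation lin_form = (\<Sum>i=1..N. expectation (\<lambda>\<omega>. \<Sum>l=1..N. (1 / (real N)^2) * (Y i \<omega> * Y l \<omega> * Kern (X i \<omega>) (X l \<omega>))))"
    unfolding lf by (intro Bochner_Integration.integral_sum Bochner_Integration.integrable_sum integrable_mult_right int)
  also have "\<dots> = (\<Sum>i=1..N. \<Sum>l=1..N. expectation (\<lambda>\<omega>. (1 / (real N)^2) * (Y i \<omega> * Y l \<omega> * Kern (X i \<omega>) (X l \<omega>))))"
    by (intro sum.cong refl Bochner_Integration.integral_sum integrable_mult_right int)
  also have "\<dots> = (\<Sum>i=1..N. \<Sum>l=1..N. (1 / (real N)^2) * expectation (\<lambda>\<omega>. Y i \<omega> * Y l \<omega> * Kern (X i \<omega>) (X l \<omega>)))"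
    by (intro sum.cong refl integral_mult_right_zero)
  also have "\<dots> = (\<Sum>i=1..N. \<Sum>l=1..N. if i = l then (1 / (real N)^2) * (\<sigma>^2 * dim1) else 0)"
    by (intro sum.cong refl) (subst E; simp)
  also have "\<dots> = \<sigma>^2 * dim1 / real N" using N by (simp add: power2_eq_square)
  finally have ex: "expectation lin_form = \<sigma>^2 * dim1 / real N" .
  have "integrable M lin_form" unfolding lf by (intro Bochner_Integration.integrable_sum integrable_mult_right int)
  moreover have "0 \<le> lin_form \<omega>" if "\<omega> \<in> space M" for \<omega>
    unfolding lin_form_def by (rule Kern_form_nonneg[OF blocks_division[OF that] Nns XS[OF that]])
  ultimately show ?thesis unfolding ex[symmetric] by (intro nn_integral_eq_integral) (auto intro!: AE_I2)
qed

text \<open>Off the diagonal \<open>lin_form\<close> is exactly W / N^2. The diagonal minus its mean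
  is a sum of i.i.d. centred variables whose second moments are of order \<open>dim1\<^sup>2\<close>
  by the fourth moment of the noise, and Jensen's inequality converts the variance into a first
  moment.\<close>

lemma diagonal_fluctuation:
  assumes N: "1 \<le> N"
  shows "(\<integral>\<^sup>+\<omega>. ennreal \<bar>lin_form \<omega> - \<sigma>^2 * dim1 / real N - W N \<omega> / (real N)^2\<bar> \<partial>M) \<le> ennreal (sqrt \<tau> * c^2 * dim1 / (real N * sqrt (real N)))"
proof -
  define g where "g x = kern (shrinkage \<mu> lam) x x" for x
  have gm: "g \<in> borel_measurable borel" unfolding g_def by (rule kern_measurable[of "shrinkage \<mu> lam", OF shrinkage_facts]) auto
  have gb: "\<bar>g x\<bar> \<le> c^2 * dim1" for x unfolding g_def by (rule kern_bound[OF shrinkage_facts])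
  define h where "h z = fst z ^ 2 * g (snd z) - \<sigma>^2 * dim1" for z :: "real \<times> 'a"
  have hm: "h \<in> borel_measurable obs_space"
    unfolding h_def using measurable_compose[OF measurable_snd gm, of borel] by measurable
  define V where "V i \<omega> = h (obs i \<omega>)" for i \<omega>
  have Yg: "L2 (\<lambda>\<omega>. Y (Suc i) \<omega> ^ 2 * g (X (Suc i) \<omega>))" and Yg_m: "expectation (\<lambda>\<omega>. (Y (Suc i) \<omega> ^ 2 * g (X (Suc i) \<omega>))^2) \<le> \<tau> * (c^2 * dim1)^2" for i
  proof -
    have g2m: "(\<lambda>x. g x ^ 2) \<in> borel_measurable borel" using gm by measurable
    have g2b: "\<bar>g x ^ 2\<bar> \<le> (c^2 * dim1)^2" for x using power_mono[OF gb[of x], of 2] by simp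
    have e: "(Y (Suc i) \<omega> ^ 2 * g (X (Suc i) \<omega>))^2 = Y (Suc i) \<omega> ^ 4 * g (X (Suc i) \<omega>) ^ 2" for \<omega>
      by (simp add: power_mult_distrib flip: power_mult)
    show "L2 (\<lambda>\<omega>. Y (Suc i) \<omega> ^ 2 * g (X (Suc i) \<omega>))"
      unfolding L2_def e using Y_fourth(1)[OF _ g2m g2b, of "Suc i"] measurable_compose[OF X_measurable gm, of "Suc i"] by auto
    have "expectation (\<lambda>\<omega>. (Y (Suc i) \<omega> ^ 2 * g (X (Suc i) \<omega>))^2) \<le> \<tau> * expectation (\<lambda>\<omega>. g (X (Suc i) \<omega>) ^ 2)"
      unfolding e using Y_fourth(2)[OF _ g2m g2b, of "Suc i"] by simp
    also have "\<dots> \<le> \<tau> * expectation (\<lambda>\<omega>. (c^2 * dim1)^2)"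
      using gX_integrable[OF _ g2m g2b, of "Suc i"] g2b \<tau>_pos by (intro mult_left_mono integral_mono) auto
    finally show "expectation (\<lambda>\<omega>. (Y (Suc i) \<omega> ^ 2 * g (X (Suc i) \<omega>))^2) \<le> \<tau> * (c^2 * dim1)^2"
      by (simp add: prob_space)
  qed
  have Ve: "V i \<omega> = Y (Suc i) \<omega> ^ 2 * g (X (Suc i) \<omega>) - \<sigma>^2 * dim1" for i \<omega> by (simp add: V_def h_def obs_def)
  have mean_Yg: "expectation (\<lambda>\<omega>. Y (Suc i) \<omega> ^ 2 * g (X (Suc i) \<omega>)) = \<sigma>^2 * dim1" for i
    using Y_square(2)[OF _ gm gb, of "Suc i"] integral_X[OF _ gm, of "Suc i"] kern_trace[OF shrinkage_facts] by (simp add: g_def)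
  have V2: "L2 (V i)" for i
    unfolding Ve[abs_def] using L2_add[OF Yg L2_const[of "- (\<sigma>^2 * dim1)"]] by simp
  have "expectation (\<lambda>\<omega>. (\<Sum>i<N. V i \<omega>)^2) \<le> real N * (\<tau> * (c^2 * dim1)^2)"
  proof (rule second_moment_sum_le[OF _ V2])
    show "indep_vars (\<lambda>_. borel) V UNIV"
      unfolding V_def[abs_def] using indep_vars_compose2[OF sample.indep, of "\<lambda>_. h" "\<lambda>_. borel"] hm by simp
    show "expectation (V i) = 0" for i
      unfolding Ve[abs_def] using L2_integrable(1)[OF Yg] mean_Yg by (simp add: prob_space)
    show "expectation (\<lambda>\<omega>. V i \<omega> ^ 2) \<le> \<tau> * (c^2 * dim1)^2" for i
    proof -
      have "expectation (\<lambda>\<omega>. V i \<omega> ^ 2) = expectation (\<lambda>\<omega>. (Y (Suc i) \<omega> ^ 2 * g (X (Suc i) \<omega>))^2) - (\<sigma>^2 * dim1)^2"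
        unfolding Ve using variance_eq[OF L2_integrable[OF Yg], of i] unfolding mean_Yg .
      also have "\<dots> \<le> expectation (\<lambda>\<omega>. (Y (Suc i) \<omega> ^ 2 * g (X (Suc i) \<omega>))^2)" by simp
      finally show ?thesis using Yg_m[of i] by linarith
    qed
  qed
  then have m: "sqrt (expectation (\<lambda>\<omega>. (\<Sum>i<N. V i \<omega>)^2)) \<le> sqrt (real N) * (sqrt \<tau> * (c^2 * dim1))"
    using real_sqrt_le_mono suminf_nonneg[OF shrinkage_facts(2) shrinkage_facts(1)] by (fastforce simp: real_sqrt_mult)
  have sV: "L2 (\<lambda>\<omega>. \<Sum>i<N. V i \<omega>)" by (intro L2_sum V2)
  have "expectation (\<lambda>\<omega>. \<bar>\<Sum>i<N. V i \<omega>\<bar>) \<le> sqrt (real N) * (sqrt \<tau> * (c^2 * dim1))"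
    using abs_expectation_le_sqrt[of "\<lambda>\<omega>. \<Sum>i<N. V i \<omega>"] sV m by (auto simp: L2_def intro: order_trans)
  then have "expectation (\<lambda>\<omega>. \<bar>\<Sum>i<N. V i \<omega>\<bar> / (real N)^2) \<le> sqrt (real N) * (sqrt \<tau> * (c^2 * dim1)) / (real N)^2"
    by (simp add: divide_right_mono)
  also have "\<dots> = sqrt \<tau> * c^2 * dim1 / (real N * sqrt (real N))"
  proof -
    have "(real N)^2 = sqrt (real N) * (real N * sqrt (real N))" by (simp add: power2_eq_square)
    then show ?thesis using N by simp
  qed
  finally have le: "expectation (\<lambda>\<omega>. \<bar>\<Sum>i<N. V i \<omega>\<bar> / (real N)^2) \<le> sqrt \<tau> * c^2 * dim1 / (real N * sqrt (real N))" .
  have eq: "\<bar>lin_form \<omega> - \<sigma>^2 * dim1 / real N - W N \<omega> / (real N)^2\<bar> = \<bar>\<Sum>i<N. V i \<omega>\<bar> / (real N)^2" if "\<omega> \<in> space M" for \<omega>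
  proof -
    define f where "f i l = Y i \<omega> * Y l \<omega> * Kern (X i \<omega>) (X l \<omega>)" for i l
    have "f i l = f l i" for i l
      unfolding f_def Kern_def using kern_sym[OF shrinkage_facts, of "X i \<omega>" "X l \<omega>"] by simp
    note split = sum_square_split[of f, OF this, of N]
    have Wf: "(\<Sum>l<N. \<Sum>i<l. 2 * f (Suc i) (Suc l)) = W N \<omega>"
      unfolding W_cong[OF that] sample.incr_def product_kernel_def f_def obs_def Kern_def
      by (intro sum.cong refl) simp
    have diag: "(\<Sum>i=1..N. f i i) = (\<Sum>i<N. V i \<omega>) + real N * (\<sigma>^2 * dim1)"
    proof -
      have "(\<Sum>i=1..N. f i i) = (\<Sum>i<N. f (Suc i) (Suc i))"
        by (rule sum.reindex_bij_witness[of _ Suc "\<lambda>i. i - 1"]) auto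
      also have "\<dots> = (\<Sum>i<N. V i \<omega> + \<sigma>^2 * dim1)"
        unfolding Ve by (simp add: f_def g_def Kern_def power2_eq_square)
      finally show ?thesis by (simp add: sum.distrib)
    qed
    have "lin_form \<omega> = (\<Sum>i=1..N. \<Sum>l=1..N. f i l) / (real N)^2"
      unfolding lin_form_def f_def by (simp add: sum_divide_distrib power2_eq_square)
    also have "\<dots> = (\<Sum>i<N. V i \<omega>) / (real N)^2 + \<sigma>^2 * dim1 / real N + W N \<omega> / (real N)^2"
      unfolding split diag Wf using N by (simp add: add_divide_distrib power2_eq_square)
    finally show ?thesis by (simp add: abs_divide)
  qed
  have "(\<integral>\<^sup>+\<omega>. ennreal \<bar>lin_form \<omega> - \<sigma>^2 * dim1 / real N - W N \<omega> / (real N)^2\<bar> \<partial>M) = (\<integral>\<^sup>+\<omega>. ennreal (\<bar>\<Sum>i<N. V i \<omega>\<bar> / (real N)^2) \<partial>M)"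
    by (intro nn_integral_cong) (simp only: eq)
  also have "\<dots> = ennreal (expectation (\<lambda>\<omega>. \<bar>\<Sum>i<N. V i \<omega>\<bar> / (real N)^2))"
    using L2_integrable(1)[OF sV] by (intro nn_integral_eq_integral) auto
  finally show ?thesis using le by (simp add: ennreal_leI)
qed

text \<open>The indicator is kept on \<open>err\<close> alone: the other two contributions are
  bounded in mean on the whole space.\<close>

lemma remainder:
  assumes N: "1 \<le> N" and \<delta>: "0 \<le> \<delta>" and \<theta>: "0 < \<theta>"
  shows "(\<integral>\<^sup>+\<omega>. ennreal (indicator (good \<delta>) \<omega> * \<bar>T \<omega> - \<sigma>^2 * dim1 / real N - W N \<omega> / (real N)^2\<bar>) \<partial>M)
    \<le> ennreal (sqrt \<tau> * c^2 * dim1 / (real N * sqrt (real N)) + \<theta> * (\<sigma>^2 * dim1 / real N) + (1 / \<theta> + 1) * (\<sigma>^2 * \<delta> / real N))"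
proof -
  define q where "q = 1 / \<theta> + 1"
  have q0: "0 \<le> q" using \<theta> by (simp add: q_def)
  have d0: "0 \<le> dim1" by (rule suminf_nonneg[OF shrinkage_facts(2) shrinkage_facts(1)])
  have lm: "lin_form \<in> borel_measurable M"
  proof -
    have "(\<lambda>\<omega>. Kern (X i \<omega>) (X l \<omega>)) \<in> borel_measurable M" if "i \<in> {1..N}" "l \<in> {1..N}" for i l
      unfolding Kern_def by (rule kern_measurable[of "shrinkage \<mu> lam", OF shrinkage_facts]) (use X_borel that in auto)
    then show ?thesis unfolding lin_form_def[abs_def]
      by (intro borel_measurable_sum borel_measurable_times borel_measurable_divide borel_measurable_const Y_borel)
  qed
  have em: "(\<lambda>\<omega>. err N s (blocks \<omega>) (\<lambda>i. X i \<omega>) (\<lambda>i. Y i \<omega>)) \<in> borel_measurable M"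
    by (rule measurable_blocks) (rule err_measurable[OF X_borel all_blocks_subset Y_borel])
  have Wm: "W N \<in> borel_measurable M" by (rule L4_measurable[OF W_L4])
  note [measurable] = lm em Wm good_event
  have "(\<integral>\<^sup>+\<omega>. ennreal (indicator (good \<delta>) \<omega> * \<bar>T \<omega> - \<sigma>^2 * dim1 / real N - W N \<omega> / (real N)^2\<bar>) \<partial>M)
    \<le> (\<integral>\<^sup>+\<omega>. ennreal \<bar>lin_form \<omega> - \<sigma>^2 * dim1 / real N - W N \<omega> / (real N)^2\<bar> + (ennreal \<theta> * ennreal (lin_form \<omega>)
        + ennreal q * ennreal (indicator (good \<delta>) \<omega> * err N s (blocks \<omega>) (\<lambda>i. X i \<omega>) (\<lambda>i. Y i \<omega>))) \<partial>M)"
  proof (rule nn_integral_mono)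
    fix \<omega> assume \<omega>: "\<omega> \<in> space M"
    let ?e = "err N s (blocks \<omega>) (\<lambda>i. X i \<omega>) (\<lambda>i. Y i \<omega>)"
    have e0: "0 \<le> ?e" by (rule err_nonneg[OF blocks_division[OF \<omega>] Nns XS[OF \<omega>]])
    have l0: "0 \<le> lin_form \<omega>" unfolding lin_form_def by (rule Kern_form_nonneg[OF blocks_division[OF \<omega>] Nns XS[OF \<omega>]])
    have close: "\<bar>T \<omega> - lin_form \<omega>\<bar> \<le> \<theta> * lin_form \<omega> + q * ?e"
      unfolding T_def T_stat_blocks lin_form_def
      unfolding q_def by (rule T_stat_close[OF blocks_division[OF \<omega>] Nns XS[OF \<omega>] \<theta>])
    have "indicator (good \<delta>) \<omega> * \<bar>T \<omega> - \<sigma>^2 * dim1 / real N - W N \<omega> / (real N)^2\<bar>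
      \<le> \<bar>lin_form \<omega> - \<sigma>^2 * dim1 / real N - W N \<omega> / (real N)^2\<bar> + (\<theta> * lin_form \<omega> + q * (indicator (good \<delta>) \<omega> * ?e))"
      using close l0 \<theta> q0 e0 by (cases "\<omega> \<in> good \<delta>") (auto intro!: add_nonneg_nonneg)
    then have "ennreal (indicator (good \<delta>) \<omega> * \<bar>T \<omega> - \<sigma>^2 * dim1 / real N - W N \<omega> / (real N)^2\<bar>)
      \<le> ennreal (\<bar>lin_form \<omega> - \<sigma>^2 * dim1 / real N - W N \<omega> / (real N)^2\<bar> + (\<theta> * lin_form \<omega> + q * (indicator (good \<delta>) \<omega> * ?e)))"
      by (rule ennreal_leI)
    also have "\<dots> = ennreal \<bar>lin_form \<omega> - \<sigma>^2 * dim1 / real N - W N \<omega> / (real N)^2\<bar> + (ennreal \<theta> * ennreal (lin_form \<omega>)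
        + ennreal q * ennreal (indicator (good \<delta>) \<omega> * ?e))"
      using l0 e0 \<theta> q0 by (simp add: ennreal_plus ennreal_mult')
    finally show "ennreal (indicator (good \<delta>) \<omega> * \<bar>T \<omega> - \<sigma>^2 * dim1 / real N - W N \<omega> / (real N)^2\<bar>) \<le> \<dots>" .
  qed
  also have "\<dots> = (\<integral>\<^sup>+\<omega>. ennreal \<bar>lin_form \<omega> - \<sigma>^2 * dim1 / real N - W N \<omega> / (real N)^2\<bar> \<partial>M) + (ennreal \<theta> * (\<integral>\<^sup>+\<omega>. ennreal (lin_form \<omega>) \<partial>M)
        + ennreal q * (\<integral>\<^sup>+\<omega>. ennreal (indicator (good \<delta>) \<omega> * err N s (blocks \<omega>) (\<lambda>i. X i \<omega>) (\<lambda>i. Y i \<omega>)) \<partial>M))"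
    by (simp add: nn_integral_add nn_integral_cmult)
  also have "\<dots> \<le> ennreal (sqrt \<tau> * c^2 * dim1 / (real N * sqrt (real N))) + (ennreal \<theta> * ennreal (\<sigma>^2 * dim1 / real N)
      + ennreal q * ennreal (\<sigma>^2 * \<delta> / real N))"
    unfolding lin_form_expectation[OF N]
    by (intro add_mono mult_left_mono diagonal_fluctuation[OF N] err_random_division[OF N \<delta>] order_refl) auto
  also have "\<dots> = ennreal (sqrt \<tau> * c^2 * dim1 / (real N * sqrt (real N)) + \<theta> * (\<sigma>^2 * dim1 / real N) + q * (\<sigma>^2 * \<delta> / real N))"
    using d0 \<delta> \<theta> \<tau>_pos q0 by (simp add: ennreal_plus ennreal_mult'[symmetric] add.assoc)
  finally show ?thesis unfolding q_def .
qed

end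

end

context null_ridge
begin

text \<open>For fixed t the first bracket tends to 0 in the asymptotic regime; the part proportional
  to \<eta> collects what depends on the accuracy demanded of the suprema and is made small by the
  choice of \<eta>. The event \<open>A\<close> covers a set that itself need not be an
  event.\<close>

lemma char_T_bound:
  fixes t \<eta> r :: real
  assumes rd: "random_division M (\<lambda>i \<omega>. (Y i \<omega>, X i \<omega>)) N s n D" and Nns: "N = n * s"
    and N: "2 \<le> N" and s: "1 \<le> s" and C: "0 < C" and dims: "dim1 \<le> C * dim2" and d1: "1 \<le> dim1"
    and \<eta>: "0 < \<eta>" "\<eta> \<le> 1" and r: "0 \<le> r" "r \<le> 1/2" "4 * c^2 * dim1 * r^2 \<le> \<eta>^2"
    and A: "A \<in> events" "{\<omega>\<in>space M. r < \<bar>MAX j\<in>{1..s}. xi_sup (design_law S p) H ip lam (D j \<omega>) (\<lambda>i. X i \<omega>)\<bar>} \<subseteq> A"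
      "prob A \<le> \<eta>"
  defines "Z \<equiv> (\<lambda>\<omega>. (real N)^2 / sqrt (variance (W N)) *
      (T_stat (design_law S p) H ip lam s (\<lambda>j. D j \<omega>) (\<lambda>i. X i \<omega>) (\<lambda>i. Y i \<omega>) - \<sigma>^2 * dim1 / real N))"
    and "\<rho> \<equiv> \<tau>^2 * c^6 * C^2 / \<sigma>^8 * (dim1 / real N)"
  shows "cmod (expectation (\<lambda>\<omega>. iexp (t * Z \<omega>)) - exp (- (t^2 / 2)))
    \<le> (13 / 3 * \<bar>t\<bar>^3 * sqrt \<rho> + 2 * t^2 * sqrt (8 * (C^2 / dim1) + 2 * \<rho>) + 2 * t^4 / real N
        + \<bar>t\<bar> * (sqrt C / \<sigma>^2 * (sqrt \<tau> * c^2 * sqrt (dim1 / real N))))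
      + (\<bar>t\<bar> * (3 * sqrt C) + 2) * \<eta>"
proof -
  have dim2: "0 < dim2"
  proof (rule ccontr)
    assume "\<not> 0 < dim2"
    then have "C * dim2 \<le> 0" using C by (simp add: mult_nonneg_nonpos)
    then show False using dims d1 by linarith
  qed
  have N1: "1 \<le> N" and N0: "0 < real N" using N by auto
  have \<sigma>4: "0 < \<sigma>^4" using zero_less_power[OF \<sigma>_pos, of 2] by simp
  have \<sigma>8: "0 < \<sigma>^8" using zero_less_power[OF \<sigma>4, of 2] by (simp flip: power_mult)
  define V where "V = variance (W N)"
  define a where "a = (real N)^2 / sqrt V"
  define E m where "E = sqrt dim1" and "m = sqrt (real N)"
  have E: "E > 0" "E^2 = dim1" "E \<ge> 1" and m: "m > 0" "m^2 = real N"
    using d1 N0 by (auto simp: E_def m_def)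
  \<comment> \<open>From \<open>W_variance\<close>, with
    \<open>N\<^sup>2 \<le> 2 * (N * (N - 1))\<close> and \<open>dim1 / C \<le> dim2\<close>.\<close>
  have V_low: "(\<sigma>^2 * real N * E / sqrt C)^2 \<le> V"
  proof -
    have "real N * 1 \<le> real N * (real N - 1)" using N by (intro mult_left_mono) auto
    then have nn: "(real N)^2 \<le> 2 * (real N * (real N - 1))" using N by (simp add: power2_eq_square algebra_simps)
    have dd: "dim1 / C \<le> dim2" using dims C by (simp add: field_simps)
    have "(\<sigma>^2 * real N * E / sqrt C)^2 = \<sigma>^4 * ((dim1 / C) * (real N)^2)"
      using C E by (simp add: power_mult_distrib power_divide flip: power_mult)
    also have "\<dots> \<le> \<sigma>^4 * (dim2 * (2 * (real N * (real N - 1))))"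
      using \<sigma>4 d1 C dim2 nn dd by (intro mult_left_mono mult_mono) auto
    also have "\<dots> = V" unfolding V_def W_variance by simp
    finally show ?thesis .
  qed
  have low_pos: "0 < \<sigma>^2 * real N * E / sqrt C" using \<sigma>_pos N0 E C by simp
  have sqrtV: "\<sigma>^2 * real N * E / sqrt C \<le> sqrt V" by (rule real_le_rsqrt[OF V_low])
  then have sV: "0 < sqrt V" using low_pos by linarith
  have a0: "0 \<le> a" using sV by (simp add: a_def)
  have a_le: "a \<le> real N * sqrt C / (\<sigma>^2 * E)"
  proof -
    have "a \<le> (real N)^2 / (\<sigma>^2 * real N * E / sqrt C)"
      unfolding a_def by (intro divide_left_mono mult_pos_pos sV low_pos sqrtV) simp
    also have "\<dots> = real N * sqrt C / (\<sigma>^2 * E)" using N0 by (simp add: power2_eq_square)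
    finally show ?thesis .
  qed
  define T' where "T' = T s D"
  have Tm: "T' \<in> borel_measurable M" unfolding T'_def by (rule T_measurable[OF rd Nns])
  have Z: "Z \<omega> = a * (T' \<omega> - \<sigma>^2 * dim1 / real N)" for \<omega>
    unfolding Z_def a_def V_def T'_def T_def[OF rd Nns] ..
  define B where "B \<omega> = W N \<omega> / sqrt V" for \<omega>
  have Ba: "B \<omega> = a * (W N \<omega> / (real N)^2)" for \<omega> using N0 by (simp add: B_def a_def)
  have Wm: "W N \<in> borel_measurable M" by (rule L4_measurable[OF W_L4])
  have Zm: "Z \<in> borel_measurable M" unfolding Z[abs_def] using Tm by measurable
  have Bm: "B \<in> borel_measurable M" unfolding B_def[abs_def] using Wm by measurable
  define G where "G = good N s D (\<eta>^2)"
  have G: "G \<in> events" unfolding G_def by (rule good_event[OF rd Nns])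
  \<comment> \<open>Balances the linear part, of mean
    \<open>\<sigma>\<^sup>2 * E\<^sup>2 / N\<close>, against the error, of mean at most
    \<open>\<sigma>\<^sup>2 * \<eta>\<^sup>2 / N\<close>: both weighted terms become
    \<open>\<sigma>\<^sup>2 * \<eta> * E / N\<close>.\<close>
  define \<theta> where "\<theta> = \<eta> / E"
  have \<theta>: "0 < \<theta>" using \<eta> E by (simp add: \<theta>_def)
  define K0 where "K0 = sqrt \<tau> * c^2 * dim1 / (real N * sqrt (real N)) + \<theta> * (\<sigma>^2 * dim1 / real N) + (1 / \<theta> + 1) * (\<sigma>^2 * \<eta>^2 / real N)"
  have K00: "0 \<le> K0" unfolding K0_def using d1 \<theta> \<tau>_pos by (intro add_nonneg_nonneg mult_nonneg_nonneg divide_nonneg_nonneg) auto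
  \<comment> \<open>Two of the three units stem from the weights \<theta> and 1 / \<theta>, the
    third from the unweighted \<open>\<eta>\<^sup>2 / E\<close>, which is at most \<eta> because
    \<open>E \<ge> 1\<close> and \<open>\<eta> \<le> 1\<close>.\<close>
  have aK: "a * K0 \<le> sqrt C / \<sigma>^2 * (sqrt \<tau> * c^2 * sqrt (dim1 / real N)) + 3 * sqrt C * \<eta>"
  proof -
    have "a * K0 \<le> (real N * sqrt C / (\<sigma>^2 * E)) * K0" by (rule mult_right_mono[OF a_le K00])
    also have "\<dots> = sqrt C / \<sigma>^2 * (sqrt \<tau> * c^2 * (E / m)) + 2 * sqrt C * \<eta> + sqrt C * (\<eta>^2 / E)"
    proof -
      have e: "K0 = sqrt \<tau> * c^2 * E^2 / (m^2 * m) + (\<eta> / E) * (\<sigma>^2 * E^2 / m^2) + (E / \<eta> + 1) * (\<sigma>^2 * \<eta>^2 / m^2)"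
        unfolding K0_def E m \<theta>_def m_def[symmetric] using \<eta> E by simp
      have "(m^2 * q / (w * E)) * (x * E^2 / (m^2 * m) + (\<eta> / E) * (w * E^2 / m^2) + (E / \<eta> + 1) * (w * \<eta>^2 / m^2))
          = q / w * (x * (E / m)) + 2 * q * \<eta> + q * (\<eta>^2 / E)" if "w > 0" for q w x :: real
        using that m(1) E(1) \<eta> by (simp add: field_simps power2_eq_square)
      from this[OF \<sigma>_pos, of "sqrt C" "sqrt \<tau> * c^2"] show ?thesis unfolding e m(2)[symmetric] by (simp only: mult.assoc)
    qed
    also have "E / m = sqrt (dim1 / real N)" unfolding E_def m_def by (simp add: real_sqrt_divide)
    also have "sqrt C * (\<eta>^2 / E) \<le> sqrt C * \<eta>"
    proof (intro mult_left_mono)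
      have "\<eta>^2 / E \<le> \<eta>^2 / 1" using E by (intro divide_left_mono) auto
      also have "\<dots> \<le> \<eta>" using \<eta> by (simp add: power2_eq_square mult_left_le)
      finally show "\<eta>^2 / E \<le> \<eta>" .
    qed (use C in simp)
    finally show ?thesis by (simp add: algebra_simps)
  qed
  have close: "(\<integral>\<^sup>+\<omega>. ennreal (indicator G \<omega> * \<bar>Z \<omega> - B \<omega>\<bar>) \<partial>M) \<le> ennreal (a * K0)"
  proof -
    have eq: "indicator G \<omega> * \<bar>Z \<omega> - B \<omega>\<bar> = a * (indicator G \<omega> * \<bar>T' \<omega> - \<sigma>^2 * dim1 / real N - W N \<omega> / (real N)^2\<bar>)" for \<omega>
    proof -
      have "Z \<omega> - B \<omega> = a * (T' \<omega> - \<sigma>^2 * dim1 / real N - W N \<omega> / (real N)^2)"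
        unfolding Z Ba by (simp add: right_diff_distrib)
      then show ?thesis using a0 by (simp add: abs_mult)
    qed
    have "(\<integral>\<^sup>+\<omega>. ennreal (indicator G \<omega> * \<bar>Z \<omega> - B \<omega>\<bar>) \<partial>M) =
       (\<integral>\<^sup>+\<omega>. ennreal a * ennreal (indicator G \<omega> * \<bar>T' \<omega> - \<sigma>^2 * dim1 / real N - W N \<omega> / (real N)^2\<bar>) \<partial>M)"
      by (simp only: eq ennreal_mult'[OF a0])
    also have "\<dots> = ennreal a * (\<integral>\<^sup>+\<omega>. ennreal (indicator G \<omega> * \<bar>T' \<omega> - \<sigma>^2 * dim1 / real N - W N \<omega> / (real N)^2\<bar>) \<partial>M)"
    proof (rule nn_integral_cmult)
      note Tm[measurable] Wm[measurable] G[measurable]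
      show "(\<lambda>\<omega>. ennreal (indicator G \<omega> * \<bar>T' \<omega> - \<sigma>^2 * dim1 / real N - W N \<omega> / (real N)^2\<bar>)) \<in> borel_measurable M"
        by measurable
    qed
    also have "\<dots> \<le> ennreal a * ennreal K0"
      unfolding G_def T'_def K0_def using remainder[OF rd Nns N1 _ \<theta>, of "\<eta>^2"] by (intro mult_left_mono) auto
    also have "\<dots> = ennreal (a * K0)" using a0 by (simp add: ennreal_mult')
    finally show ?thesis .
  qed
  have "prob (space M - G) \<le> prob A"
    using bad_subset[OF rd Nns s N1 r(1,2,3)] A(1,2) unfolding G_def by (intro finite_measure_mono) auto
  then have q: "prob (space M - G) \<le> \<eta>" using A(3) by linarith
  have "cmod (expectation (\<lambda>\<omega>. iexp (t * Z \<omega>)) - expectation (\<lambda>\<omega>. iexp (t * B \<omega>))) \<le> \<bar>t\<bar> * (a * K0) + 2 * \<eta>"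
    using a0 K00 by (intro char_close[OF Zm Bm G close _ q]) auto
  also have "\<dots> \<le> \<bar>t\<bar> * (sqrt C / \<sigma>^2 * (sqrt \<tau> * c^2 * sqrt (dim1 / real N)) + 3 * sqrt C * \<eta>) + 2 * \<eta>"
    by (intro add_right_mono mult_left_mono aK) auto
  finally have 1: "cmod (expectation (\<lambda>\<omega>. iexp (t * Z \<omega>)) - expectation (\<lambda>\<omega>. iexp (t * B \<omega>)))
     \<le> \<bar>t\<bar> * (sqrt C / \<sigma>^2 * (sqrt \<tau> * c^2 * sqrt (dim1 / real N))) + (\<bar>t\<bar> * (3 * sqrt C) + 2) * \<eta>"
    by (simp add: algebra_simps)
  have dim_sq: "dim1^2 \<le> C^2 * dim2^2"
    using power_mono[OF dims, of 2] d1 by (simp add: power_mult_distrib)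
  have ratio: "dim1^2 / dim2^2 \<le> C^2" using dim_sq dim2 by (simp add: field_simps)
  have \<rho>_le: "\<tau>^2 * c^6 * dim1^3 / (\<sigma>^8 * real N * dim2^2) \<le> \<rho>"
  proof -
    have "\<tau>^2 * c^6 * dim1^3 / (\<sigma>^8 * real N * dim2^2) = (\<tau>^2 * c^6 / \<sigma>^8 * (dim1 / real N)) * (dim1^2 / dim2^2)"
      by (simp add: power3_eq_cube power2_eq_square mult_ac)
    also have "\<dots> \<le> (\<tau>^2 * c^6 / \<sigma>^8 * (dim1 / real N)) * C^2"
      using d1 \<sigma>8 by (intro mult_left_mono ratio mult_nonneg_nonneg divide_nonneg_nonneg) auto
    finally show ?thesis unfolding \<rho>_def by (simp add: mult_ac)
  qed
  have q_le: "dim1 / dim2^2 \<le> C^2 / dim1"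
  proof -
    have "dim1 / dim2^2 = (dim1^2 / dim2^2) * (1 / dim1)" using d1 by (simp add: power2_eq_square)
    also have "\<dots> \<le> C^2 * (1 / dim1)" using d1 by (intro mult_right_mono ratio) auto
    finally show ?thesis by simp
  qed
  have "cmod (expectation (\<lambda>\<omega>. iexp (t * B \<omega>)) - exp (- (t^2 / 2)))
    \<le> 13 / 3 * \<bar>t\<bar>^3 * sqrt (\<tau>^2 * c^6 * dim1^3 / (\<sigma>^8 * real N * dim2^2))
      + 2 * t^2 * sqrt (8 * (dim1 / dim2^2) + 2 * (\<tau>^2 * c^6 * dim1^3 / (\<sigma>^8 * real N * dim2^2))) + 2 * t^4 / real N"
    unfolding B_def V_def by (rule char_W_bound[OF N dim2])
  also have "\<dots> \<le> 13 / 3 * \<bar>t\<bar>^3 * sqrt \<rho> + 2 * t^2 * sqrt (8 * (C^2 / dim1) + 2 * \<rho>) + 2 * t^4 / real N"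
    using \<rho>_le q_le by (intro add_mono mult_left_mono real_sqrt_le_mono) auto
  finally have 2: "cmod (expectation (\<lambda>\<omega>. iexp (t * B \<omega>)) - exp (- (t^2 / 2)))
    \<le> 13 / 3 * \<bar>t\<bar>^3 * sqrt \<rho> + 2 * t^2 * sqrt (8 * (C^2 / dim1) + 2 * \<rho>) + 2 * t^4 / real N" .
  show ?thesis
    using norm_triangle_mono[OF 1 2] by (simp add: algebra_simps)
qed

end

section \<open>Passage to the limit\<close>

theorem theorem3p5:
  fixes M :: "'w measure"
    and S :: "'a::euclidean_space set"
    and \<pi> \<sigma>2 f0 :: "'a \<Rightarrow> real"
    and X :: "nat \<Rightarrow> 'w \<Rightarrow> 'a"
    and Y \<epsilon> :: "nat \<Rightarrow> 'w \<Rightarrow> real"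
    and H :: "('a \<Rightarrow> real) set"
    and ip :: "('a \<Rightarrow> real) \<Rightarrow> ('a \<Rightarrow> real) \<Rightarrow> real"
    and \<mu> :: "nat \<Rightarrow> real"
    and \<phi> :: "nat \<Rightarrow> 'a \<Rightarrow> real"
    and N s n :: "nat \<Rightarrow> nat"
    and lam h :: "nat \<Rightarrow> real"
    and D :: "nat \<Rightarrow> nat \<Rightarrow> 'w \<Rightarrow> nat set"
    and Q :: "'a measure"
    and W :: "nat \<Rightarrow> 'w \<Rightarrow> real"
    and \<sigma>N :: "nat \<Rightarrow> real"
    and \<sigma> a b :: real
  defines "Q \<equiv> design_law S \<pi>"
    and "h \<equiv> (\<lambda>k. h_of \<mu> (lam k))"
    and "W \<equiv> (\<lambda>k \<omega>. W_stat (K_kernel \<mu> \<phi> (lam k)) (N k) (\<lambda>i. X i \<omega>) (\<lambda>i. \<epsilon> i \<omega>))"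
    and "\<sigma>N \<equiv> (\<lambda>k. sqrt (prob_space.variance M (W k)))"
  assumes prob: "prob_space M"
    and S: "S \<in> sets borel"
    and model: "regression_model M S \<pi> X Y \<epsilon> f0 \<sigma>2"
    and rkhs: "spectral_rkhs S Q H ip \<mu> \<phi>"
    and f0: "f0 \<in> H"
    and N_eq: "\<And>k. N k = n k * s k"
    and N_lim: "filterlim N at_top sequentially"
    and division: "\<And>k. random_division M (\<lambda>i \<omega>. (Y i \<omega>, X i \<omega>)) (N k) (s k) (n k) (D k)"
    and lam: "\<And>k. 0 < lam k"
    and homoscedastic: "\<And>x. x \<in> S \<Longrightarrow> \<sigma>2 x = \<sigma>\<^sup>2"
    and i: "\<exists>c>0. \<forall>x\<in>S. 0 \<le> \<pi> x \<and> \<pi> x \<le> c \<and> 0 \<le> \<sigma>2 x \<and> \<sigma>2 x \<le> c"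
    and ii: "\<exists>\<tau>>0. \<forall>i\<ge>1. AE \<omega> in M.
               nn_cond_exp M (sigma_of M (X i)) (\<lambda>\<omega>. ennreal ((\<epsilon> i \<omega>) ^ 4)) \<omega> < ennreal \<tau>"
    and iii_\<phi>: "(SUP j\<in>{1..}. sup_norm_on S (\<phi> j)) < \<infinity>"
    and iii_\<mu>: "(SUP k\<in>{1..}. (\<Sum>\<nu>. ennreal (\<mu> (k + 1 + \<nu>))) / ennreal (real k * \<mu> k)) < \<infinity>"
    and ab: "0 \<le> a" "0 \<le> b"
    and iv: "bigO_in_prob M
               (\<lambda>k \<omega>. MAX j\<in>{1..s k}. xi_sup Q H ip (lam k) (D k j \<omega>) (\<lambda>i. X i \<omega>))
               (\<lambda>k. sqrt (ln (real (N k)) powr b / (real (n k) * h k powr a)))"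
    and v_h: "h \<longlonglongrightarrow> 0"
    and v_N: "filterlim (\<lambda>k. real (N k) * (h k)\<^sup>2) at_top sequentially"
    and v_log: "(\<lambda>k. ln (real (N k)) powr b) \<in> o(\<lambda>k. real (n k) * h k powr (a + 1))"
    and H0: "f0 = (\<lambda>_. 0)"
  shows "weak_conv_m
           (\<lambda>k. distr M borel (\<lambda>\<omega>. (real (N k))\<^sup>2 / \<sigma>N k *
              (T_stat Q H ip (lam k) (s k) (\<lambda>j. D k j \<omega>) (\<lambda>i. X i \<omega>) (\<lambda>i. Y i \<omega>)
                 - \<sigma>\<^sup>2 / (real (N k) * h k))))
           std_normal_distribution"
proof -
  obtain \<tau> where \<tau>: "\<tau> > 0" and fourth: "\<forall>i\<ge>1. AE \<omega> in M.
               nn_cond_exp M (sigma_of M (X i)) (\<lambda>\<omega>. ennreal ((\<epsilon> i \<omega>) ^ 4)) \<omega> < ennreal \<tau>"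
    using ii by blast
  interpret null_model M S \<pi> X Y \<epsilon> \<sigma>2 \<sigma> \<tau>
    using prob S model homoscedastic \<tau> fourth unfolding H0
    by (intro null_model.intro null_model_axioms.intro) auto
  define c where "c = enn2real (SUP j\<in>{1..}. sup_norm_on S (\<phi> j))"
  have \<phi>_le: "\<bar>\<phi> i x\<bar> \<le> c" if "1 \<le> i" "x \<in> S" for i x
  proof -
    have "ennreal \<bar>\<phi> i x\<bar> \<le> sup_norm_on S (\<phi> i)" unfolding sup_norm_on_def using that by (intro SUP_upper)
    also have "\<dots> \<le> (SUP j\<in>{1..}. sup_norm_on S (\<phi> j))" using that by (intro SUP_upper) auto
    finally have "enn2real (ennreal \<bar>\<phi> i x\<bar>) \<le> c"
      unfolding c_def using iii_\<phi> by (intro enn2real_mono) auto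
    then show ?thesis by simp
  qed
  have \<mu>0: "0 \<le> \<mu> i" and \<mu>_dec: "\<mu> (Suc i) \<le> \<mu> i" if "1 \<le> i" for i
    using rkhs that by (auto simp: spectral_rkhs_def)
  \<comment> \<open>Convergence of \<open>h\<close> to 0 does not exclude \<open>h k = 0\<close>,
    the value of \<open>inverse\<close> at a vanishing sum; divergence of
    \<open>N * h\<^sup>2\<close> does.\<close>
  have hN: "\<forall>\<^sub>F k in sequentially. h k \<noteq> 0"
    using eventually_gt_at_top[of 0] filterlim_at_top_dense[THEN iffD1, OF v_N, rule_format, of 0]
    by (auto elim: eventually_mono)
  \<comment> \<open>A zero eigenvalue would be followed by zeros only, leaving at most
    \<open>j\<close> shrinkage factors, each at most 1. Then 1/h would be at most \<open>j\<close>
    wherever h is nonzero, against the convergence of h to 0.\<close>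
  have \<mu>_pos: "0 < \<mu> (Suc j)" for j
  proof (rule ccontr)
    assume "\<not> 0 < \<mu> (Suc j)"
    then have z: "\<mu> (Suc j) = 0" using \<mu>0[of "Suc j"] by simp
    have zero: "\<mu> (Suc i) = 0" if "j \<le> i" for i
      using that
    proof (induction i rule: dec_induct)
      case (step i)
      then show ?case using \<mu>_dec[of "Suc i"] \<mu>0[of "Suc (Suc i)"] by simp
    qed (rule z)
    have shrink: "0 \<le> shrinkage \<mu> (lam k) (Suc i)" "shrinkage \<mu> (lam k) (Suc i) \<le> 1" for k i
    proof -
      have "0 \<le> lam k / \<mu> (Suc i)" using lam[of k] \<mu>0[of "Suc i"] by simp
      then show "0 \<le> shrinkage \<mu> (lam k) (Suc i)" "shrinkage \<mu> (lam k) (Suc i) \<le> 1"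
        by (auto simp: shrinkage_def)
    qed
    have sum_le: "(\<Sum>i. shrinkage \<mu> (lam k) (Suc i)) \<le> real j" for k
    proof -
      have "(\<Sum>i. shrinkage \<mu> (lam k) (Suc i)) = (\<Sum>i<j. shrinkage \<mu> (lam k) (Suc i))"
        by (intro suminf_finite) (auto simp: shrinkage_def zero)
      also have "\<dots> \<le> (\<Sum>i<j. 1)"
        by (intro sum_mono shrink)
      finally show ?thesis by simp
    qed
    have "\<forall>\<^sub>F k in sequentially. h k < 1 / (real j + 1)" "\<forall>\<^sub>F k in sequentially. - (1 / (real j + 1)) < h k"
      using order_tendstoD[OF v_h] by auto
    then have "\<forall>\<^sub>F k in sequentially. False"
      using hN
    proof eventually_elim
      case (elim k)
      define x where "x = (\<Sum>i. shrinkage \<mu> (lam k) (Suc i))"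
      have hx: "h k = inverse x" by (simp add: h_def h_of_def x_def)
      have x: "x \<le> real j" using sum_le by (simp add: x_def)
      have x0: "0 \<le> x"
      proof -
        have "x = (\<Sum>i<j. shrinkage \<mu> (lam k) (Suc i))"
          unfolding x_def by (intro suminf_finite) (auto simp: shrinkage_def zero)
        also have "\<dots> \<ge> 0" by (intro sum_nonneg shrink)
        finally show ?thesis .
      qed
      have "x \<noteq> 0" using elim(3) hx by auto
      then have "x > 0" using x0 by simp
      then have "1 < x * (1 / (real j + 1)) * (real j + 1) \<or> 1 / (real j + 1) \<le> 1 / x"
        using x by (intro disjI2 divide_left_mono) auto
      then show False using elim(1) hx x \<open>x > 0\<close> by (auto simp: inverse_eq_divide field_simps)
    qed
    then show False by simp
  qed
  define C where "C = enn2real (SUP k\<in>{1..}. (\<Sum>\<nu>. ennreal (\<mu> (k + 1 + \<nu>))) / ennreal (real k * \<mu> k))"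
  have C0: "0 \<le> C" by (simp add: C_def)
  have tail_enn: "(\<Sum>\<nu>. ennreal (\<mu> (k + 1 + \<nu>))) \<le> ennreal (C * (real k * \<mu> k))" if k: "1 \<le> k" for k
  proof -
    let ?x = "\<Sum>\<nu>. ennreal (\<mu> (k + 1 + \<nu>))" and ?y = "ennreal (real k * \<mu> k)"
    have pos: "0 < real k * \<mu> k" using \<mu>_pos[of "k - 1"] k by simp
    have "?x / ?y \<le> (SUP k\<in>{1..}. (\<Sum>\<nu>. ennreal (\<mu> (k + 1 + \<nu>))) / ennreal (real k * \<mu> k))"
      using k by (intro SUP_upper) auto
    also have "\<dots> = ennreal C" unfolding C_def using iii_\<mu> by (subst ennreal_enn2real) auto
    finally have "(?x / ?y) * ?y \<le> ennreal C * ?y" by (rule mult_right_mono) simp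
    moreover have "ennreal y / ennreal y = 1" if "0 < y" for y :: real
      using that by (intro ennreal_divide_self) auto
    from this[OF pos] have "(?x / ?y) * ?y = ?x" unfolding ennreal_divide_times by simp
    ultimately show ?thesis using C0 by (simp add: ennreal_mult')
  qed
  \<comment> \<open>A finite ratio with a positive denominator forces a finite numerator in the
    extended reals; \<open>k = 1\<close> then gives summability of all eigenvalues.\<close>
  have \<mu>_tail_sum: "summable (\<lambda>\<nu>. \<mu> (k + 1 + \<nu>))" if "1 \<le> k" for k
  proof (rule summable_suminf_not_top)
    show "0 \<le> \<mu> (k + 1 + i)" for i by (rule \<mu>0) simp
    show "(\<Sum>\<nu>. ennreal (\<mu> (k + 1 + \<nu>))) \<noteq> top" using tail_enn[OF that] by (auto simp: top_unique)
  qed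
  have \<mu>_sum: "summable (\<lambda>i. \<mu> (Suc i))"
    using \<mu>_tail_sum[of 1] by (subst summable_Suc_iff[symmetric]) simp
  have tail: "(\<Sum>\<nu>. \<mu> (Suc (\<nu> + k))) \<le> C * real k * \<mu> k" if k: "1 \<le> k" for k
  proof -
    have "ennreal (\<Sum>\<nu>. \<mu> (k + 1 + \<nu>)) = (\<Sum>\<nu>. ennreal (\<mu> (k + 1 + \<nu>)))"
      by (rule suminf_ennreal2[symmetric, OF \<mu>0 \<mu>_tail_sum[OF k]]) simp
    then have "ennreal (\<Sum>\<nu>. \<mu> (k + 1 + \<nu>)) \<le> ennreal (C * (real k * \<mu> k))" using tail_enn[OF k] by simp
    then have "(\<Sum>\<nu>. \<mu> (k + 1 + \<nu>)) \<le> C * (real k * \<mu> k)"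
      using C0 \<mu>0[OF k] by (subst (asm) ennreal_le_iff) auto
    then show ?thesis by (simp add: add.commute mult.assoc)
  qed
  have bo: "bounded_orthonormal S Q \<phi> c"
  proof (rule bounded_orthonormal.intro)
    show "prob_space Q" unfolding Q_def by (rule prob_design)
    show "sets Q = sets (restrict_space borel S)"
      unfolding Q_def design_law_def by (simp cong: sets_restrict_space_cong)
    show "S \<in> sets borel" by fact
    show "orthonormal_basis_L2 Q \<phi>" using rkhs by (simp add: spectral_rkhs_def)
    show "\<phi> i \<in> functions_on S" if "1 \<le> i" for i
      using rkhs that by (simp add: spectral_rkhs_def)
  qed (rule \<phi>_le)
  have R: "null_ridge M S \<pi> X Y \<epsilon> \<sigma>2 \<sigma> \<tau> \<phi> c H ip \<mu> (lam k)" for k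
    using bo rkhs \<mu>_pos \<mu>_sum lam[of k] unfolding Q_def
    by (intro null_ridge.intro null_model_axioms ridge.intro spectral.intro spectral_axioms.intro ridge_axioms.intro)
       (auto intro: null_model.axioms null_model_axioms)
  define A where "A k = (\<Sum>i. shrinkage \<mu> (lam k) (Suc i))" for k
  define A2 where "A2 k = (\<Sum>i. shrinkage \<mu> (lam k) (Suc i) * shrinkage \<mu> (lam k) (Suc i))" for k
  have hA: "h k = inverse (A k)" for k by (simp add: h_def h_of_def A_def)
  have A0: "0 \<le> A k" for k
  proof -
    interpret R: null_ridge M S \<pi> X Y \<epsilon> \<sigma>2 \<sigma> \<tau> \<phi> c H ip \<mu> "lam k" by (rule R)
    show ?thesis unfolding A_def by (rule suminf_nonneg[OF R.shrinkage_facts(2) R.shrinkage_facts(1)])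
  qed
  define Z where "Z k \<omega> = (real (N k))\<^sup>2 / \<sigma>N k *
              (T_stat Q H ip (lam k) (s k) (\<lambda>j. D k j \<omega>) (\<lambda>i. X i \<omega>) (\<lambda>i. Y i \<omega>)
                 - \<sigma>\<^sup>2 / (real (N k) * h k))" for k \<omega>
  have Zm: "Z k \<in> borel_measurable M" for k
  proof -
    interpret R: null_ridge M S \<pi> X Y \<epsilon> \<sigma>2 \<sigma> \<tau> \<phi> c H ip \<mu> "lam k" by (rule R)
    have "(\<lambda>\<omega>. T_stat Q H ip (lam k) (s k) (\<lambda>j. D k j \<omega>) (\<lambda>i. X i \<omega>) (\<lambda>i. Y i \<omega>)) \<in> borel_measurable M"
      using R.T_measurable[OF division N_eq, of k] unfolding R.T_def[OF division N_eq, abs_def] Q_def .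
    then show ?thesis unfolding Z_def[abs_def] by measurable
  qed
  have Z_eq: "Z k \<omega> = (real (N k))\<^sup>2 / sqrt (variance (null_ridge.W X \<epsilon> \<phi> \<mu> (lam k) (N k))) *
              (T_stat (design_law S \<pi>) H ip (lam k) (s k) (\<lambda>j. D k j \<omega>) (\<lambda>i. X i \<omega>) (\<lambda>i. Y i \<omega>)
                 - \<sigma>\<^sup>2 * A k / real (N k))" for k \<omega>
  proof -
    have "W k = null_ridge.W X \<epsilon> \<phi> \<mu> (lam k) (N k)"
      unfolding W_def null_ridge.W_def[OF R, abs_def] ..
    then show ?thesis unfolding Z_def \<sigma>N_def Q_def hA by (simp add: divide_inverse mult_ac)
  qed
  \<comment> \<open>Once \<open>A k \<ge> 2 * (1 + C)\<close>, the additive term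
    \<open>1 + C\<close> of \<open>shrinkage_square_sum\<close> is at most half of
    \<open>A k\<close>; absorbing it doubles the factor \<open>4 * (1 + C)\<close>.\<close>
  define Ck where "Ck = 8 * (1 + C)"
  have Ck: "0 < Ck" using C0 by (simp add: Ck_def)
  have h_small: "\<forall>\<^sub>F k in sequentially. h k < e" if "0 < e" for e
    using order_tendstoD(2)[OF v_h that] .
  have h_pos: "\<forall>\<^sub>F k in sequentially. 0 < h k"
    using hN by eventually_elim (use A0 hA in \<open>auto simp: less_le\<close>)
  have C_small: "0 < 1 / (2 * (1 + C))" using C0 by simp
  have A_large: "\<forall>\<^sub>F k in sequentially. 1 \<le> A k \<and> A k \<le> Ck * A2 k"
    using h_pos h_small[OF C_small] h_small[OF zero_less_one]
  proof eventually_elim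
    case (elim k)
    interpret R: null_ridge M S \<pi> X Y \<epsilon> \<sigma>2 \<sigma> \<tau> \<phi> c H ip \<mu> "lam k" by (rule R)
    have Ap: "0 < A k" using elim(1) hA[of k] by simp
    have "1 < A k" using elim(3) Ap hA[of k] by (simp add: field_simps)
    moreover have "2 * (1 + C) \<le> A k" using elim(2) Ap hA[of k] C0 by (simp add: field_simps)
    moreover have "A k \<le> (1 + C) * (4 * A2 k + 1)"
      using R.shrinkage_square_sum[OF C0 _ tail] \<mu>_dec unfolding A_def A2_def power2_eq_square by simp
    ultimately show ?case by (simp add: Ck_def algebra_simps)
  qed
  define u where "u k = A k / real (N k)" for k
  \<comment> \<open>\<open>u k\<close> is 1 / (N h), and \<open>N * h\<^sup>2 \<le> N * h\<close>
    once h lies between 0 and 1.\<close>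
  have u0: "u \<longlonglongrightarrow> 0"
  proof -
    have "filterlim (\<lambda>k. real (N k) * h k) at_top sequentially"
    proof (rule filterlim_at_top_mono[OF v_N])
      show "\<forall>\<^sub>F k in sequentially. real (N k) * (h k)\<^sup>2 \<le> real (N k) * h k"
        using h_pos h_small[OF zero_less_one]
        by eventually_elim (auto intro!: mult_left_mono simp: power2_eq_square mult_left_le)
    qed
    then have "(\<lambda>k. inverse (real (N k) * h k)) \<longlonglongrightarrow> 0" by (rule tendsto_inverse_0_at_top)
    moreover have "inverse (real (N k) * h k) = u k" for k by (simp add: u_def hA divide_inverse mult.commute)
    ultimately show ?thesis by simp
  qed
  have N_inv: "(\<lambda>k. 1 / real (N k)) \<longlonglongrightarrow> 0"
    using tendsto_inverse_0_at_top[OF filterlim_compose[OF filterlim_real_sequentially N_lim]] by (simp add: inverse_eq_divide)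
  have N_large: "\<forall>\<^sub>F k in sequentially. 2 \<le> N k"
    using N_lim by (auto simp: filterlim_at_top)
  show ?thesis
    unfolding Z_def[symmetric]
  proof (rule levy_continuity)
    show "real_distribution (distr M borel (Z k))" for k
      by (rule real_distribution_distr) (rule Zm)
    show "real_distribution std_normal_distribution" by (rule real_dist_normal_dist)
    fix t
    have charZ: "char (distr M borel (Z k)) t = expectation (\<lambda>\<omega>. iexp (t * Z k \<omega>))" for k
      unfolding char_def using Zm by (subst integral_distr) auto
    define \<rho> where "\<rho> k = \<tau>^2 * c^6 * Ck^2 / \<sigma>^8 * u k" for k
    define rem where "rem k = 13 / 3 * \<bar>t\<bar>^3 * sqrt (\<rho> k) + 2 * t^2 * sqrt (8 * (Ck^2 * h k) + 2 * \<rho> k) + 2 * t^4 * (1 / real (N k))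
        + \<bar>t\<bar> * (sqrt Ck / \<sigma>^2 * (sqrt \<tau> * c^2 * sqrt (u k)))" for k
    have rem0: "rem \<longlonglongrightarrow> 0"
    proof -
      have "\<rho> \<longlonglongrightarrow> \<tau>^2 * c^6 * Ck^2 / \<sigma>^8 * 0" unfolding \<rho>_def by (intro tendsto_mult tendsto_const u0)
      then have r: "\<rho> \<longlonglongrightarrow> 0" by simp
      have "rem \<longlonglongrightarrow> 13 / 3 * \<bar>t\<bar>^3 * sqrt 0 + 2 * t^2 * sqrt (8 * (Ck^2 * 0) + 2 * 0) + 2 * t^4 * 0
        + \<bar>t\<bar> * (sqrt Ck / \<sigma>^2 * (sqrt \<tau> * c^2 * sqrt 0))"
        unfolding rem_def by (intro tendsto_add tendsto_mult tendsto_const tendsto_real_sqrt r v_h u0 N_inv)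
      then show ?thesis by simp
    qed
    have bound: "\<forall>\<^sub>F k in sequentially. cmod (expectation (\<lambda>\<omega>. iexp (t * Z k \<omega>)) - exp (- (t^2 / 2))) \<le> rem k + (\<bar>t\<bar> * (3 * sqrt Ck) + 2) * \<eta>"
      if \<eta>: "0 < \<eta>" "\<eta> \<le> 1" for \<eta>
    proof -
      define r where "r k = sqrt (ln (real (N k)) powr b / (real (n k) * h k powr a))" for k
      from iv[unfolded bigO_in_prob_def, rule_format, OF \<eta>(1)] obtain C' where C': "C' > 0"
        and ev: "\<forall>\<^sub>F k in sequentially. \<exists>U\<in>sets M. {\<omega>\<in>space M. C' * r k < \<bar>MAX j\<in>{1..s k}. xi_sup Q H ip (lam k) (D k j \<omega>) (\<lambda>i. X i \<omega>)\<bar>} \<subseteq> U \<and> prob U \<le> \<eta>"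
        unfolding r_def by blast
      \<comment> \<open>The 1/4 keeps \<open>C' * r k\<close> at most 1/2. The other entry makes
        \<open>4 * c\<^sup>2 * A k * (C' * r k)\<^sup>2\<close> at most
        \<open>\<eta>\<^sup>2\<close>, using \<open>A k * h k = 1\<close>; its added 1 covers
        \<open>c = 0\<close>. Division by \<open>C'\<^sup>2\<close> offsets the constant of the
        stochastic order.\<close>
      define e where "e = min (1/4) (\<eta>^2 / (4 * c^2 + 1)) / C'^2"
      have c1: "0 < 4 * c^2 + 1" by (simp add: add_nonneg_pos)
      have e: "e > 0" unfolding e_def using \<eta> C' c1 by (intro divide_pos_pos) (auto simp: min_less_iff_conj)
      have "\<forall>\<^sub>F k in sequentially. norm (ln (real (N k)) powr b) \<le> e * norm (real (n k) * h k powr (a + 1))"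
        by (rule landau_o.smallD[OF v_log e])
      then show ?thesis
        using ev A_large h_pos h_small[OF zero_less_one] N_large
      proof eventually_elim
        case (elim k)
        interpret R: null_ridge M S \<pi> X Y \<epsilon> \<sigma>2 \<sigma> \<tau> \<phi> c H ip \<mu> "lam k" by (rule R)
        from elim(2) obtain U where U: "U \<in> sets M" "{\<omega>\<in>space M. C' * r k < \<bar>MAX j\<in>{1..s k}. xi_sup Q H ip (lam k) (D k j \<omega>) (\<lambda>i. X i \<omega>)\<bar>} \<subseteq> U" "prob U \<le> \<eta>"
          by blast
        have ns: "0 < n k" "1 \<le> s k" using elim(6) N_eq[of k] by (auto simp: Suc_le_eq intro: Nat.gr0I)
        define L where "L = ln (real (N k)) powr b"
        have L0: "0 \<le> L" by (simp add: L_def)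
        have hpk: "0 < h k" and hpa: "0 < h k powr a" and hpa1: "h k powr (a + 1) = h k powr a * h k"
          using elim(4) by (auto simp: powr_add)
        have L_le: "L \<le> e * (real (n k) * h k powr a * h k)"
          using elim(1) ns hpk hpa unfolding L_def[symmetric] hpa1 using L0 by (simp add: abs_mult mult.assoc)
        have den: "0 < real (n k) * h k powr a" using ns hpa by simp
        have "(r k)^2 = L / (real (n k) * h k powr a)"
          unfolding r_def L_def[symmetric] using L0 den by simp
        also have "\<dots> \<le> e * h k" using L_le den by (simp add: field_simps)
        finally have "C'^2 * (r k)^2 \<le> C'^2 * (e * h k)" by (intro mult_left_mono) auto
        also have "\<dots> = min (1/4) (\<eta>^2 / (4 * c^2 + 1)) * h k" using C' by (simp add: e_def)
        finally have Cr: "(C' * r k)^2 \<le> min (1/4) (\<eta>^2 / (4 * c^2 + 1)) * h k" by (simp add: power_mult_distrib)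
        have Ah: "A k * h k = 1" using hA[of k] elim(3) by simp
        have r0: "0 \<le> C' * r k" using C' L0 den unfolding r_def L_def[symmetric] by simp
        have "(C' * r k)^2 \<le> (1/4) * 1"
          by (rule order_trans[OF Cr]) (use hpk elim(5) in \<open>intro mult_mono min.cobounded1, auto\<close>)
        then have r1: "C' * r k \<le> 1/2" by (intro power2_le_imp_le[of "C' * r k" "1/2"]) (simp_all add: power_divide)
        have Cr2: "(C' * r k)^2 \<le> (\<eta>^2 / (4 * c^2 + 1)) * h k"
          by (rule order_trans[OF Cr mult_right_mono[OF min.cobounded2]]) (use hpk in simp)
        have "4 * c^2 * A k * (C' * r k)^2 \<le> 4 * c^2 * A k * ((\<eta>^2 / (4 * c^2 + 1)) * h k)"
          using A0[of k] by (intro mult_left_mono Cr2) auto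
        also have "\<dots> = 4 * c^2 * (\<eta>^2 / (4 * c^2 + 1)) * (A k * h k)" by (simp only: mult_ac)
        also have "\<dots> = \<eta>^2 * (4 * c^2 / (4 * c^2 + 1))" unfolding Ah by simp
        also have "\<dots> \<le> \<eta>^2 * 1" using c1 by (intro mult_left_mono) (auto simp: field_simps)
        finally have r2: "4 * c^2 * A k * (C' * r k)^2 \<le> \<eta>^2" by simp
        have Ainv: "Ck^2 / A k = Ck^2 * h k" by (simp add: hA divide_inverse)
        note bd = R.char_T_bound[OF division N_eq elim(6) ns(2) Ck _ _ \<eta> r0 r1 _ U(1) _ U(3), of t,
            folded A_def A2_def, folded Z_eq]
        have "cmod (expectation (\<lambda>\<omega>. iexp (t * Z k \<omega>)) - exp (- (t^2 / 2)))
          \<le> (13 / 3 * \<bar>t\<bar>^3 * sqrt (\<rho> k) + 2 * t^2 * sqrt (8 * (Ck^2 / A k) + 2 * \<rho> k) + 2 * t^4 / real (N k)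
            + \<bar>t\<bar> * (sqrt Ck / \<sigma>^2 * (sqrt \<tau> * c^2 * sqrt (u k)))) + (\<bar>t\<bar> * (3 * sqrt Ck) + 2) * \<eta>"
          unfolding \<rho>_def u_def by (rule bd) (use elim(3) r2 U(2) in \<open>simp_all add: Q_def\<close>)
        then show ?case by (simp add: rem_def Ainv)
      qed
    qed
    have "(\<lambda>k. expectation (\<lambda>\<omega>. iexp (t * Z k \<omega>))) \<longlonglongrightarrow> exp (- (t^2 / 2))"
    proof (rule LIM_zero_cancel, rule tendstoI)
      fix e :: real assume e: "0 < e"
      define K where "K = \<bar>t\<bar> * (3 * sqrt Ck) + 2"
      have K: "0 < K" using Ck by (simp add: K_def add_nonneg_pos)
      \<comment> \<open>The order of limits matters: \<eta> is fixed first, since the constant of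
        the stochastic order depends on it, and only then does k tend to infinity.\<close>
      define \<eta> where "\<eta> = min 1 (e / (2 * K))"
      have \<eta>: "0 < \<eta>" "\<eta> \<le> 1" "K * \<eta> \<le> e / 2"
        using e K by (auto simp: \<eta>_def min_less_iff_conj field_simps min_def)
      have "\<forall>\<^sub>F k in sequentially. rem k < e / 2"
        using order_tendstoD(2)[OF rem0, of "e / 2"] e by simp
      with bound[OF \<eta>(1,2)] show "\<forall>\<^sub>F k in sequentially. dist (expectation (\<lambda>\<omega>. iexp (t * Z k \<omega>)) - exp (- (t^2 / 2))) 0 < e"
        by eventually_elim (use \<eta>(3) in \<open>simp add: K_def[symmetric]\<close>)
    qed
    then show "(\<lambda>k. char (distr M borel (Z k)) t) \<longlonglongrightarrow> char std_normal_distribution t"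
      unfolding charZ char_std_normal_distribution by simp
  qed
qed

end
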